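(* Let $f$ be a Hecke-holomorphic or Hecke-Maass cusp form for $\mathrm{SL}(2,\mathbb{Z})$ with normalized Fourier coefficients $\mathcal{A}_f(n)$, and let $\ell_1,\ell_2>4$ be integers. For every (arbitrarily small) $\varepsilon>0$ there is a constant $C=C(f,\ell_1,\ell_2,\varepsilon)>0$ such that for all real $X,Y\geqslant 1$ with $Y<X^{1-\varepsilon}$, $$\left|\sum_{1\leqslant n\leqslant X}\ \sum_{1\leqslant m\leqslant Y}r_{\ell_1}(n)\,r_{\ell_2}(m)\,\mathcal{A}_f(n+m)\right|\leqslant C\,\frac{X^{3/8}}{Y^{3/4}}\,\left(X^{\ell_1/2}Y^{\ell_2/2}\right)^{1+\varepsilon}.$$ This bound is non-trivial in the range $X^{1/2}<Y<X^{1-\varepsilon}$, i.e. there the factor $X^{3/8}/Y^{3/4}$ is less than $1$.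
   Context: Fourier coefficients: write $e(x)=e^{2\pi i x}$. If $f$ is a primitive holomorphic Hecke eigen-cusp form of integral weight $\kappa$ for $\mathrm{SL}(2,\mathbb{Z})$, the $\mathcal{A}_f(n)$ are defined by $f(z)=\sum_{n\geqslant 1}\mathcal{A}_f(n)n^{(\kappa-1)/2}e(nz)$ with $\mathcal{A}_f(1)=1$. If $f$ is a primitive Hecke-Maass cusp form for $\mathrm{SL}(2,\mathbb{Z})$ with Laplace eigenvalue $\tfrac14+\nu^2$, they are defined by $f(x+iy)=2\sqrt{y}\sum_{n\neq 0}\mathcal{A}_f(n)K_{i\nu}(2\pi|n|y)e(nx)$ with $\mathcal{A}_f(1)=1$, where $K_{i\nu}$ is the $K$-Bessel function. For $\ell\in\mathbb{N}$, $r_\ell(n)=|\{(n_1,\dots,n_\ell)\in\mathbb{Z}^\ell: n_1^2+\cdots+n_\ell^2=n\}|$. *)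

theory Defs
  imports "HOL-Complex_Analysis.Complex_Analysis" "HOL-Library.Landau_Symbols"
begin

definition upper_half_plane :: "complex set" where
  "upper_half_plane = {z. Im z > 0}"

definition e :: "complex \<Rightarrow> complex" where
  "e z = exp (2 * of_real pi * \<i> * z)"

(* Weight k modularity for SL(2,Z); weight 0 is plain invariance. *)
definition modular_weight :: "int \<Rightarrow> (complex \<Rightarrow> complex) \<Rightarrow> bool" where
  "modular_weight k f \<longleftrightarrow>
     (\<forall>a b c d :: int. a * d - b * c = 1 \<longrightarrow>
        (\<forall>z\<in>upper_half_plane.
           f ((of_int a * z + of_int b) / (of_int c * z + of_int d)) =
             (of_int c * z + of_int d) powi k * f z))"

text \<open>Holomorphic forms\<close>

definition holomorphic_cusp_form :: "int \<Rightarrow> (complex \<Rightarrow> complex) \<Rightarrow> bool" where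
  "holomorphic_cusp_form k f \<longleftrightarrow>
     f holomorphic_on upper_half_plane \<and>
     modular_weight k f \<and>
     (f \<longlongrightarrow> 0) (filtercomap Im at_top)"

(* Sum over the upper triangular representatives (a b; 0 d), a d = n, 0 <= b < d. *)
definition hecke_holomorphic ::
    "int \<Rightarrow> nat \<Rightarrow> (complex \<Rightarrow> complex) \<Rightarrow> complex \<Rightarrow> complex" where
  "hecke_holomorphic k n f z =
     of_nat n powi (k - 1) *
       (\<Sum>d | d dvd n. of_nat d powi (- k) *
          (\<Sum>b<d. f ((of_nat (n div d) * z + of_nat b) / of_nat d)))"

definition hecke_holomorphic_cusp_form :: "int \<Rightarrow> (complex \<Rightarrow> complex) \<Rightarrow> bool" where
  "hecke_holomorphic_cusp_form k f \<longleftrightarrow>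
     holomorphic_cusp_form k f \<and>
     (\<exists>z\<in>upper_half_plane. f z \<noteq> 0) \<and>
     (\<forall>n\<ge>1. \<exists>c. \<forall>z\<in>upper_half_plane. hecke_holomorphic k n f z = c * f z)"

(* A is indexed by the integers so that one type serves holomorphic and Maass forms;
   here its values at n <= 0 are irrelevant. *)
definition holomorphic_coeffs ::
    "int \<Rightarrow> (complex \<Rightarrow> complex) \<Rightarrow> (int \<Rightarrow> complex) \<Rightarrow> bool" where
  "holomorphic_coeffs k f A \<longleftrightarrow>
     A 1 = 1 \<and>
     (\<forall>z\<in>upper_half_plane.
        ((\<lambda>n. A n * of_real (of_int n powr ((of_int k - 1) / 2)) * e (of_int n * z))
           has_sum f z) {1..})"

text \<open>Maass forms\<close>

definition dx :: "(complex \<Rightarrow> complex) \<Rightarrow> complex \<Rightarrow> complex" where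
  "dx f z = vector_derivative (\<lambda>t. f (z + of_real t)) (at 0)"

definition dy :: "(complex \<Rightarrow> complex) \<Rightarrow> complex \<Rightarrow> complex" where
  "dy f z = vector_derivative (\<lambda>t. f (z + \<i> * of_real t)) (at 0)"

(* C^k and smoothness in the real sense, for the two real variables x and y. *)
primrec Ck_on :: "nat \<Rightarrow> (complex \<Rightarrow> complex) \<Rightarrow> complex set \<Rightarrow> bool" where
  "Ck_on 0 f S \<longleftrightarrow> continuous_on S f"
| "Ck_on (Suc k) f S \<longleftrightarrow>
     (\<forall>z\<in>S. f differentiable (at z)) \<and> Ck_on k (dx f) S \<and> Ck_on k (dy f) S"

definition smooth_on :: "(complex \<Rightarrow> complex) \<Rightarrow> complex set \<Rightarrow> bool" where
  "smooth_on f S \<longleftrightarrow> (\<forall>k. Ck_on k f S)"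

definition hyp_laplacian :: "(complex \<Rightarrow> complex) \<Rightarrow> complex \<Rightarrow> complex" where
  "hyp_laplacian f z = - (of_real (Im z))\<^sup>2 * (dx (dx f) z + dy (dy f) z)"

definition maass_cusp_form :: "complex \<Rightarrow> (complex \<Rightarrow> complex) \<Rightarrow> bool" where
  "maass_cusp_form \<nu> f \<longleftrightarrow>
     smooth_on f upper_half_plane \<and>
     modular_weight 0 f \<and>
     (\<forall>z\<in>upper_half_plane. hyp_laplacian f z = (1 / 4 + \<nu>\<^sup>2) * f z) \<and>
     (\<exists>N::nat. f \<in> O[filtercomap Im at_top](\<lambda>z. of_real (Im z) ^ N)) \<and>
     (\<forall>y>0. integral {0..1} (\<lambda>x. f (Complex x y)) = 0)"

definition hecke_maass :: "nat \<Rightarrow> (complex \<Rightarrow> complex) \<Rightarrow> complex \<Rightarrow> complex" where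
  "hecke_maass n f z =
     (\<Sum>d | d dvd n. \<Sum>b<d. f ((of_nat (n div d) * z + of_nat b) / of_nat d))
       / of_real (sqrt (real n))"

definition hecke_maass_cusp_form :: "complex \<Rightarrow> (complex \<Rightarrow> complex) \<Rightarrow> bool" where
  "hecke_maass_cusp_form \<nu> f \<longleftrightarrow>
     maass_cusp_form \<nu> f \<and>
     (\<exists>z\<in>upper_half_plane. f z \<noteq> 0) \<and>
     (\<forall>n\<ge>1. \<exists>c. \<forall>z\<in>upper_half_plane. hecke_maass n f z = c * f z)"

(* K-Bessel function of complex order s at x > 0, by its standard integral representation. *)
definition bessel_K :: "complex \<Rightarrow> real \<Rightarrow> complex" where
  "bessel_K s x = integral {0..} (\<lambda>t. of_real (exp (- x * cosh t)) * cosh (s * of_real t))"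

definition maass_coeffs ::
    "complex \<Rightarrow> (complex \<Rightarrow> complex) \<Rightarrow> (int \<Rightarrow> complex) \<Rightarrow> bool" where
  "maass_coeffs \<nu> f A \<longleftrightarrow>
     A 1 = 1 \<and>
     (\<forall>x y. y > 0 \<longrightarrow>
        ((\<lambda>n. 2 * of_real (sqrt y) * A n *
              bessel_K (\<i> * \<nu>) (2 * pi * \<bar>of_int n\<bar> * y) * e (of_int n * of_real x))
           has_sum f (Complex x y)) {n. n \<noteq> 0})"

definition r :: "nat \<Rightarrow> nat \<Rightarrow> nat" where
  "r l n = card {v :: int list. length v = l \<and> (\<Sum>x\<leftarrow>v. x\<^sup>2) = int n}"

end

theory Submission
  imports Defs
begin

text \<open>
  The bound comes from the circle method without any dissection of the circle.  Let \<open>R1\<close> and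
  \<open>R2\<close> be the trigonometric polynomials with coefficients \<open>r l1 n\<close> (\<open>n \<le> X\<close>) and \<open>r l2 m\<close>
  (\<open>m \<le> Y\<close>).  Orthogonality turns the double sum into the integral over one period of
  \<open>R1(-x) R2(-x)\<close> against the Fourier series \<open>H\<close> of the coefficients \<open>A\<close>.  By Cauchy-Schwarz and
  Parseval this is at most \<open>sup |H|\<close> times the product of the \<open>L2\<close> norms of \<open>r l1\<close> and
  \<open>r l2\<close>.  There is square root cancellation in \<open>H\<close>, uniformly in \<open>x\<close>, so \<open>sup |H|\<close> costs
  \<open>X powr (1/2)\<close>, while the two norms are about \<open>X powr ((l1 - 1)/2)\<close> and
  \<open>Y powr ((l2 - 1)/2)\<close>.  The result is \<open>X powr (l1/2) * Y powr (l2/2)\<close> with the factor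
  \<open>Y powr (-1/2)\<close>, and since \<open>Y \<le> X\<close> this beats \<open>X powr (3/8) * Y powr (-3/4)\<close> with room to lose
  small powers of \<open>X\<close>.

  The cancellation is used in the form \<open>hankel_bounded\<close>: the matrix \<open>A (n + m) (n + m) powr (-s)\<close>
  with \<open>s = 1/2 + \<delta>\<close> is bounded on \<open>l2\<close>.  The function \<open>|f(x + iy)| y powr (k/2)\<close> is bounded on the
  upper half plane (\<open>k\<close> the weight, \<open>k = 0\<close> for Maass forms), because it is invariant under the
  modular group and small high up in the half plane.  Integrating \<open>f(x + iy)\<close> against
  \<open>y powr (k/2 + \<delta> - 1)\<close> in \<open>y\<close> therefore gives a bounded function of \<open>x\<close>, and its \<open>n\<close>-th Fourier
  coefficient is \<open>A n * n powr (-s)\<close> times a constant, a Mellin transform of the exponential function or of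
  the K-Bessel function (lemma \<open>hankel_bounded_mellin\<close>).  The power is removed by writing
  \<open>k powr s\<close> as \<open>k\<close> times a Laplace integral of \<open>exp (- k t)\<close>; for \<open>k = n + m\<close> each piece
  factors into a function of \<open>n\<close> and a function of \<open>m\<close> (lemma \<open>hankel_bounded_untwist\<close>).

  For Maass forms the constant must be shown not to vanish.  It is \<open>Gamma s\<close> times the integral of
  \<open>cosh (\<mu> t) / cosh t powr s\<close>, where \<open>\<mu> = \<i> \<nu>\<close>.  The integral satisfies a recurrence in \<open>s\<close> of step 2, so a zero at \<open>s\<close>
  would propagate to \<open>s + 2 j\<close> for all \<open>j\<close>, where Laplace's method shows that there is none.
  The integral makes sense only for \<open>|Re \<mu>| < s\<close>.  This holds because the first Fourier
  coefficient of the bounded function \<open>f\<close> is \<open>2 sqrt y K(2 \<pi> y)\<close>, which would be unbounded as \<open>y\<close>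
  tends to 0 if \<open>|Re \<mu>| > 1/2\<close>.

  The mean square of \<open>r l\<close> is reduced by Cauchy-Schwarz to that of \<open>r 2\<close>, which counts
  the solutions of \<open>x y = z w\<close> in a box.
\<close>

section \<open>Mean squares of representation numbers\<close>

lemma finite_lists_with_sum_of_squares: "finite {v::int list. length v = l \<and> (\<Sum>x\<leftarrow>v. x\<^sup>2) = j}"
proof -
  have "{v::int list. length v = l \<and> (\<Sum>x\<leftarrow>v. x\<^sup>2) = j} \<subseteq> {v. set v \<subseteq> {-j..j} \<and> length v = l}"
  proof safe
    fix v :: "int list" and x assume x: "x \<in> set v" and j: "j = (\<Sum>x\<leftarrow>v. x\<^sup>2)"
    have "x\<^sup>2 \<le> (\<Sum>x\<leftarrow>v. x\<^sup>2)"
      using x by (intro member_le_sum_list) auto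
    moreover have "\<bar>x\<bar> \<le> x\<^sup>2"
      using self_le_power[of "\<bar>x\<bar>" 2] by (cases "x = 0") auto
    ultimately show "x \<in> {- (\<Sum>x\<leftarrow>v. x\<^sup>2)..(\<Sum>x\<leftarrow>v. x\<^sup>2)}" by auto
  qed
  then show ?thesis
    by (rule finite_subset) (simp add: finite_lists_length_eq)
qed

text \<open>
  The argument is an integer so that the recursion in \<open>l\<close> subtracts squares without
  truncation: a negative argument has no representation.
\<close>
definition reps :: "nat \<Rightarrow> int \<Rightarrow> nat" where
  "reps l j = card {v :: int list. length v = l \<and> (\<Sum>x\<leftarrow>v. x\<^sup>2) = j}"

lemma r_eq_reps: "r l n = reps l (int n)"
  by (simp add: r_def reps_def)

lemma reps_neg: "j < 0 \<Longrightarrow> reps l j = 0"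
proof -
  assume "j < 0"
  moreover have "(\<Sum>x\<leftarrow>v. x\<^sup>2) \<ge> 0" for v :: "int list"
    by (intro sum_list_nonneg) auto
  ultimately have "{v :: int list. length v = l \<and> (\<Sum>x\<leftarrow>v. x\<^sup>2) = j} = {}"
    by (smt (verit) Collect_empty_eq)
  then show ?thesis unfolding reps_def by (simp only: card.empty)
qed

lemma reps_Suc:
  fixes D :: int
  assumes "j < (D + 1)\<^sup>2" "D \<ge> 0"
  shows "reps (Suc l) j = (\<Sum>a\<in>{-D..D}. reps l (j - a\<^sup>2))"
proof -
  let ?V = "\<lambda>l j. {v :: int list. length v = l \<and> (\<Sum>x\<leftarrow>v. x\<^sup>2) = j}"
  have "bij_betw (\<lambda>(a, v). a # v) (SIGMA a:{-D..D}. ?V l (j - a\<^sup>2)) (?V (Suc l) j)"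
  proof (rule bij_betw_imageI)
    show "(\<lambda>(a, v). a # v) ` (SIGMA a:{-D..D}. ?V l (j - a\<^sup>2)) = ?V (Suc l) j"
    proof safe
      fix v :: "int list" assume v: "length v = Suc l" "j = (\<Sum>x\<leftarrow>v. x\<^sup>2)"
      then obtain a w where w: "v = a # w" by (cases v) auto
      have "(\<Sum>x\<leftarrow>w. x\<^sup>2) \<ge> 0" by (intro sum_list_nonneg) auto
      then have "a\<^sup>2 < (D+1)\<^sup>2" using v w assms by simp
      then have "\<bar>a\<bar> < D + 1" using assms(2) power2_less_imp_less[of "\<bar>a\<bar>" "D + 1"] by simp
      then show "v \<in> (\<lambda>(a, v). a # v) ` (SIGMA a:{-D..D}. ?V l ((\<Sum>x\<leftarrow>v. x\<^sup>2) - a\<^sup>2))"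
        using v w by (intro image_eqI[of _ _ "(a, w)"]) auto
    qed auto
  qed (auto simp: inj_on_def)
  from bij_betw_same_card[OF this] show ?thesis
    by (simp add: reps_def finite_lists_with_sum_of_squares)
qed

text \<open>
  Fix one coordinate \<open>a\<close> and apply Cauchy-Schwarz to the sum over the at most
  \<open>3 sqrt N\<close> values of \<open>a\<close>; each shifted sum is at most the unshifted one.
\<close>
lemma sum_reps_sq_Suc:
  fixes N :: nat
  assumes "N \<ge> 1"
  shows "(\<Sum>j\<in>{0..int N}. real (reps (Suc l) j) ^ 2) \<le> 9 * real N * (\<Sum>j\<in>{0..int N}. real (reps l j) ^ 2)"
proof -
  define D where "D = \<lfloor>sqrt (real N)\<rfloor>"
  have D1: "D \<ge> 1" using assms by (simp add: D_def le_floor_iff)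
  have Dle: "real_of_int D \<le> sqrt (real N)" by (simp add: D_def)
  have "sqrt (real N) < real_of_int D + 1" by (simp add: D_def)
  then have "real N < (real_of_int D + 1)\<^sup>2" 
    by (metis less_eq_real_def of_nat_0_le_iff real_sqrt_ge_0_iff real_sqrt_pow2 power_strict_mono zero_less_numeral)
  then have "real_of_int (int N) < real_of_int ((D + 1)\<^sup>2)" by simp
  then have DN: "int N < (D + 1)\<^sup>2" by (simp only: of_int_less_iff)
  have shift: "(\<Sum>j\<in>{0..int N}. real (reps l (j - a\<^sup>2)) ^ 2) \<le> (\<Sum>j\<in>{0..int N}. real (reps l j) ^ 2)" for a
  proof -
    have "(\<Sum>j\<in>{0..int N}. real (reps l (j - a\<^sup>2)) ^ 2) = (\<Sum>j\<in>(\<lambda>j. j - a\<^sup>2) ` {0..int N}. real (reps l j) ^ 2)"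
      by (subst sum.reindex) (auto simp: inj_on_def)
    also have "\<dots> = (\<Sum>j\<in>(\<lambda>j. j - a\<^sup>2) ` {0..int N} \<inter> {0..}. real (reps l j) ^ 2)"
      by (intro sum.mono_neutral_right) (auto simp: reps_neg)
    also have "\<dots> \<le> (\<Sum>j\<in>{0..int N}. real (reps l j) ^ 2)"
      by (intro sum_mono2) (auto simp: order_trans[OF diff_le_self])
    finally show ?thesis .
  qed
  have "(\<Sum>j\<in>{0..int N}. real (reps (Suc l) j) ^ 2)
      = (\<Sum>j\<in>{0..int N}. (\<Sum>a\<in>{-D..D}. real (reps l (j - a\<^sup>2))) ^ 2)"
    by (intro sum.cong refl) (subst reps_Suc[of _ D], use DN D1 in auto)
  also have "\<dots> \<le> (\<Sum>j\<in>{0..int N}. (\<Sum>a\<in>{-D..D}. real (reps l (j - a\<^sup>2)) ^ 2) * card {-D..D})"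
    by (intro sum_mono sum_squared_le_sum_of_squares)
  also have "\<dots> = (\<Sum>a\<in>{-D..D}. \<Sum>j\<in>{0..int N}. real (reps l (j - a\<^sup>2)) ^ 2) * card {-D..D}"
    by (subst sum.swap) (simp add: sum_distrib_right)
  also have "\<dots> \<le> (\<Sum>a\<in>{-D..D}. \<Sum>j\<in>{0..int N}. real (reps l j) ^ 2) * card {-D..D}"
    by (intro mult_right_mono sum_mono shift) auto
  also have "\<dots> = (real_of_int (2 * D + 1))\<^sup>2 * (\<Sum>j\<in>{0..int N}. real (reps l j) ^ 2)"
    using D1 by (simp add: power2_eq_square)
  also have "\<dots> \<le> 9 * real N * (\<Sum>j\<in>{0..int N}. real (reps l j) ^ 2)"
  proof (rule mult_right_mono)
    have "sqrt (real N) \<ge> 1" using assms by simp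
    then have "real_of_int (2 * D + 1) \<le> 3 * sqrt (real N)" using Dle by linarith
    then have "(real_of_int (2 * D + 1))\<^sup>2 \<le> (3 * sqrt (real N))\<^sup>2"
      using D1 by (intro power_mono) auto
    then show "(real_of_int (2 * D + 1))\<^sup>2 \<le> 9 * real N" by (simp add: power_mult_distrib)
  qed (auto intro: sum_nonneg)
  finally show ?thesis .
qed

text \<open>
  The exponent 1/16 is a loss that the final estimate can afford; it avoids logarithms.
\<close>
lemma harm_le_powr:
  assumes "n \<ge> 1"
  shows "harm n \<le> 17 * real n powr (1/16)"
proof -
  have "harm n \<le> 1 + ln (real n)"
    using assms
  proof (induction n rule: dec_induct)
    case base show ?case by (simp add: harm_expand)
  next
    case (step n)
    have "inverse (real (Suc n)) \<le> ln (real (Suc n)) - ln (real n)"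
    proof -
      have "ln (real n / real (Suc n)) \<le> real n / real (Suc n) - 1"
        using step by (intro ln_le_minus_one) auto
      then show ?thesis using step by (simp add: ln_div field_simps)
    qed
    then show ?case using step by (simp add: harm_Suc)
  qed
  also have "ln (real n) \<le> 16 * real n powr (1/16)"
    using ln_powr_bound[of "real n" "1/16"] assms by simp
  finally show ?thesis using ge_one_powr_ge_zero[of "real n" "1/16"] assms by simp
qed

lemma sum_inverse_abs:
  "(\<Sum>s\<in>{-int B..int B} - {0}. 1 / \<bar>real_of_int s\<bar>) = 2 * harm B"
proof -
  have "{-int B..int B} - {0} = (\<lambda>k. int k) ` {1..B} \<union> (\<lambda>k. - int k) ` {1..B}"
  proof safe
    fix x assume "x \<in> {-int B..int B}" "x \<notin> (\<lambda>k. - int k) ` {1..B}" "x \<noteq> 0"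
    then show "x \<in> int ` {1..B}"
      by (cases "x > 0") (auto intro!: image_eqI[of _ _ "nat \<bar>x\<bar>"])
  qed auto
  also have "(\<Sum>s\<in>\<dots>. 1 / \<bar>real_of_int s\<bar>) = (\<Sum>s\<in>int ` {1..B}. 1 / \<bar>real_of_int s\<bar>) + (\<Sum>s\<in>(\<lambda>k. - int k) ` {1..B}. 1 / \<bar>real_of_int s\<bar>)"
    by (intro sum.union_disjoint) auto
  also have "\<dots> = 2 * harm B"
    by (simp add: sum.reindex inj_on_def harm_def inverse_eq_divide)
  finally show ?thesis .
qed

text \<open>
  A nonzero solution of \<open>x y = z w\<close> is \<open>x = g s\<close>, \<open>z = g t\<close>, \<open>y = t h\<close>, \<open>w = s h\<close> with
  \<open>g = gcd x z\<close>.  Given \<open>s\<close> and \<open>t\<close>, both \<open>g\<close> and \<open>h\<close> have at most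
  \<open>2 B / max |s| |t|\<close> nonzero values, and \<open>1 / (max |s| |t|)^2 \<le> 1 / (|s| |t|)\<close> separates the sum into
  two harmonic sums.
\<close>
lemma card_equal_products:
  fixes B :: nat
  assumes "B \<ge> 1"
  defines "W \<equiv> {(x, y, z, w). x \<in> {-int B..int B} \<and> y \<in> {-int B..int B} \<and> z \<in> {-int B..int B}
                   \<and> w \<in> {-int B..int B} \<and> x * y = z * w}"
  shows "finite W" "real (card W) \<le> 36 * real B ^ 2 + 16 * real B ^ 2 * harm B ^ 2"
proof -
  let ?I = "{-int B..int B}"
  have "W \<subseteq> ?I \<times> ?I \<times> ?I \<times> ?I" by (auto simp: W_def)
  then show fin: "finite W" by (rule finite_subset) simp
  \<comment> \<open>The solutions with both products zero: one factor on each side vanishes, two stay free.\<close>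
  define Z where "Z = (\<lambda>(a, b). (0::int, a, 0::int, b)) ` (?I \<times> ?I) \<union> (\<lambda>(a, b). (0, a, b, 0)) ` (?I \<times> ?I)
      \<union> ((\<lambda>(a, b). (a, 0, 0, b)) ` (?I \<times> ?I) \<union> (\<lambda>(a, b). (a, 0, b, 0)) ` (?I \<times> ?I))"
  define H where "H = (\<lambda>s t. {g :: int. g \<noteq> 0 \<and> \<bar>g\<bar> * max \<bar>s\<bar> \<bar>t\<bar> \<le> int B})"
  define P where "P = (SIGMA s : ?I - {0}. SIGMA t : ?I - {0}. H s t \<times> H s t)"
  have Hsub: "H s t \<subseteq> {- \<lfloor>real B / max \<bar>s\<bar> \<bar>t\<bar>\<rfloor>..\<lfloor>real B / max \<bar>s\<bar> \<bar>t\<bar>\<rfloor>} - {0}" if "s \<noteq> 0" for s t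
  proof
    fix g assume "g \<in> H s t"
    then have g: "g \<noteq> 0" "\<bar>g\<bar> * max \<bar>s\<bar> \<bar>t\<bar> \<le> int B" by (auto simp: H_def)
    have m: "max \<bar>s\<bar> \<bar>t\<bar> > 0" using that by auto
    have "real_of_int (\<bar>g\<bar> * max \<bar>s\<bar> \<bar>t\<bar>) \<le> real B" using g(2) by linarith
    then have "real_of_int \<bar>g\<bar> \<le> real B / real_of_int (max \<bar>s\<bar> \<bar>t\<bar>)"
      using m by (subst pos_le_divide_eq) (simp_all only: of_int_mult of_int_0_less_iff)
    then have "\<bar>g\<bar> \<le> \<lfloor>real B / real_of_int (max \<bar>s\<bar> \<bar>t\<bar>)\<rfloor>" by (simp only: le_floor_iff)
    then show "g \<in> {- \<lfloor>real B / max \<bar>s\<bar> \<bar>t\<bar>\<rfloor>..\<lfloor>real B / max \<bar>s\<bar> \<bar>t\<bar>\<rfloor>} - {0}" using g(1) by auto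
  qed
  have Hfin: "finite (H s t)" if "s \<noteq> 0" for s t
    by (rule finite_subset[OF Hsub[OF that]]) simp
  have Hcard: "real (card (H s t)) \<le> 2 * (real B / max \<bar>s\<bar> \<bar>t\<bar>)" if "s \<noteq> 0" for s t
  proof -
    let ?F = "\<lfloor>real B / max \<bar>s\<bar> \<bar>t\<bar>\<rfloor>"
    have F: "?F \<ge> 0" by simp
    have "card (H s t) \<le> card ({- ?F..?F} - {0})" by (intro card_mono Hsub that) simp
    also have "\<dots> = nat (2 * ?F)" using F by simp
    finally have "real (card (H s t)) \<le> real (nat (2 * ?F))" by linarith
    also have "\<dots> = 2 * real_of_int ?F" using F by simp
    also have "\<dots> \<le> 2 * (real B / max \<bar>s\<bar> \<bar>t\<bar>)" by (intro mult_left_mono of_int_floor_le) simp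
    finally show ?thesis .
  qed
  have Pfin: "finite P" unfolding P_def by (intro finite_SigmaI) (auto intro: Hfin)
  have "card P = (\<Sum>s\<in>?I - {0}. \<Sum>t\<in>?I - {0}. card (H s t) ^ 2)"
    unfolding P_def by (subst card_SigmaI; (intro ballI finite_SigmaI)?)
       (auto intro!: sum.cong simp: Hfin card_cartesian_product power2_eq_square)
  then have "real (card P) = (\<Sum>s\<in>?I - {0}. \<Sum>t\<in>?I - {0}. real (card (H s t)) ^ 2)" by simp
  also have "\<dots> \<le> (\<Sum>s\<in>?I - {0}. \<Sum>t\<in>?I - {0}. 4 * real B ^ 2 * ((1 / \<bar>s\<bar>) * (1 / \<bar>t\<bar>)))"
  proof (intro sum_mono)
    fix s t assume st: "s \<in> ?I - {0}" "t \<in> ?I - {0}"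
    let ?m = "real_of_int (max \<bar>s\<bar> \<bar>t\<bar>)"
    have m: "?m > 0" using st by (auto simp: less_max_iff_disj)
    have "real (card (H s t)) ^ 2 \<le> (2 * (real B / ?m)) ^ 2"
      using Hcard st by (intro power_mono) auto
    also have "\<dots> = 4 * real B ^ 2 * (1 / (?m * ?m))" by (simp add: power2_eq_square)
    also have "\<dots> \<le> 4 * real B ^ 2 * (1 / (\<bar>real_of_int s\<bar> * \<bar>real_of_int t\<bar>))"
      using st by (intro mult_left_mono divide_left_mono mult_mono mult_pos_pos) (use m in auto)
    finally show "real (card (H s t)) ^ 2 \<le> 4 * real B ^ 2 * ((1 / \<bar>s\<bar>) * (1 / \<bar>t\<bar>))" by simp
  qed
  also have "\<dots> = 4 * real B ^ 2 * ((\<Sum>s\<in>?I - {0}. 1 / \<bar>real_of_int s\<bar>) * (\<Sum>s\<in>?I - {0}. 1 / \<bar>real_of_int s\<bar>))"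
    unfolding sum_product by (simp only: sum_distrib_left of_int_abs)
  also have "\<dots> = 16 * real B ^ 2 * harm B ^ 2"
    by (simp only: sum_inverse_abs) (simp add: power2_eq_square)
  finally have cardP: "real (card P) \<le> 16 * real B ^ 2 * harm B ^ 2" .
  have cover: "W \<subseteq> Z \<union> (\<lambda>(s, t, g, h). (g * s, t * h, g * t, s * h)) ` P"
  proof safe
    fix x y z w assume W: "(x, y, z, w) \<in> W" and nP: "(x, y, z, w) \<notin> (\<lambda>(s, t, g, h). (g * s, t * h, g * t, s * h)) ` P"
    show "(x, y, z, w) \<in> Z"
    proof (cases "x * y = 0")
      case True
      then have "z = 0 \<or> w = 0" "x = 0 \<or> y = 0" using W by (auto simp: W_def)
      then show ?thesis using W by (auto simp: Z_def W_def)
    next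
      case False
      define g where "g = gcd x z"
      have nz: "x \<noteq> 0" "y \<noteq> 0" "z \<noteq> 0" "w \<noteq> 0" using False W by (auto simp: W_def)
      have g: "g > 0" using nz by (simp add: g_def)
      obtain s t where st: "x = s * g" "z = t * g" "coprime s t"
        unfolding g_def using gcd_coprime_exists[of x z] nz by auto
      have "s * y * g = t * w * g" using W st by (auto simp: W_def algebra_simps)
      then have eq: "s * y = t * w" using g by simp
      then have "t dvd y" using st(3) by (metis coprime_commute coprime_dvd_mult_right_iff dvd_triv_left)
      then obtain h where h: "y = t * h" by (auto elim: dvdE)
      have "t \<noteq> 0" using nz st by auto
      then have w: "w = s * h" using eq h by auto
      have bd: "\<bar>s\<bar> * g \<le> int B" "\<bar>t\<bar> * g \<le> int B" "\<bar>t\<bar> * \<bar>h\<bar> \<le> int B" "\<bar>s\<bar> * \<bar>h\<bar> \<le> int B"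
      proof -
        have "\<bar>s * g\<bar> \<le> int B" "\<bar>t * g\<bar> \<le> int B" "\<bar>t * h\<bar> \<le> int B" "\<bar>s * h\<bar> \<le> int B"
          using W unfolding W_def st h w by auto
        then show "\<bar>s\<bar> * g \<le> int B" "\<bar>t\<bar> * g \<le> int B" "\<bar>t\<bar> * \<bar>h\<bar> \<le> int B" "\<bar>s\<bar> * \<bar>h\<bar> \<le> int B"
          using g by (simp_all add: abs_mult)
      qed
      have sle: "\<bar>s\<bar> \<le> \<bar>s\<bar> * g" "\<bar>t\<bar> \<le> \<bar>t\<bar> * g" using g by (auto intro: mult_le_cancel_left1[THEN iffD2])
      have "(s, t, g, h) \<in> P"
        using nz st(1,2) h bd sle g order_trans[OF sle(1) bd(1)] order_trans[OF sle(2) bd(2)]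
        unfolding P_def H_def by (simp add: max_def mult.commute abs_le_iff)
      then have "(g * s, t * h, g * t, s * h) \<in> (\<lambda>(s, t, g, h). (g * s, t * h, g * t, s * h)) ` P" 
        by (rule rev_image_eqI) simp
      moreover have "(x, y, z, w) = (g * s, t * h, g * t, s * h)" using st h w by (simp add: mult.commute)
      ultimately show ?thesis using nP by simp
    qed
  qed
  have imI: "card ((f :: int \<times> int \<Rightarrow> int \<times> int \<times> int \<times> int) ` (?I \<times> ?I)) \<le> (2 * B + 1) ^ 2" for f
    by (rule order_trans[OF card_image_le]) (auto simp: card_cartesian_product power2_eq_square nat_add_distrib nat_mult_distrib)
  have "card Z \<le> ((2 * B + 1) ^ 2 + (2 * B + 1) ^ 2) + ((2 * B + 1) ^ 2 + (2 * B + 1) ^ 2)"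
    unfolding Z_def by (intro order_trans[OF card_Un_le] add_mono imI)
  also have "\<dots> = 4 * (2 * B + 1) ^ 2" by simp
  also have "\<dots> \<le> 4 * (3 * B) ^ 2" using assms by (intro mult_left_mono power_mono) auto
  finally have cardZ: "card Z \<le> 36 * B ^ 2" by (simp add: power_mult_distrib)
  have finZ: "finite Z" by (simp add: Z_def)
  have "card W \<le> card (Z \<union> (\<lambda>(s, t, g, h). (g * s, t * h, g * t, s * h)) ` P)"
    by (intro card_mono cover) (use finZ Pfin in auto)
  also have "\<dots> \<le> card Z + card P"
    by (rule order_trans[OF card_Un_le]) (simp add: card_image_le Pfin)
  finally have "real (card W) \<le> real (card Z) + real (card P)" by linarith
  also have "real (card Z) \<le> 36 * real B ^ 2" using cardZ by (metis of_nat_le_iff of_nat_mult of_nat_numeral of_nat_power)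
  finally show "real (card W) \<le> 36 * real B ^ 2 + 16 * real B ^ 2 * harm B ^ 2" using cardP by simp
qed

text \<open>
  The left side counts the quadruples with \<open>a^2 + b^2 = c^2 + d^2 \<le> N\<close>, and this equation
  is \<open>(a - c) (a + c) = (d - b) (d + b)\<close>.
\<close>
lemma sum_reps_two_sq:
  fixes N :: nat
  assumes "N \<ge> 1"
  shows "(\<Sum>j\<in>{0..int N}. real (reps 2 j) ^ 2) \<le> 80000 * real N powr (17/16)"
proof -
  define B where "B = nat (2 * \<lfloor>sqrt (real N)\<rfloor>)"
  have f1: "\<lfloor>sqrt (real N)\<rfloor> \<ge> 1" using assms by (simp add: le_floor_iff)
  have B1: "B \<ge> 1" using f1 unfolding B_def by linarith
  have Bint: "int B = 2 * \<lfloor>sqrt (real N)\<rfloor>" using f1 unfolding B_def by linarith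
  have Ble: "real B \<le> 2 * sqrt (real N)" using f1 of_int_floor_le[of "sqrt (real N)"] unfolding B_def by linarith
  let ?V = "\<lambda>j. {v :: int list. length v = 2 \<and> (\<Sum>x\<leftarrow>v. x\<^sup>2) = j}"
  define W where "W = {(x, y, z, w). x \<in> {-int B..int B} \<and> y \<in> {-int B..int B} \<and> z \<in> {-int B..int B}
                   \<and> w \<in> {-int B..int B} \<and> x * y = z * w}"
  define g :: "int list \<times> int list \<Rightarrow> _" where
    "g = (\<lambda>(v, w). (v ! 0 - w ! 0, v ! 0 + w ! 0, w ! 1 - v ! 1, w ! 1 + v ! 1))"
  have "(\<Sum>j\<in>{0..int N}. reps 2 j ^ 2) = card (\<Union>j\<in>{0..int N}. ?V j \<times> ?V j)"
    by (subst card_UN_disjoint) (auto simp: finite_lists_with_sum_of_squares card_cartesian_product reps_def power2_eq_square[of "card _"])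
  also have "\<dots> \<le> card W"
  proof (rule card_inj_on_le[of g])
    show "finite W" unfolding W_def by (rule card_equal_products[OF B1])
    show "inj_on g (\<Union>j\<in>{0..int N}. ?V j \<times> ?V j)"
      by (auto simp: inj_on_def g_def length_Suc_conv numeral_2_eq_2)
    have bd: "\<bar>a\<bar> \<le> \<lfloor>sqrt (real N)\<rfloor>" if "a\<^sup>2 + b\<^sup>2 \<le> int N" for a b :: int
    proof -
      have "a\<^sup>2 \<le> int N" using that zero_le_power2[of b] by linarith
      then have "real_of_int (a\<^sup>2) \<le> real N" by linarith
      then have "sqrt ((real_of_int a)\<^sup>2) \<le> sqrt (real N)" by (intro real_sqrt_le_mono) simp
      then have "real_of_int \<bar>a\<bar> \<le> sqrt (real N)" by simp
      then show ?thesis by (simp only: le_floor_iff)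
    qed
    show "g ` (\<Union>j\<in>{0..int N}. ?V j \<times> ?V j) \<subseteq> W"
    proof (rule image_subsetI)
      fix p assume "p \<in> (\<Union>j\<in>{0..int N}. ?V j \<times> ?V j)"
      then obtain j v w where p: "p = (v, w)" and j: "j \<in> {0..int N}" "length v = 2" "j = (\<Sum>x\<leftarrow>v. x\<^sup>2)"
          and w: "length w = 2" "(\<Sum>x\<leftarrow>w. x\<^sup>2) = (\<Sum>x\<leftarrow>v. x\<^sup>2)"
        by auto
      obtain a b where v': "v = [a, b]" using j(2) by (auto simp: length_Suc_conv numeral_2_eq_2)
      obtain c d where w': "w = [c, d]" using w(1) by (auto simp: length_Suc_conv numeral_2_eq_2)
      have eq: "c\<^sup>2 + d\<^sup>2 = a\<^sup>2 + b\<^sup>2" using w(2) by (simp add: v' w')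
      have le: "a\<^sup>2 + b\<^sup>2 \<le> int N" using j by (simp add: v')
      note bds = bd[OF le] bd[of b a] bd[of c d] bd[of d c]
      have "(a - c) * (a + c) = (d - b) * (d + b)"
        using eq by (simp add: algebra_simps power2_eq_square)
      then show "g p \<in> W" unfolding p
        using bds le eq Bint by (simp add: g_def W_def v' w' add.commute abs_le_iff)
    qed
  qed
  finally have "(\<Sum>j\<in>{0..int N}. real (reps 2 j) ^ 2) \<le> real (card W)"
    by (metis (mono_tags, lifting) of_nat_le_iff of_nat_power of_nat_sum sum.cong)
  also have "\<dots> \<le> 36 * real B ^ 2 + 16 * real B ^ 2 * harm B ^ 2"
    unfolding W_def by (rule card_equal_products[OF B1])
  also have "\<dots> \<le> 36 * (4 * real N) + 16 * (4 * real N) * (34 * real N powr (1/32)) ^ 2"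
  proof -
    have B2: "real B ^ 2 \<le> 4 * real N"
      using power_mono[OF Ble, of 2] by (simp add: power_mult_distrib)
    have "harm B \<le> 17 * real B powr (1/16)" by (rule harm_le_powr[OF B1])
    also have "real B powr (1/16) \<le> (2 * sqrt (real N)) powr (1/16)"
      using Ble by (intro powr_mono2) auto
    also have "\<dots> = 2 powr (1/16) * real N powr (1/32)"
      by (simp add: powr_mult powr_half_sqrt[symmetric] powr_powr)
    also have "\<dots> \<le> 2 powr 1 * real N powr (1/32)"
      by (intro mult_right_mono powr_mono) auto
    finally have h: "harm B \<le> 34 * real N powr (1/32)" by simp
    show ?thesis
      using B2 by (intro add_mono mult_mono power_mono h mult_left_mono) (auto simp: harm_nonneg)
  qed
  also have "\<dots> = 144 * real N + 73984 * (real N * (real N powr (1/32) * real N powr (1/32)))"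
    by (simp add: power2_eq_square)
  also have "real N powr (1/32) * real N powr (1/32) = real N powr (1/16)"
    by (simp add: powr_add[symmetric])
  also have "real N * real N powr (1/16) = real N powr (17/16)"
    using powr_add[of "real N" 1 "1/16"] by simp
  finally show ?thesis
    using powr_mono[of 1 "17/16" "real N"] assms by simp
qed

lemma sum_reps_sq_bound:
  fixes N :: nat
  assumes "N \<ge> 1"
  shows "(\<Sum>j\<in>{0..int N}. real (reps (m + 2) j) ^ 2) \<le> 9 ^ m * 80000 * real N powr (real m + 17/16)"
proof (induction m)
  case 0
  then show ?case using sum_reps_two_sq[OF assms] by (simp add: numeral_2_eq_2)
next
  case (Suc m)
  have "(\<Sum>j\<in>{0..int N}. real (reps (Suc m + 2) j) ^ 2) \<le> 9 * real N * (\<Sum>j\<in>{0..int N}. real (reps (m + 2) j) ^ 2)"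
    using sum_reps_sq_Suc[OF assms, of "m + 2"] by simp
  also have "\<dots> \<le> 9 * real N * (9 ^ m * 80000 * real N powr (real m + 17/16))"
    by (intro mult_left_mono Suc) auto
  also have "\<dots> = 9 ^ Suc m * 80000 * (real N * real N powr (real m + 17/16))" by simp
  also have "real N * real N powr (real m + 17/16) = real N powr (real (Suc m) + 17/16)"
    using powr_add[of "real N" 1 "real m + 17/16"] by (simp add: algebra_simps)
  finally show ?case .
qed

theorem sum_r_sq_bound:
  assumes "l \<ge> 2"
  shows "\<exists>C>0. \<forall>X\<ge>1. (\<Sum>n | 1 \<le> n \<and> real n \<le> X. real (r l n) ^ 2) \<le> C * X powr (real l - 15/16)"
proof (intro exI conjI allI impI)
  fix X :: real assume X: "X \<ge> 1"
  obtain m where m: "l = m + 2" using assms by (metis add.commute le_iff_add)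
  define N where "N = nat \<lfloor>X\<rfloor>"
  have N: "N \<ge> 1" "real N \<le> X" using X by (auto simp: N_def le_nat_iff le_floor_iff)
  have "(\<Sum>n | 1 \<le> n \<and> real n \<le> X. real (r l n) ^ 2) = (\<Sum>j\<in>int ` {n. 1 \<le> n \<and> real n \<le> X}. real (reps l j) ^ 2)"
    by (subst sum.reindex) (auto simp: r_eq_reps)
  also have "\<dots> \<le> (\<Sum>j\<in>{0..int N}. real (reps l j) ^ 2)"
    by (intro sum_mono2) (auto simp: N_def le_floor_iff)
  also have "\<dots> \<le> 9 ^ m * 80000 * real N powr (real m + 17/16)"
    unfolding m by (rule sum_reps_sq_bound[OF N(1)])
  also have "\<dots> \<le> 9 ^ m * 80000 * X powr (real m + 17/16)"
    using N by (intro mult_left_mono powr_mono2) auto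
  also have "\<dots> = 9 ^ (l - 2) * 80000 * X powr (real l - 15/16)" by (simp add: m add.commute)
  finally show "(\<Sum>n | 1 \<le> n \<and> real n \<le> X. real (r l n) ^ 2) \<le> 9 ^ (l - 2) * 80000 * X powr (real l - 15/16)" .
qed simp

section \<open>Fourier series and Hankel forms\<close>

abbreviation fchar :: "int \<Rightarrow> real \<Rightarrow> complex" where
  "fchar n x \<equiv> e (of_int n * of_real x)"

lemma e_add: "e (a + b) = e a * e b"
  by (simp add: e_def ring_distribs exp_add)

lemma norm_fchar: "norm (fchar n x) = 1"
  by (simp add: e_def)

lemma fchar_add: "fchar (m + n) x = fchar m x * fchar n x"
  by (simp add: e_add[symmetric] ring_distribs)

lemma cnj_fchar: "cnj (fchar n x) = fchar (- n) x"
  by (simp add: e_def exp_cnj)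

lemma continuous_on_fchar [continuous_intros]: "continuous_on S (fchar n)"
  unfolding e_def by (intro continuous_intros)

lemma fchar_has_integral:
  "(fchar n has_integral (if n = 0 then 1 else 0)) {0..1}"
proof (cases "n = 0")
  case True
  then show ?thesis using has_integral_const_real[of "1::complex" 0 1] by (simp add: e_def)
next
  case False
  define F where "F = (\<lambda>x. fchar n x / (2 * of_real pi * \<i> * of_int n))"
  have "(fchar n has_integral F 1 - F 0) {0..1}"
  proof (rule fundamental_theorem_of_calculus)
    fix x :: real assume "x \<in> {0..1}"
    have "((\<lambda>z. e (of_int n * z) / (2 * of_real pi * \<i> * of_int n)) has_field_derivative fchar n x) (at (of_real x))"
      unfolding e_def using False by (auto intro!: derivative_eq_intros)
    from has_vector_derivative_real_field[OF this]
    show "(F has_vector_derivative fchar n x) (at x within {0..1})"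
      by (simp add: F_def)
  qed simp
  moreover have "F 1 = F 0"
  proof -
    have "exp (2 * of_real pi * \<i> * of_int n) = (1::complex)"
      using exp_integer_2pi[of "of_int n"] by (simp add: mult_ac)
    then show ?thesis by (simp add: F_def e_def)
  qed
  ultimately show ?thesis using False by simp
qed

text \<open>
  Parseval's identity; expand the square and integrate termwise.
\<close>
lemma integral_trig_poly_sq:
  assumes "finite N"
  shows "((\<lambda>x. (norm (\<Sum>n\<in>N. c n * fchar (- int n) x))\<^sup>2) has_integral (\<Sum>n\<in>N. (norm (c n))\<^sup>2)) {0..1}"
proof -
  have "((\<lambda>x. \<Sum>n\<in>N. \<Sum>m\<in>N. (c n * cnj (c m)) * fchar (int m - int n) x) has_integral
      (\<Sum>n\<in>N. \<Sum>m\<in>N. (c n * cnj (c m)) * (if int m - int n = 0 then 1 else 0))) {0..1}"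
    by (intro has_integral_sum has_integral_mult_right fchar_has_integral assms)
  also have "(\<Sum>n\<in>N. \<Sum>m\<in>N. (c n * cnj (c m)) * (if int m - int n = 0 then 1 else 0)) = of_real (\<Sum>n\<in>N. (norm (c n))\<^sup>2)"
    using assms by (simp add: if_distrib[of "\<lambda>x. _ * x"] sum.delta complex_norm_square[symmetric] cong: if_cong)
  also have "(\<lambda>x. \<Sum>n\<in>N. \<Sum>m\<in>N. (c n * cnj (c m)) * fchar (int m - int n) x) =
             (\<lambda>x. of_real ((norm (\<Sum>n\<in>N. c n * fchar (- int n) x))\<^sup>2))"
  proof
    fix x
    have eq: "fchar (int m - int n) x = fchar (- int n) x * cnj (fchar (- int m) x)" for m n
      using fchar_add[of "- int n" "int m" x] by (simp only: cnj_fchar minus_minus uminus_add_conv_diff)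
    show "(\<Sum>n\<in>N. \<Sum>m\<in>N. (c n * cnj (c m)) * fchar (int m - int n) x) = of_real ((norm (\<Sum>n\<in>N. c n * fchar (- int n) x))\<^sup>2)"
      unfolding complex_norm_square cnj_sum complex_cnj_mult sum_product eq by (simp only: mult_ac)
  qed
  finally have "((\<lambda>x. Re (of_real ((norm (\<Sum>n\<in>N. c n * fchar (- int n) x))\<^sup>2))) has_integral Re (of_real (\<Sum>n\<in>N. (norm (c n))\<^sup>2))) {0..1}"
    by (rule has_integral_Re)
  then show ?thesis by simp
qed

lemma integral_product_trig_poly:
  fixes c d :: "nat \<Rightarrow> complex"
  assumes "finite N" "finite M"
  shows "integral {0..1} (\<lambda>x. norm ((\<Sum>n\<in>N. c n * fchar (- int n) x) * (\<Sum>m\<in>M. d m * fchar (- int m) x)))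
          \<le> sqrt (\<Sum>n\<in>N. (norm (c n))\<^sup>2) * sqrt (\<Sum>m\<in>M. (norm (d m))\<^sup>2)"
proof -
  define F where "F = (\<lambda>x. \<Sum>n\<in>N. c n * fchar (- int n) x)"
  define G where "G = (\<lambda>x. \<Sum>m\<in>M. d m * fchar (- int m) x)"
  define a where "a = sqrt (\<Sum>n\<in>N. (norm (c n))\<^sup>2)"
  define b where "b = sqrt (\<Sum>m\<in>M. (norm (d m))\<^sup>2)"
  have a2: "a\<^sup>2 = (\<Sum>n\<in>N. (norm (c n))\<^sup>2)" and b2: "b\<^sup>2 = (\<Sum>m\<in>M. (norm (d m))\<^sup>2)"
    and ab0: "a \<ge> 0" "b \<ge> 0"
    by (auto simp: a_def b_def sum_nonneg)
  have cont: "continuous_on {0..1} F" "continuous_on {0..1} G"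
    unfolding F_def G_def by (intro continuous_intros)+
  have I: "(\<lambda>x. norm (F x * G x)) integrable_on {0..1}"
    by (intro integrable_continuous_interval continuous_intros cont)
  \<comment> \<open>Cauchy-Schwarz through the arithmetic-geometric mean inequality: the weight \<open>l\<close> will be \<open>b / a\<close>.\<close>
  have le: "integral {0..1} (\<lambda>x. norm (F x * G x)) * (2 * l) \<le> l\<^sup>2 * a\<^sup>2 + b\<^sup>2" if "l > 0" for l
  proof -
    have "integral {0..1} (\<lambda>x. norm (F x * G x) * (2 * l)) \<le> l\<^sup>2 * a\<^sup>2 + b\<^sup>2"
    proof (rule has_integral_le)
      show "((\<lambda>x. norm (F x * G x) * (2 * l)) has_integral integral {0..1} (\<lambda>x. norm (F x * G x) * (2 * l))) {0..1}"
        using I by (intro integrable_integral integrable_on_mult_left)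
      show "((\<lambda>x. l\<^sup>2 * (norm (F x))\<^sup>2 + (norm (G x))\<^sup>2) has_integral l\<^sup>2 * a\<^sup>2 + b\<^sup>2) {0..1}"
        unfolding a2 b2 F_def G_def
        by (intro has_integral_add has_integral_mult_right integral_trig_poly_sq assms)
      fix x show "norm (F x * G x) * (2 * l) \<le> l\<^sup>2 * (norm (F x))\<^sup>2 + (norm (G x))\<^sup>2"
        using zero_le_power2[of "l * norm (F x) - norm (G x)"]
        by (simp add: norm_mult power2_eq_square algebra_simps)
    qed
    then show ?thesis by simp
  qed
  define J where "J = integral {0..1} (\<lambda>x. norm (F x * G x))"
  have "J \<le> a * b"
  proof (cases "a = 0 \<or> b = 0")
    case False
    then have pos: "a > 0" "b > 0" using ab0 by auto
    have "J * (2 * (b / a)) \<le> (b / a)\<^sup>2 * a\<^sup>2 + b\<^sup>2" unfolding J_def by (rule le) (use pos in simp)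
    also have "\<dots> = (a * b) * (2 * (b / a))" using pos by (simp add: power2_eq_square field_simps)
    finally show ?thesis using pos by (subst (asm) mult_le_cancel_right) auto
  next
    case True
    have "F x = 0 \<or> G x = 0" for x
    proof -
      have "(\<forall>n\<in>N. c n = 0) \<or> (\<forall>m\<in>M. d m = 0)"
        using True assms by (auto simp: a_def b_def sum_nonneg_eq_0_iff)
      then show ?thesis by (auto simp: F_def G_def)
    qed
    then have "(\<lambda>x. norm (F x * G x)) = (\<lambda>_. 0)" by auto
    then show ?thesis using True by (auto simp: J_def)
  qed
  then show ?thesis by (simp add: J_def F_def G_def a_def b_def)
qed

text \<open>
  The convergence at \<open>x = 0\<close> is absolute, since every unconditionally convergent complex
  series is, and the terms have the same modulus for all \<open>x\<close>.  Hence the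
  series converges uniformly and may be integrated termwise.
\<close>
lemma fourier_series_coefficient:
  assumes hs: "\<And>x. ((\<lambda>n. \<phi> n * fchar n x) has_sum g x) S"
  shows "continuous_on {0..1} g"
    and "k \<in> S \<Longrightarrow> ((\<lambda>x. g x * fchar (- k) x) has_integral \<phi> k) {0..1}"
proof -
  have "(\<lambda>n. norm (\<phi> n * fchar n 0)) summable_on S"
    using hs[of 0] by (auto simp: summable_on_iff_abs_summable_on_complex dest: has_sum_imp_summable)
  then have sm: "(\<lambda>n. norm (\<phi> n)) summable_on S" by (simp only: norm_mult norm_fchar mult_1_right)
  have ul: "uniform_limit {0..1} (\<lambda>X x. \<Sum>n\<in>X. \<phi> n * fchar n x) g (finite_subsets_at_top S)"
    by (rule Weierstrass_m_test_general'[OF _ hs sm]) (simp add: norm_mult norm_fchar)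
  show cont: "continuous_on {0..1} g"
    by (rule uniform_limit_theorem[OF _ ul]) (auto intro!: always_eventually continuous_intros)
  assume k: "k \<in> S"
  have ul2: "uniform_limit {0..1} (\<lambda>X x. \<Sum>n\<in>X. \<phi> n * fchar (n - k) x) (\<lambda>x. g x * fchar (- k) x) (finite_subsets_at_top S)"
  proof (rule Weierstrass_m_test_general'[OF _ _ sm])
    fix x :: real
    have "((\<lambda>n. \<phi> n * fchar n x * fchar (- k) x) has_sum g x * fchar (- k) x) S"
      by (intro has_sum_cmult_left hs)
    then show "((\<lambda>n. \<phi> n * fchar (n - k) x) has_sum g x * fchar (- k) x) S"
      using fchar_add[of _ "-k" x] by (simp add: mult.assoc)
  qed (simp add: norm_mult norm_fchar del: of_int_diff)
  have ct: "continuous_on {0..1} (\<lambda>x. \<Sum>n\<in>X. \<phi> n * fchar (n - k) x)" for X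
    by (intro continuous_intros)
  obtain I J where I: "\<And>X. ((\<lambda>x. \<Sum>n\<in>X. \<phi> n * fchar (n - k) x) has_integral I X) {0..1}"
    and J: "((\<lambda>x. g x * fchar (- k) x) has_integral J) {0..1}"
    and lim: "(I \<longlongrightarrow> J) (finite_subsets_at_top S)"
    using uniform_limit_integral[OF ul2 ct finite_subsets_at_top_neq_bot] by blast
  have "eventually (\<lambda>X. I X = \<phi> k) (finite_subsets_at_top S)"
  proof -
    have "eventually (\<lambda>X. finite X \<and> {k} \<subseteq> X \<and> X \<subseteq> S) (finite_subsets_at_top S)"
      using k unfolding eventually_finite_subsets_at_top by (intro exI[of _ "{k}"]) auto
    then show ?thesis
    proof eventually_elim
      case (elim X)
      have "((\<lambda>x. \<Sum>n\<in>X. \<phi> n * fchar (n - k) x) has_integral (\<Sum>n\<in>X. \<phi> n * (if n - k = 0 then 1 else 0))) {0..1}"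
        using elim by (intro has_integral_sum has_integral_mult_right fchar_has_integral) auto
      also have "(\<Sum>n\<in>X. \<phi> n * (if n - k = 0 then 1 else 0)) = \<phi> k"
        using elim by (simp add: if_distrib[of "\<lambda>x. _ * x"] sum.delta' cong: if_cong)
      finally show ?case using I[of X] has_integral_unique by blast
    qed
  qed
  then have "(I \<longlongrightarrow> \<phi> k) (finite_subsets_at_top S)" by (rule tendsto_eventually)
  then have "J = \<phi> k" using lim tendsto_unique finite_subsets_at_top_neq_bot by blast
  then show "((\<lambda>x. g x * fchar (- k) x) has_integral \<phi> k) {0..1}" using J by simp
qed

lemma fourier_coefficient_bound:
  assumes hs: "\<And>x. ((\<lambda>n. \<phi> n * fchar n x) has_sum g x) S" and "k \<in> S" and bd: "\<And>x. norm (g x) \<le> B"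
  shows "norm (\<phi> k) \<le> B"
proof -
  note I = fourier_series_coefficient(2)[OF hs \<open>k \<in> S\<close>]
  have "norm (\<phi> k) \<le> integral {0..1::real} (\<lambda>x. B)"
    unfolding integral_unique[OF I, symmetric]
    using I by (intro integral_norm_bound_integral) (auto simp only: norm_mult norm_fchar mult_1_right bd intro: has_integral_integrable)
  then show ?thesis by simp
qed

text \<open>
  The form is the integral of \<open>g\<close> against the product of the trigonometric polynomials with
  coefficients \<open>c\<close> and \<open>d\<close>.  Their frequencies are negative, so only the coefficients of \<open>g\<close> with
  positive index enter, whatever the other elements of \<open>S\<close> are.
\<close>
lemma hankel_form_fourier_bound:
  fixes c d :: "nat \<Rightarrow> complex"
  assumes hs: "\<And>x. ((\<lambda>n. \<phi> n * fchar n x) has_sum g x) S"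
    and S: "{1..} \<subseteq> S"
    and bd: "\<And>x. norm (g x) \<le> B"
    and fin: "finite N" "finite M" and pos: "0 \<notin> N" "0 \<notin> M"
  shows "norm (\<Sum>n\<in>N. \<Sum>m\<in>M. c n * d m * \<phi> (int (n + m))) \<le>
           B * (sqrt (\<Sum>n\<in>N. (norm (c n))\<^sup>2) * sqrt (\<Sum>m\<in>M. (norm (d m))\<^sup>2))"
proof -
  define F where "F = (\<lambda>x. \<Sum>n\<in>N. c n * fchar (- int n) x)"
  define G where "G = (\<lambda>x. \<Sum>m\<in>M. d m * fchar (- int m) x)"
  have B0: "B \<ge> 0" using bd[of 0] norm_ge_zero order_trans by blast
  have inS: "int (n + m) \<in> S" if "n \<in> N" "m \<in> M" for n m
    using that pos S by (cases n) auto
  have "((\<lambda>x. \<Sum>n\<in>N. \<Sum>m\<in>M. c n * d m * (g x * fchar (- int (n + m)) x)) has_integral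
     (\<Sum>n\<in>N. \<Sum>m\<in>M. c n * d m * \<phi> (int (n + m)))) {0..1}"
    by (intro has_integral_sum has_integral_mult_right fourier_series_coefficient(2)[OF hs] inS fin)
  also have "(\<lambda>x. \<Sum>n\<in>N. \<Sum>m\<in>M. c n * d m * (g x * fchar (- int (n + m)) x)) = (\<lambda>x. g x * (F x * G x))"
  proof
    fix x
    have "fchar (- int (n + m)) x = fchar (- int n) x * fchar (- int m) x" for n m
      using fchar_add[of "- int n" "- int m" x] by simp
    then show "(\<Sum>n\<in>N. \<Sum>m\<in>M. c n * d m * (g x * fchar (- int (n + m)) x)) = g x * (F x * G x)"
      unfolding F_def G_def sum_product by (simp only: sum_distrib_left mult_ac)
  qed
  finally have *: "((\<lambda>x. g x * (F x * G x)) has_integral (\<Sum>n\<in>N. \<Sum>m\<in>M. c n * d m * \<phi> (int (n + m)))) {0..1}" .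
  have cont: "continuous_on {0..1} F" "continuous_on {0..1} G"
    unfolding F_def G_def by (intro continuous_intros)+
  note contg = fourier_series_coefficient(1)[OF hs]
  have "norm (\<Sum>n\<in>N. \<Sum>m\<in>M. c n * d m * \<phi> (int (n + m))) = norm (integral {0..1} (\<lambda>x. g x * (F x * G x)))"
    using * by (simp add: integral_unique)
  also have "\<dots> \<le> integral {0..1} (\<lambda>x. B * norm (F x * G x))"
    using * by (intro integral_norm_bound_integral integrable_continuous_interval continuous_intros cont contg)
      (auto simp: norm_mult intro!: mult_right_mono bd)
  also have "\<dots> = B * integral {0..1} (\<lambda>x. norm (F x * G x))" by simp
  also have "\<dots> \<le> B * (sqrt (\<Sum>n\<in>N. (norm (c n))\<^sup>2) * sqrt (\<Sum>m\<in>M. (norm (d m))\<^sup>2))"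
    unfolding F_def G_def by (intro mult_left_mono integral_product_trig_poly fin B0)
  finally show ?thesis .
qed

text \<open>
  The matrix with entries \<open>a (n + m)\<close> (\<open>n, m \<ge> 1\<close>) defines a bounded operator on \<open>l2\<close>.
\<close>
definition hankel_bounded :: "(nat \<Rightarrow> complex) \<Rightarrow> bool" where
  "hankel_bounded a \<longleftrightarrow> (\<exists>C\<ge>0. \<forall>N M c d. finite N \<longrightarrow> finite M \<longrightarrow> 0 \<notin> N \<longrightarrow> 0 \<notin> M \<longrightarrow>
     norm (\<Sum>n\<in>N. \<Sum>m\<in>M. c n * d m * a (n + m)) \<le>
       C * (sqrt (\<Sum>n\<in>N. (norm (c n))\<^sup>2) * sqrt (\<Sum>m\<in>M. (norm (d m))\<^sup>2)))"

text \<open>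
  For each height \<open>y\<close> the Hankel form of the coefficients \<open>\<phi> y\<close> is bounded by \<open>B y\<close>.  Integrating
  in \<open>y\<close> replaces \<open>\<phi> y\<close> by its Mellin transform and the bound by that of \<open>B\<close>.
\<close>
lemma hankel_bounded_mellin:
  assumes hs: "\<And>x y. y > 0 \<Longrightarrow> ((\<lambda>n. \<phi> y n * fchar n x) has_sum g y x) S"
    and S: "{1..} \<subseteq> S"
    and bd: "\<And>x y. y > 0 \<Longrightarrow> norm (g y x) \<le> B y"
    and mel: "\<And>k. k \<ge> 1 \<Longrightarrow> ((\<lambda>y. of_real (y powr (w - 1)) * \<phi> y (int k)) has_integral \<gamma> * a k) {0<..}"
    and "\<gamma> \<noteq> 0"
    and int: "(\<lambda>y. y powr (w - 1) * B y) integrable_on {0<..}"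
  shows "hankel_bounded a"
  unfolding hankel_bounded_def
proof (intro exI[of _ "integral {0<..} (\<lambda>y. y powr (w - 1) * B y) / norm \<gamma>"] conjI allI impI)
  have B0: "B y \<ge> 0" if "y > 0" for y using bd[OF that, of 0] norm_ge_zero order_trans by blast
  show "integral {0<..} (\<lambda>y. y powr (w - 1) * B y) / norm \<gamma> \<ge> 0"
    using int B0 by (intro divide_nonneg_nonneg Henstock_Kurzweil_Integration.integral_nonneg) auto
  fix N M :: "nat set" and c d :: "nat \<Rightarrow> complex"
  assume fin: "finite N" "finite M" and pos: "0 \<notin> N" "0 \<notin> M"
  let ?L = "sqrt (\<Sum>n\<in>N. (norm (c n))\<^sup>2) * sqrt (\<Sum>m\<in>M. (norm (d m))\<^sup>2)"
  let ?S = "\<Sum>n\<in>N. \<Sum>m\<in>M. c n * d m * a (n + m)"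
  have "((\<lambda>y. \<Sum>n\<in>N. \<Sum>m\<in>M. c n * d m * (of_real (y powr (w - 1)) * \<phi> y (int (n + m)))) has_integral
           (\<Sum>n\<in>N. \<Sum>m\<in>M. c n * d m * (\<gamma> * a (n + m)))) {0<..}"
    using pos by (intro has_integral_sum has_integral_mult_right mel fin) (metis One_nat_def add_is_0 leI less_Suc0)
  also have "(\<Sum>n\<in>N. \<Sum>m\<in>M. c n * d m * (\<gamma> * a (n + m))) = \<gamma> * ?S"
    by (simp add: sum_distrib_left mult_ac)
  also have "(\<lambda>y. \<Sum>n\<in>N. \<Sum>m\<in>M. c n * d m * (of_real (y powr (w - 1)) * \<phi> y (int (n + m)))) =
             (\<lambda>y. of_real (y powr (w - 1)) * (\<Sum>n\<in>N. \<Sum>m\<in>M. c n * d m * \<phi> y (int (n + m))))"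
    by (simp add: sum_distrib_left mult_ac)
  finally have *: "((\<lambda>y. of_real (y powr (w - 1)) * (\<Sum>n\<in>N. \<Sum>m\<in>M. c n * d m * \<phi> y (int (n + m)))) has_integral \<gamma> * ?S) {0<..}" .
  have "norm (\<gamma> * ?S) \<le> integral {0<..} (\<lambda>y. y powr (w - 1) * B y * ?L)"
    unfolding integral_unique[OF *, symmetric]
  proof (rule integral_norm_bound_integral)
    show "(\<lambda>y. y powr (w - 1) * B y * ?L) integrable_on {0<..}" by (intro integrable_on_mult_left int)
    fix y :: real assume "y \<in> {0<..}"
    then have y: "y > 0" by simp
    show "norm (of_real (y powr (w - 1)) * (\<Sum>n\<in>N. \<Sum>m\<in>M. c n * d m * \<phi> y (int (n + m)))) \<le> y powr (w - 1) * B y * ?L"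
      using hankel_form_fourier_bound[OF hs[OF y] S bd[OF y] fin pos, of c d]
      by (simp add: norm_mult mult.assoc mult_left_mono)
  qed (use * in blast)
  also have "\<dots> = integral {0<..} (\<lambda>y. y powr (w - 1) * B y) * ?L" by simp
  finally show "norm ?S \<le> integral {0<..} (\<lambda>y. y powr (w - 1) * B y) / norm \<gamma> * ?L"
    using \<open>\<gamma> \<noteq> 0\<close> by (simp add: norm_mult field_simps)
qed

lemma has_integral_scale_pos:
  fixes f :: "real \<Rightarrow> 'a::euclidean_space"
  assumes "f absolutely_integrable_on {0<..}" "(f has_integral I) {0<..}" "c > 0"
  shows "(\<lambda>x. f (c * x)) absolutely_integrable_on {0<..}" "((\<lambda>x. f (c * x)) has_integral I /\<^sub>R c) {0<..}"
proof -
  have im: "(\<lambda>x. c * x) ` {0<..} = {0<..}"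
    using assms(3) by (auto simp: image_iff intro!: bexI[of _ "_ / c"])
  have "(\<lambda>x. \<bar>c\<bar> *\<^sub>R f (c * x)) absolutely_integrable_on {0<..} \<and> integral {0<..} (\<lambda>x. \<bar>c\<bar> *\<^sub>R f (c * x)) = I"
    by (subst has_absolute_integral_change_of_variables_real[where h = "\<lambda>_. c" and g = "\<lambda>x. c * x"])
       (use assms im in \<open>auto intro!: derivative_eq_intros inj_onI integral_unique\<close>)
  then have *: "(\<lambda>x. c *\<^sub>R f (c * x)) absolutely_integrable_on {0<..}" "integral {0<..} (\<lambda>x. c *\<^sub>R f (c * x)) = I"
    using assms by auto
  then have "((\<lambda>x. c *\<^sub>R f (c * x)) has_integral I) {0<..}"
    using set_lebesgue_integral_eq_integral(1) by blast
  from has_integral_cmul[OF this, of "inverse c"] 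
  show "((\<lambda>x. f (c * x)) has_integral I /\<^sub>R c) {0<..}" using assms by simp
  from absolutely_integrable_scaleR_left[OF *(1), of "inverse c"]
  show "(\<lambda>x. f (c * x)) absolutely_integrable_on {0<..}" using assms by simp
qed

lemma Gamma_integral_scaled:
  assumes "Re w > 0" "c > 0"
  shows "(\<lambda>t. of_real t powr (w - 1) * of_real (exp (- (c * t)))) absolutely_integrable_on {0<..}"
    "((\<lambda>t. of_real t powr (w - 1) * of_real (exp (- (c * t)))) has_integral Gamma w * of_real c powr (- w)) {0<..}"
proof -
  define f :: "real \<Rightarrow> complex" where "f = (\<lambda>t. of_real t powr (w - 1) / of_real (exp t))"
  have f: "f absolutely_integrable_on {0<..}" "(f has_integral Gamma w) {0<..}"
    unfolding f_def using absolutely_integrable_Gamma_integral' Gamma_integral_complex' assms by auto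
  note sc = has_integral_scale_pos[OF f \<open>c > 0\<close>]
  let ?k = "of_real c powr (1 - w) :: complex"
  have eq: "?k * f (c * t) = of_real t powr (w - 1) * of_real (exp (- (c * t)))" if "t \<in> {0<..}" for t
  proof -
    have "complex_of_real (c * t) powr (w - 1) = of_real c powr (w - 1) * of_real t powr (w - 1)"
      using that assms by (simp add: powr_times_real)
    moreover have "?k * of_real c powr (w - 1) = 1"
      using assms by (simp add: powr_add[symmetric])
    ultimately show ?thesis
      by (simp add: f_def exp_minus field_simps)
  qed
  have "(\<lambda>t. ?k * f (c * t)) absolutely_integrable_on {0<..}"
    by (rule set_integrable_mult_right) (rule sc)
  then show "(\<lambda>t. of_real t powr (w - 1) * of_real (exp (- (c * t)))) absolutely_integrable_on {0<..}"
    by (subst (asm) set_integrable_cong[OF refl refl eq])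
  have "((\<lambda>t. ?k * f (c * t)) has_integral ?k * (Gamma w /\<^sub>R c)) {0<..}"
    by (intro has_integral_mult_right sc)
  also have "?k * (Gamma w /\<^sub>R c) = Gamma w * of_real c powr (- w)"
    using assms by (simp add: scaleR_conv_of_real powr_diff powr_minus field_simps)
  finally show "((\<lambda>t. of_real t powr (w - 1) * of_real (exp (- (c * t)))) has_integral Gamma w * of_real c powr (- w)) {0<..}"
    by (rule has_integral_eq[rotated]) (rule eq)
qed

lemma Gamma_integral_scaled_real:
  fixes w c :: real
  assumes "w > 0" "c > 0"
  shows "((\<lambda>t. t powr (w - 1) * exp (- (c * t))) has_integral Gamma w * c powr (- w)) {0<..}"
proof -
  have "((\<lambda>t. of_real t powr (of_real w - 1) * of_real (exp (- (c * t)))) has_integral Gamma (of_real w :: complex) * of_real c powr (- of_real w)) {0<..}"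
    using assms by (intro Gamma_integral_scaled) auto
  then have "((\<lambda>t. of_real (t powr (w - 1) * exp (- (c * t)))) has_integral (of_real (Gamma w * c powr (- w)) :: complex)) {0<..}"
    using assms by (subst (asm) has_integral_cong[where g = "\<lambda>t. of_real (t powr (w - 1) * exp (- (c * t)))"])
      (auto simp: powr_of_real[symmetric] Gamma_complex_of_real)
  from has_integral_Re[OF this] show ?thesis by simp
qed

lemma has_integral_Ioi_iff_Ici:
  fixes f :: "real \<Rightarrow> 'a::banach"
  shows "(f has_integral I) {a<..} \<longleftrightarrow> (f has_integral I) {a..}"
  by (rule has_integral_spike_set_eq)
     (auto intro: negligible_subset[of "{a}"])

lemma has_integral_min_powr:
  fixes s X :: real
  assumes "0 < s" "s < 1" "X > 0"
  shows "((\<lambda>t. t powr (-s) * (if t \<le> 1 / X then X else 1 / t)) has_integral (X powr s / (1 - s) + X powr s / s)) {0<..}"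
proof -
  have "((\<lambda>t. X * t powr (-s)) has_integral X * ((1 / X) powr (-s + 1) / (-s + 1))) {0..1/X}"
    using assms by (intro has_integral_mult_right has_integral_powr_from_0) auto
  also have "X * ((1 / X) powr (-s + 1) / (-s + 1)) = X powr s / (1 - s)"
  proof -
    have "(1 / X) powr (-s + 1) = X powr s / X"
      using assms by (simp add: powr_divide powr_diff)
    then show ?thesis using assms by (simp add: field_simps)
  qed
  finally have 1: "((\<lambda>t. t powr (-s) * (if t \<le> 1 / X then X else 1 / t)) has_integral X powr s / (1 - s)) {0..1/X}"
    by (rule has_integral_eq[rotated]) auto
  have "((\<lambda>t. t powr (-s - 1)) has_integral - ((1 / X) powr (-s - 1 + 1)) / (-s - 1 + 1)) {1/X..}"
    using assms by (intro has_integral_powr_to_inf) auto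
  also have "- ((1 / X) powr (-s - 1 + 1)) / (-s - 1 + 1) = X powr s / s"
    using assms by (simp add: powr_divide powr_minus field_simps)
  finally have 2: "((\<lambda>t. t powr (-s) * (if t \<le> 1 / X then X else 1 / t)) has_integral X powr s / s) {1/X..}"
  proof (rule has_integral_eq[rotated])
    fix t :: real assume t: "t \<in> {1/X..}"
    have tpos: "t > 0" using t assms by (smt (verit) atLeast_iff divide_pos_pos)
    show "t powr (-s - 1) = t powr (-s) * (if t \<le> 1 / X then X else 1 / t)"
      using t tpos assms by (auto simp: powr_diff)
  qed
  have "((\<lambda>t. t powr (-s) * (if t \<le> 1 / X then X else 1 / t)) has_integral (X powr s / (1 - s) + X powr s / s)) ({0..1/X} \<union> {1/X..})"
  proof (rule has_integral_Un[OF 1 2])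
    show "negligible ({0..1/X} \<inter> {1/X..})"
      by (rule negligible_subset[of "{1/X}"]) auto
  qed
  also have "{0..1/X} \<union> {1/X..} = {0..}" using order_trans[of 0 "1 / X"] assms by auto
  finally show ?thesis by (simp only: has_integral_Ioi_iff_Ici)
qed

text \<open>
  Write \<open>k powr s = k * k powr (s - 1)\<close> and \<open>k powr (s - 1)\<close> as the Laplace transform of
  \<open>t powr (-s) / Gamma (1 - s)\<close>.  With \<open>k = n + m\<close> the integrand \<open>(n + m) exp (- (n + m) t)\<close> is a sum of two
  products of a function of \<open>n\<close> and a function of \<open>m\<close>, so the twisted bound applies at each \<open>t\<close>.  The factors
  \<open>n exp (- n t)\<close> are at most \<open>min X (1/t)\<close>, whose integral against \<open>t powr (-s)\<close> is of
  order \<open>X powr s\<close>.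
\<close>
lemma hankel_bounded_untwist:
  assumes hb: "hankel_bounded (\<lambda>k. a k * of_real (real k powr (-s)))" and s: "0 < s" "s < 1"
  shows "\<exists>C\<ge>0. \<forall>X\<ge>1. \<forall>N M c d. N \<subseteq> {n. 1 \<le> n \<and> real n \<le> X} \<longrightarrow> M \<subseteq> {m. 1 \<le> m \<and> real m \<le> X} \<longrightarrow>
     norm (\<Sum>n\<in>N. \<Sum>m\<in>M. c n * d m * a (n + m)) \<le>
       C * X powr s * (sqrt (\<Sum>n\<in>N. (norm (c n))\<^sup>2) * sqrt (\<Sum>m\<in>M. (norm (d m))\<^sup>2))"
proof -
  define b where "b = (\<lambda>k::nat. a k * of_real (real k powr (-s)))"
  obtain C0 where C0: "C0 \<ge> 0" and hankel: "\<And>N M c d. finite N \<Longrightarrow> finite M \<Longrightarrow> 0 \<notin> N \<Longrightarrow> 0 \<notin> M \<Longrightarrow>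
     norm (\<Sum>n\<in>N. \<Sum>m\<in>M. c n * d m * b (n + m)) \<le>
       C0 * (sqrt (\<Sum>n\<in>N. (norm (c n))\<^sup>2) * sqrt (\<Sum>m\<in>M. (norm (d m))\<^sup>2))"
    using hb unfolding hankel_bounded_def b_def by blast
  define G where "G = Gamma (1 - s)"
  have G: "G > 0" using s by (simp add: G_def)
  show ?thesis
  proof (intro exI[of _ "2 * C0 * (1 / (1 - s) + 1 / s) / G"] conjI allI impI)
    show "2 * C0 * (1 / (1 - s) + 1 / s) / G \<ge> 0" using C0 s G by simp
    fix X :: real and N M :: "nat set" and c d :: "nat \<Rightarrow> complex"
    assume X: "X \<ge> 1" and N: "N \<subseteq> {n. 1 \<le> n \<and> real n \<le> X}" and M: "M \<subseteq> {m. 1 \<le> m \<and> real m \<le> X}"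
    have fin: "finite {n. 1 \<le> n \<and> real n \<le> X}"
      by (rule finite_subset[of _ "{..nat \<lfloor>X\<rfloor>}"]) (auto simp: le_nat_floor)
    have finN: "finite N" and finM: "finite M" using N M fin finite_subset by auto
    have N0: "0 \<notin> N" and M0: "0 \<notin> M" using N M by auto
    define L where "L = sqrt (\<Sum>n\<in>N. (norm (c n))\<^sup>2) * sqrt (\<Sum>m\<in>M. (norm (d m))\<^sup>2)"
    define h where "h = (\<lambda>t::real. if t \<le> 1 / X then X else 1 / t)"
    define u where "u = (\<lambda>t n. of_real (real n * exp (- (real n * t))) :: complex)"
    define v where "v = (\<lambda>t n. of_real (exp (- (real n * t))) :: complex)"
    define S where "S = (\<lambda>t. (\<Sum>n\<in>N. \<Sum>m\<in>M. (c n * u t n) * (d m * v t m) * b (n + m)) + (\<Sum>n\<in>N. \<Sum>m\<in>M. (c n * v t n) * (d m * u t m) * b (n + m)))"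
    have h0: "h t \<ge> 0" if "t > 0" for t using that X by (simp add: h_def)
    have u: "norm (u t n) \<le> h t" if "t > 0" "1 \<le> n" "real n \<le> X" for t n
    proof -
      have "real n * exp (- (real n * t)) \<le> X * 1"
        using that by (intro mult_mono) auto
      moreover have "real n * t \<le> exp (real n * t)" using exp_ge_add_one_self[of "real n * t"] by linarith
      then have "real n * exp (- (real n * t)) \<le> 1 / t" using that by (simp add: exp_minus field_simps)
      ultimately show ?thesis
        unfolding u_def h_def norm_of_real by (simp add: abs_mult)
    qed
    have v: "norm (v t n) \<le> 1" if "t > 0" for t n using that by (simp add: v_def)
    have l2: "sqrt (\<Sum>n\<in>K. (norm (x n * y n))\<^sup>2) \<le> B * sqrt (\<Sum>n\<in>K. (norm (x n))\<^sup>2)"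
      if "\<And>n. n \<in> K \<Longrightarrow> norm (y n) \<le> B" "B \<ge> 0" for K :: "nat set" and x y :: "nat \<Rightarrow> complex" and B
    proof -
      have "(\<Sum>n\<in>K. (norm (x n * y n))\<^sup>2) \<le> (\<Sum>n\<in>K. (B * norm (x n))\<^sup>2)"
        using that by (intro sum_mono power_mono) (auto simp: norm_mult mult.commute[of B] intro!: mult_left_mono)
      also have "\<dots> = B\<^sup>2 * (\<Sum>n\<in>K. (norm (x n))\<^sup>2)" by (simp add: power_mult_distrib sum_distrib_left)
      finally have "sqrt (\<Sum>n\<in>K. (norm (x n * y n))\<^sup>2) \<le> sqrt (B\<^sup>2 * (\<Sum>n\<in>K. (norm (x n))\<^sup>2))"
        by (rule real_sqrt_le_mono)
      then show ?thesis using that(2) by (simp add: real_sqrt_mult)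
    qed
    have Sb: "norm (S t) \<le> 2 * C0 * h t * L" if t: "t > 0" for t
    proof -
      have "norm (S t) \<le> C0 * ((h t * sqrt (\<Sum>n\<in>N. (norm (c n))\<^sup>2)) * (1 * sqrt (\<Sum>m\<in>M. (norm (d m))\<^sup>2)))
         + C0 * ((1 * sqrt (\<Sum>n\<in>N. (norm (c n))\<^sup>2)) * (h t * sqrt (\<Sum>m\<in>M. (norm (d m))\<^sup>2)))"
        unfolding S_def
        using N M t v h0[OF t]
        by (intro order_trans[OF norm_triangle_ineq] add_mono order_trans[OF hankel[OF finN finM N0 M0]]
           mult_left_mono mult_mono l2 C0) (auto intro!: u mult_nonneg_nonneg simp: sum_nonneg)
      then show ?thesis by (simp add: L_def algebra_simps)
    qed
    have I: "((\<lambda>t. of_real (t powr (-s)) * S t) has_integral of_real G * (\<Sum>n\<in>N. \<Sum>m\<in>M. c n * d m * a (n + m))) {0<..}"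
    proof -
      have k: "((\<lambda>t. complex_of_real (t powr (-s) * exp (- (k * t)))) has_integral of_real (G * k powr (s - 1))) {0<..}"
        if "k > 0" for k
        using has_integral_of_real[OF Gamma_integral_scaled_real[of "1 - s" k]] that s by (simp add: G_def)
      have "((\<lambda>t. \<Sum>n\<in>N. \<Sum>m\<in>M. (c n * d m * b (n + m) * of_nat (n + m)) * of_real (t powr (-s) * exp (- (real (n + m) * t)))) has_integral
        (\<Sum>n\<in>N. \<Sum>m\<in>M. (c n * d m * b (n + m) * of_nat (n + m)) * of_real (G * real (n + m) powr (s - 1)))) {0<..}"
      proof (intro has_integral_sum has_integral_mult_right finN finM k)
        fix n m assume "n \<in> N" "m \<in> M"
        then show "real (n + m) > 0" using N by auto
      qed
      also have "(\<lambda>t. \<Sum>n\<in>N. \<Sum>m\<in>M. (c n * d m * b (n + m) * of_nat (n + m)) * of_real (t powr (-s) * exp (- (real (n + m) * t))))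
          = (\<lambda>t. of_real (t powr (-s)) * S t)"
      proof
        fix t :: real
        have "exp (- (real (n + m) * t)) = exp (- (real n * t)) * exp (- (real m * t))" for n m
          by (simp add: exp_add[symmetric] algebra_simps)
        then show "(\<Sum>n\<in>N. \<Sum>m\<in>M. (c n * d m * b (n + m) * of_nat (n + m)) * of_real (t powr (-s) * exp (- (real (n + m) * t)))) = of_real (t powr (-s)) * S t"
          unfolding S_def u_def v_def sum.distrib[symmetric] sum_distrib_left
          by (intro sum.cong refl) (simp add: algebra_simps)
      qed
      also have "(\<Sum>n\<in>N. \<Sum>m\<in>M. (c n * d m * b (n + m) * of_nat (n + m)) * of_real (G * real (n + m) powr (s - 1))) =
           of_real G * (\<Sum>n\<in>N. \<Sum>m\<in>M. c n * d m * a (n + m))"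
        unfolding sum_distrib_left
      proof (intro sum.cong refl)
        fix n m assume nm: "n \<in> N" "m \<in> M"
        have "real (n + m) > 0" using nm N by auto
        moreover have "k powr (-s) * k * k powr (s - 1) = 1" if "k > 0" for k :: real
          using that by (simp add: powr_minus powr_diff field_simps)
        ultimately have "real (n + m) powr (-s) * real (n + m) * real (n + m) powr (s - 1) = 1"
          by blast
        then have "complex_of_real (real (n + m) powr (-s)) * of_nat (n + m) * of_real (real (n + m) powr (s - 1)) = 1"
          by (metis of_real_1 of_real_mult of_real_of_nat_eq)
        moreover have "(c n * d m * b (n + m) * of_nat (n + m)) * of_real (G * real (n + m) powr (s - 1)) =
            of_real G * (c n * d m * a (n + m)) * (complex_of_real (real (n + m) powr (-s)) * of_nat (n + m) * of_real (real (n + m) powr (s - 1)))"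
          unfolding b_def of_real_mult by (simp only: mult_ac)
        ultimately show "(c n * d m * b (n + m) * of_nat (n + m)) * of_real (G * real (n + m) powr (s - 1)) = of_real G * (c n * d m * a (n + m))"
          by (simp only: mult_1_right)
      qed
      finally show ?thesis .
    qed
    have "norm (of_real G * (\<Sum>n\<in>N. \<Sum>m\<in>M. c n * d m * a (n + m))) \<le> integral {0<..} (\<lambda>t. 2 * C0 * L * (t powr (-s) * h t))"
      unfolding integral_unique[OF I, symmetric]
    proof (rule integral_norm_bound_integral)
      show "(\<lambda>t. 2 * C0 * L * (t powr (-s) * h t)) integrable_on {0<..}"
        using has_integral_min_powr[of s X] s X unfolding h_def by (intro integrable_on_mult_right) (auto intro: has_integral_integrable)
      fix t :: real assume "t \<in> {0<..}"
      then show "norm (of_real (t powr (-s)) * S t) \<le> 2 * C0 * L * (t powr (-s) * h t)"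
        using mult_left_mono[OF Sb[of t], of "t powr (-s)"] by (simp add: norm_mult algebra_simps)
    qed (use I in blast)
    also have "\<dots> = 2 * C0 * L * (X powr s / (1 - s) + X powr s / s)"
      using has_integral_min_powr[of s X] s X unfolding h_def by (simp add: integral_unique)
    finally have "G * norm (\<Sum>n\<in>N. \<Sum>m\<in>M. c n * d m * a (n + m)) \<le> 2 * C0 * L * (X powr s / (1 - s) + X powr s / s)"
      using G by (simp add: norm_mult)
    then have "norm (\<Sum>n\<in>N. \<Sum>m\<in>M. c n * d m * a (n + m)) \<le> 2 * C0 * L * (X powr s / (1 - s) + X powr s / s) / G"
      using G by (simp add: field_simps)
    also have "\<dots> = 2 * C0 * (1 / (1 - s) + 1 / s) / G * X powr s * L" by (simp add: field_simps)
    finally show "norm (\<Sum>n\<in>N. \<Sum>m\<in>M. c n * d m * a (n + m)) \<le> 2 * C0 * (1 / (1 - s) + 1 / s) / G * X powr s *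
       (sqrt (\<Sum>n\<in>N. (norm (c n))\<^sup>2) * sqrt (\<Sum>m\<in>M. (norm (d m))\<^sup>2))" unfolding L_def .
  qed
qed

section \<open>The K-Bessel function and its Mellin transform\<close>

lemma continuous_dominated_absolutely_integrable:
  fixes f :: "'a::euclidean_space \<Rightarrow> 'b::euclidean_space"
  assumes "continuous_on S f" "S \<in> sets borel" "g integrable_on S" "\<And>x. x \<in> S \<Longrightarrow> norm (f x) \<le> g x"
  shows "f absolutely_integrable_on S"
proof (rule measurable_bounded_by_integrable_imp_absolutely_integrable)
  show "S \<in> sets lebesgue" using assms(2) by auto
  then show "f \<in> borel_measurable (lebesgue_on S)"
    by (intro continuous_imp_measurable_on_sets_lebesgue assms)
qed (use assms in auto)

lemma norm_cosh_mult_le: "norm (cosh (\<mu> * of_real t) :: complex) \<le> exp (\<bar>Re \<mu>\<bar> * \<bar>t\<bar>)"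
proof -
  have "norm (cosh (\<mu> * of_real t) :: complex) \<le> (norm (exp (\<mu> * of_real t)) + norm (exp (- (\<mu> * of_real t)))) / 2"
    unfolding cosh_def using norm_triangle_ineq[of "exp (\<mu> * of_real t)" "exp (- (\<mu> * of_real t))"]
    by (simp only: norm_scaleR) simp
  also have "\<dots> \<le> (exp (\<bar>Re \<mu>\<bar> * \<bar>t\<bar>) + exp (\<bar>Re \<mu>\<bar> * \<bar>t\<bar>)) / 2"
    using abs_ge_self[of "Re \<mu> * t"] abs_ge_minus_self[of "Re \<mu> * t"]
    by (intro divide_right_mono add_mono) (auto simp: abs_mult)
  finally show ?thesis by simp
qed

lemma cosh_ge_quadratic: "cosh t \<ge> 1 + t\<^sup>2 / 2" for t :: real
proof -
  have *: "cosh t \<ge> 1 + t\<^sup>2 / 2" if "t \<ge> 0" for t :: real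
  proof -
    have d: "sinh t - t \<ge> 0" if "t \<ge> 0" for t :: real
    proof -
      have "sinh 0 - 0 \<le> sinh t - t"
        by (rule DERIV_nonneg_imp_nondecreasing[OF that])
           (auto intro!: exI derivative_eq_intros simp: cosh_real_ge_1)
      then show ?thesis by simp
    qed
    have "cosh 0 - 1 - 0\<^sup>2 / 2 \<le> cosh t - 1 - t\<^sup>2 / 2"
    proof (rule DERIV_nonneg_imp_nondecreasing[OF that])
      fix x :: real assume "0 \<le> x" "x \<le> t"
      then show "\<exists>y. ((\<lambda>t. cosh t - 1 - t\<^sup>2 / 2) has_real_derivative y) (at x) \<and> 0 \<le> y"
        by (intro exI[of _ "sinh x - x"] conjI d) (auto intro!: derivative_eq_intros)
    qed
    then show ?thesis by simp
  qed
  show ?thesis using *[of "\<bar>t\<bar>"] by simp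
qed

lemma has_integral_exp_minus_Ici: "((\<lambda>t::real. exp (- (a * t))) has_integral 1 / a) {0..}" if "a > 0"
  using has_integral_exp_minus_to_infinity[OF that, of 0] by simp

text \<open>
  Since \<open>cosh t \<ge> 1 + t^2 / 2\<close>, the exponent is at most \<open>- x - x t^2 / 2 + |Re \<mu>| t\<close>; completing the square
  leaves the convergent factor \<open>exp (- t)\<close>.
\<close>
lemma bessel_K_integrand:
  fixes x t :: real
  assumes "x > 0" "t \<ge> 0"
  shows "norm (of_real (exp (- x * cosh t)) * cosh (\<mu> * of_real t) :: complex) \<le>
     exp (- x) * exp ((\<bar>Re \<mu>\<bar> + 1)\<^sup>2 / (2 * x)) * exp (- (1 * t))"
proof -
  let ?a = "\<bar>Re \<mu>\<bar>"
  have "norm (of_real (exp (- x * cosh t)) * cosh (\<mu> * of_real t) :: complex) \<le> exp (- x * cosh t) * exp (?a * t)"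
    using norm_cosh_mult_le[of \<mu> t] assms by (simp add: norm_mult mult_left_mono)
  also have "\<dots> = exp (- x * cosh t + ?a * t)" by (simp only: exp_add)
  also have "\<dots> \<le> exp (- x + (?a + 1)\<^sup>2 / (2 * x) - t)"
  proof (subst exp_le_cancel_iff)
    have "x * (1 + t\<^sup>2 / 2) \<le> x * cosh t"
      using cosh_ge_quadratic[of t] assms by (intro mult_left_mono) auto
    moreover have "0 \<le> (x * t - (?a + 1))\<^sup>2 / (2 * x)" using assms by simp
    moreover have "(x * t - (?a + 1))\<^sup>2 / (2 * x) = x * t\<^sup>2 / 2 - (?a + 1) * t + (?a + 1)\<^sup>2 / (2 * x)"
      using assms by (simp add: field_simps power2_eq_square)
    ultimately show "- x * cosh t + ?a * t \<le> - x + (?a + 1)\<^sup>2 / (2 * x) - t"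
      by (simp add: algebra_simps)
  qed
  also have "\<dots> = exp (- x) * exp ((?a + 1)\<^sup>2 / (2 * x)) * exp (- (1 * t))"
    by (simp add: exp_add[symmetric])
  finally show ?thesis .
qed

lemma bessel_K_absolutely_integrable:
  assumes "x > 0"
  shows "(\<lambda>t. of_real (exp (- x * cosh t)) * cosh (\<mu> * of_real t) :: complex) absolutely_integrable_on {0..}"
proof (rule continuous_dominated_absolutely_integrable)
  show "continuous_on {0..} (\<lambda>t. of_real (exp (- x * cosh t)) * cosh (\<mu> * of_real t) :: complex)"
    by (intro continuous_intros)
  show "(\<lambda>t. exp (- x) * exp ((\<bar>Re \<mu>\<bar> + 1)\<^sup>2 / (2 * x)) * exp (- (1 * t))) integrable_on {0..}"
    using has_integral_exp_minus_Ici[of 1] by (intro integrable_on_mult_right) (auto intro: has_integral_integrable)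
qed (use assms bessel_K_integrand in auto)

lemma bessel_K_upper:
  assumes "x > 0"
  shows "norm (bessel_K \<mu> x) \<le> exp (- x) * exp ((\<bar>Re \<mu>\<bar> + 1)\<^sup>2 / (2 * x))"
proof -
  have "norm (bessel_K \<mu> x) \<le> integral {0..} (\<lambda>t. exp (- x) * exp ((\<bar>Re \<mu>\<bar> + 1)\<^sup>2 / (2 * x)) * exp (- (1 * t)))"
    unfolding bessel_K_def
    using bessel_K_absolutely_integrable[OF assms] has_integral_exp_minus_Ici[of 1] 
    by (intro integral_norm_bound_integral bessel_K_integrand assms integrable_on_mult_right)
       (auto intro: has_integral_integrable set_lebesgue_integral_eq_integral)
  also have "\<dots> = exp (- x) * exp ((\<bar>Re \<mu>\<bar> + 1)\<^sup>2 / (2 * x))"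
    using integral_unique[OF has_integral_exp_minus_Ici[of 1]] by simp
  finally show ?thesis .
qed

lemma bessel_K_minus: "bessel_K (- \<mu>) x = bessel_K \<mu> x"
  by (simp add: bessel_K_def)

text \<open>
  Laplace's method.  Near 0 the real part of \<open>g\<close> is at least 1/2, so a short initial interval contributes at least a
  constant times \<open>exp (- S \<phi> t1)\<close>; beyond \<open>t0 > t1\<close> the integrand is
  smaller by a factor \<open>exp (- S (\<phi> t0 - \<phi> t1))\<close>.  The point 1 in the conclusion serves
  only as an explicit upper bound for \<open>t1\<close>.
\<close>
lemma laplace_lower_bound:
  fixes \<phi> :: "real \<Rightarrow> real" and g :: "real \<Rightarrow> complex"
  assumes mono: "strict_mono_on {0..} \<phi>"
    and cont: "continuous_on {0..} \<phi>" "continuous_on {0..} g" and g0: "g 0 = 1"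
    and int: "\<And>S. S \<ge> S0 \<Longrightarrow> (\<lambda>t. of_real (exp (- (S * \<phi> t))) * g t) absolutely_integrable_on {0..}"
  shows "\<exists>c>0. \<exists>S1\<ge>0. \<forall>S\<ge>S1. norm (integral {0..} (\<lambda>t. of_real (exp (- (S * \<phi> t))) * g t)) \<ge> c * exp (- (S * \<phi> 1))"
proof -
  have "isCont (\<lambda>t. g \<bar>t\<bar>) 0"
  proof -
    have "continuous_on UNIV (\<lambda>t. g \<bar>t\<bar>)"
      by (rule continuous_on_compose2[OF cont(2)]) (auto intro!: continuous_intros)
    then show ?thesis by (simp add: continuous_on_eq_continuous_at)
  qed
  then obtain d where d: "d > 0" "\<And>t. \<bar>t\<bar> < d \<Longrightarrow> norm (g \<bar>t\<bar> - g 0) < 1 / 2"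
    unfolding continuous_at_eps_delta dist_norm by (metis abs_zero diff_zero half_gt_zero_iff real_norm_def zero_less_one)
  define t0 where "t0 = min 1 (d / 2)"
  define t1 where "t1 = t0 / 2"
  have t0: "t0 > 0" "t0 \<le> 1" "t0 < d" using d(1) by (auto simp: t0_def)
  have t1: "t1 > 0" "t1 < t0" using t0 by (auto simp: t1_def)
  have Reg: "Re (g t) \<ge> 1 / 2" if "t \<in> {0..t0}" for t
  proof -
    have "norm (g t - 1) < 1 / 2" using d(2)[of t] that t0 g0 by simp
    then have "\<bar>Re (g t - 1)\<bar> < 1 / 2" using abs_Re_le_cmod le_less_trans by blast
    then show ?thesis unfolding minus_complex.sel one_complex.sel by linarith
  qed
  have mono': "\<phi> s \<le> \<phi> t" if "0 \<le> s" "s \<le> t" for s t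
    using strict_mono_on_leD[OF mono, of s t] that by simp
  define F where "F = (\<lambda>S t. of_real (exp (- (S * \<phi> t))) * g t :: complex)"
  define S2 where "S2 = max S0 0"
  define J where "J = integral {0..} (\<lambda>t. norm (F S2 t))"
  have Fint: "F S absolutely_integrable_on {0..}" if "S \<ge> S0" for S using int[OF that] by (simp add: F_def)
  have Fnint: "(\<lambda>t. norm (F S t)) integrable_on {0..}" if "S \<ge> S0" for S
    using Fint[OF that] by (simp add: absolutely_integrable_on_def)
  have J0: "J \<ge> 0" unfolding J_def by (intro Henstock_Kurzweil_Integration.integral_nonneg Fnint) (auto simp: S2_def)
  define \<delta> where "\<delta> = \<phi> t0 - \<phi> t1"
  have \<delta>: "\<delta> > 0" using strict_mono_onD[OF mono, of t1 t0] t1 by (simp add: \<delta>_def)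
  define J' where "J' = J * exp (S2 * \<phi> t0)"
  have J'0: "J' \<ge> 0" using J0 by (simp add: J'_def)
  have "((\<lambda>S. J' * exp (- (\<delta> * S))) \<longlongrightarrow> J' * 0) at_top"
    by (intro tendsto_mult tendsto_const filterlim_compose[OF exp_at_bot] filterlim_compose[OF filterlim_uminus_at_bot_at_top]
         filterlim_tendsto_pos_mult_at_top[OF tendsto_const \<delta>] filterlim_ident)
  then have "eventually (\<lambda>S. J' * exp (- (\<delta> * S)) < t1 / 4) at_top"
    using t1 by (intro order_tendstoD) auto
  then obtain S3 where S3: "\<And>S. S \<ge> S3 \<Longrightarrow> J' * exp (- (\<delta> * S)) < t1 / 4"
    by (auto simp: eventually_at_top_linorder)
  show ?thesis
  proof (rule exI[of _ "t1 / 4"], rule conjI, simp add: t1, rule exI[of _ "max S2 S3"], intro conjI allI impI)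
    show "max S2 S3 \<ge> 0" by (simp add: S2_def)
    fix S assume "S \<ge> max S2 S3"
    then have S: "S \<ge> S2" "S \<ge> S3" "S \<ge> 0" "S \<ge> S0" by (auto simp: S2_def)
    have FS: "F S integrable_on {0..}" using Fint[OF S(4)] set_lebesgue_integral_eq_integral(1) by blast
    have FS0: "F S integrable_on {0..t0}" 
      by (rule set_lebesgue_integral_eq_integral(1), rule absolutely_integrable_on_subinterval[OF Fint[OF S(4)]]) auto
    have "F S absolutely_integrable_on {t0..}"
      by (rule set_integrable_subset[OF Fint[OF S(4)]]) (use t0 in auto)
    then have FS1: "F S integrable_on {t0..}" "(\<lambda>t. norm (F S t)) integrable_on {t0..}" 
      by (auto simp: absolutely_integrable_on_def)
    have "{0..} = {0..t0} \<union> {t0..}" using t0 by auto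
    then have split: "integral {0..} (F S) = integral {0..t0} (F S) + integral {t0..} (F S)"
      by (simp only:) (intro integral_Un FS0 FS1, auto intro: negligible_subset[of "{t0}"])
    have main: "Re (integral {0..t0} (F S)) \<ge> t1 / 2 * exp (- (S * \<phi> t1))"
    proof -
      have *: "(\<lambda>t. Re (F S t)) integrable_on {0..t0}" using has_integral_Re[OF integrable_integral[OF FS0]] has_integral_integrable by blast
      have "t1 / 2 * exp (- (S * \<phi> t1)) = integral {0..t1} (\<lambda>t. 1 / 2 * exp (- (S * \<phi> t1)))"
        using t1 by simp
      also have "\<dots> \<le> integral {0..t1} (\<lambda>t. Re (F S t))"
      proof (rule integral_le)
        show "(\<lambda>t. Re (F S t)) integrable_on {0..t1}"
          by (rule integrable_subinterval_real[OF *]) (use t1 in auto)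
        show "(\<lambda>t. 1 / 2 * exp (- (S * \<phi> t1))) integrable_on {0..t1}"
          by (intro integrable_continuous_interval continuous_intros)
        fix t assume t: "t \<in> {0..t1}"
        have "1 / 2 * exp (- (S * \<phi> t1)) \<le> Re (g t) * exp (- (S * \<phi> t))"
          using t t1 S mono'[of t t1] Reg[of t] by (intro mult_mono) (auto intro!: mult_left_mono)
        then show "1 / 2 * exp (- (S * \<phi> t1)) \<le> Re (F S t)" by (simp add: F_def mult.commute)
      qed
      also have "\<dots> \<le> integral {0..t0} (\<lambda>t. Re (F S t))"
      proof (rule integral_subset_le)
        show "(\<lambda>t. Re (F S t)) integrable_on {0..t1}"
          by (rule integrable_subinterval_real[OF *]) (use t1 in auto)
        show "\<forall>t\<in>{0..t0}. 0 \<le> Re (F S t)"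
        proof
          fix t assume "t \<in> {0..t0}"
          from Reg[OF this] show "0 \<le> Re (F S t)" by (simp add: F_def)
        qed
      qed (use t1 * in auto)
      also have "\<dots> = Re (integral {0..t0} (F S))" by (rule integral_unique[OF has_integral_Re[OF integrable_integral[OF FS0]]])
      finally show ?thesis .
    qed
    have tail: "norm (integral {t0..} (F S)) \<le> exp (- (S * \<phi> t1)) * (J' * exp (- (\<delta> * S)))"
    proof -
      have "norm (integral {t0..} (F S)) \<le> integral {t0..} (\<lambda>t. exp (- ((S - S2) * \<phi> t0)) * norm (F S2 t))"
      proof (rule integral_norm_bound_integral[OF FS1(1)])
        have "F S2 absolutely_integrable_on {t0..}"
          by (rule set_integrable_subset[OF Fint]) (use t0 in \<open>auto simp: S2_def\<close>)
        then show "(\<lambda>t. exp (- ((S - S2) * \<phi> t0)) * norm (F S2 t)) integrable_on {t0..}"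
          by (intro integrable_on_mult_right) (auto simp: absolutely_integrable_on_def)
        fix t assume t: "t \<in> {t0..}"
        have "S * \<phi> t \<ge> (S - S2) * \<phi> t0 + S2 * \<phi> t"
          using mult_left_mono[OF mono'[of t0 t], of "S - S2"] t t0 S by (simp add: algebra_simps)
        then have "exp (- (S * \<phi> t)) \<le> exp (- ((S - S2) * \<phi> t0)) * exp (- (S2 * \<phi> t))"
          by (simp add: exp_add[symmetric])
        then show "norm (F S t) \<le> exp (- ((S - S2) * \<phi> t0)) * norm (F S2 t)"
          by (simp add: F_def norm_mult mult_right_mono flip: mult.assoc)
      qed
      also have "\<dots> = exp (- ((S - S2) * \<phi> t0)) * integral {t0..} (\<lambda>t. norm (F S2 t))" by simp
      also have "\<dots> \<le> exp (- ((S - S2) * \<phi> t0)) * J"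
        unfolding J_def
      proof (intro mult_left_mono integral_subset_le)
        have "F S2 absolutely_integrable_on {t0..}"
          by (rule set_integrable_subset[OF Fint]) (use t0 in \<open>auto simp: S2_def\<close>)
        then show "(\<lambda>t. norm (F S2 t)) integrable_on {t0..}" by (simp add: absolutely_integrable_on_def)
      qed (use t0 Fnint[of S2] in \<open>auto simp: S2_def\<close>)
      also have "\<dots> = exp (- (S * \<phi> t1)) * (J' * exp (- (\<delta> * S)))"
        by (simp add: J'_def \<delta>_def algebra_simps exp_add[symmetric] exp_diff[symmetric])
      finally show ?thesis .
    qed
    have "t1 / 4 * exp (- (S * \<phi> 1)) \<le> t1 / 4 * exp (- (S * \<phi> t1))"
      using t1 t0 S mono'[of t1 1] by (intro mult_left_mono) (auto intro!: mult_left_mono)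
    also have "\<dots> \<le> t1 / 2 * exp (- (S * \<phi> t1)) - exp (- (S * \<phi> t1)) * (J' * exp (- (\<delta> * S)))"
      using S3[OF S(2)] mult_left_mono[of "J' * exp (- (\<delta> * S))" "t1 / 4" "exp (- (S * \<phi> t1))"] by simp
    also have "\<dots> \<le> Re (integral {0..t0} (F S)) - norm (integral {t0..} (F S))"
      using main tail by simp
    also have "\<dots> \<le> Re (integral {0..} (F S))"
      unfolding split using abs_Re_le_cmod[of "integral {t0..} (F S)"] by simp
    also have "\<dots> \<le> norm (integral {0..} (F S))" by (rule complex_Re_le_cmod)
    finally show "t1 / 4 * exp (- (S * \<phi> 1)) \<le> norm (integral {0..} (\<lambda>t. of_real (exp (- (S * \<phi> t))) * g t))"
      by (simp add: F_def)
  qed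
qed

lemma strict_mono_on_cosh: "strict_mono_on {0..} (cosh :: real \<Rightarrow> real)"
  by (rule strict_mono_onI) (auto simp: cosh_real_strict_mono)

text \<open>
  A lower bound for \<open>K\<close> turns the convergence of the Fourier expansion at one height
  into a bound for the coefficients.  The crude exponent 2 is harmless because that height may be small.
\<close>
lemma bessel_K_lower:
  "\<exists>c>0. \<exists>x0\<ge>0. \<forall>x\<ge>x0. norm (bessel_K \<mu> x) \<ge> c * exp (- 2 * x)"
proof -
  have "\<exists>c>0. \<exists>S1\<ge>0. \<forall>S\<ge>S1. norm (integral {0..} (\<lambda>t. of_real (exp (- (S * cosh t))) * cosh (\<mu> * of_real t) :: complex)) \<ge> c * exp (- (S * cosh 1))"
    by (rule laplace_lower_bound[OF strict_mono_on_cosh, where ?S0.0 = 1])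
       (use bessel_K_absolutely_integrable in \<open>auto intro!: continuous_intros\<close>)
  then obtain c S1 where c: "c > 0" "S1 \<ge> 0" and K: "\<And>x. x \<ge> S1 \<Longrightarrow> norm (bessel_K \<mu> x) \<ge> c * exp (- (x * cosh 1))"
    unfolding bessel_K_def by auto
  have "cosh (1::real) \<le> 2"
    using exp_le by (simp add: cosh_def)
      (smt (verit) exp_gt_zero exp_minus_inverse exp_le_one_iff)
  then have "c * exp (- 2 * x) \<le> c * exp (- (x * cosh 1))" if "x \<ge> 0" for x
    using c that mult_left_mono[of "cosh 1" 2 x] by simp
  then show ?thesis using c K by (meson order_trans)
qed

text \<open>
  The Mellin transform of \<open>bessel_K \<mu>\<close> at \<open>s\<close> is \<open>Gamma s * cosh_mellin \<mu> s\<close>.  The power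
  \<open>cosh t powr (-s)\<close> is written as an exponential of a real logarithm, which is smooth in \<open>t\<close>.
\<close>
definition cosh_mellin :: "complex \<Rightarrow> complex \<Rightarrow> complex" where
  "cosh_mellin \<mu> s = integral {0..} (\<lambda>t. exp (- s * of_real (ln (cosh t))) * cosh (\<mu> * of_real t))"

lemma cosh_mellin_integrand_bound:
  assumes "Re s \<ge> 0" "t \<ge> 0"
  shows "norm (exp (- s * of_real (ln (cosh t))) * cosh (\<mu> * of_real t) :: complex) \<le>
     2 powr Re s * exp (- ((Re s - \<bar>Re \<mu>\<bar>) * t))"
proof -
  have "exp t / 2 \<le> cosh t" by (simp add: cosh_def)
  then have "ln (exp t / 2) \<le> ln (cosh t)" by (subst ln_le_cancel_iff) auto
  then have l: "t - ln 2 \<le> ln (cosh t)" by (simp add: ln_div)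
  have "norm (exp (- s * of_real (ln (cosh t))) * cosh (\<mu> * of_real t) :: complex)
      = exp (- (Re s * ln (cosh t))) * norm (cosh (\<mu> * of_real t))" by (simp add: norm_mult)
  also have "\<dots> \<le> exp (- (Re s * (t - ln 2))) * exp (\<bar>Re \<mu>\<bar> * t)"
    using norm_cosh_mult_le[of \<mu> t] l assms by (intro mult_mono) (auto intro: mult_left_mono)
  also have "\<dots> = 2 powr Re s * exp (- ((Re s - \<bar>Re \<mu>\<bar>) * t))"
    by (simp add: powr_def exp_add[symmetric] algebra_simps)
  finally show ?thesis .
qed

lemma cosh_mellin_absolutely_integrable:
  assumes "Re s > \<bar>Re \<mu>\<bar>"
  shows "(\<lambda>t. exp (- s * of_real (ln (cosh t))) * cosh (\<mu> * of_real t) :: complex) absolutely_integrable_on {0..}"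
proof (rule continuous_dominated_absolutely_integrable)
  show "continuous_on {0..} (\<lambda>t. exp (- s * of_real (ln (cosh t))) * cosh (\<mu> * of_real t) :: complex)"
    by (intro continuous_intros) (auto simp: cosh_real_nonzero)
  show "(\<lambda>t. 2 powr Re s * exp (- ((Re s - \<bar>Re \<mu>\<bar>) * t))) integrable_on {0..}"
    using assms has_integral_exp_minus_Ici[of "Re s - \<bar>Re \<mu>\<bar>"]
    by (intro integrable_on_mult_right) (auto intro: has_integral_integrable)
  show "norm (exp (- s * of_real (ln (cosh t))) * cosh (\<mu> * of_real t) :: complex) \<le> 2 powr Re s * exp (- ((Re s - \<bar>Re \<mu>\<bar>) * t))"
    if "t \<in> {0..}" for t
    by (rule cosh_mellin_integrand_bound) (use assms that in auto)
qed simp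

lemma integral_Ici_eq_limit:
  fixes F :: "real \<Rightarrow> 'a::euclidean_space"
  assumes int: "f absolutely_integrable_on {0..}"
    and deriv: "\<And>t. t \<ge> 0 \<Longrightarrow> (F has_vector_derivative f t) (at t)"
    and lim: "(\<lambda>n. F (real n)) \<longlonglongrightarrow> L"
  shows "integral {0..} f = L - F 0"
proof -
  let ?f = "\<lambda>n t. if t \<in> {0..real n} then f t else 0"
  have sub: "f integrable_on {0..real n}" for n
    by (rule set_lebesgue_integral_eq_integral(1), rule absolutely_integrable_on_subinterval[OF int]) auto
  have I: "(?f n has_integral integral {0..real n} f) {0..}" for n
    by (subst has_integral_restrict) (auto intro: integrable_integral sub)
  have "(\<lambda>n. integral {0..} (?f n)) \<longlonglongrightarrow> integral {0..} f"
  proof (rule dominated_convergence(2))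
    show "?f n integrable_on {0..}" for n using I by blast
    show "(\<lambda>t. norm (f t)) integrable_on {0..}" using int by (simp add: absolutely_integrable_on_def)
    fix t :: real assume t: "t \<in> {0..}"
    have "eventually (\<lambda>n. ?f n t = f t) sequentially"
      using eventually_ge_at_top[of "nat \<lceil>t\<rceil>"] by eventually_elim (use t in \<open>auto simp: nat_ceiling_le_eq\<close>)
    then show "(\<lambda>n. ?f n t) \<longlonglongrightarrow> f t" by (rule tendsto_eventually)
  qed auto
  moreover have "integral {0..} (?f n) = F (real n) - F 0" for n
  proof -
    have "(f has_integral F (real n) - F 0) {0..real n}"
      by (rule fundamental_theorem_of_calculus) (auto intro: has_vector_derivative_at_within deriv)
    then show ?thesis using integral_unique[OF I[of n]] by (simp add: integral_unique)
  qed
  ultimately have "(\<lambda>n. F (real n) - F 0) \<longlonglongrightarrow> integral {0..} f" by simp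
  moreover have "(\<lambda>n. F (real n) - F 0) \<longlonglongrightarrow> L - F 0" by (intro tendsto_intros lim)
  ultimately show ?thesis using LIMSEQ_unique by blast
qed

lemma norm_sinh_mult_le: "norm (sinh (\<mu> * of_real t) :: complex) \<le> exp (\<bar>Re \<mu>\<bar> * \<bar>t\<bar>)"
proof -
  have "norm (sinh (\<mu> * of_real t) :: complex) \<le> (norm (exp (\<mu> * of_real t)) + norm (exp (- (\<mu> * of_real t)))) / 2"
    unfolding sinh_def using norm_triangle_ineq4[of "exp (\<mu> * of_real t)" "exp (- (\<mu> * of_real t))"]
    by (simp only: norm_scaleR) simp
  also have "\<dots> \<le> (exp (\<bar>Re \<mu>\<bar> * \<bar>t\<bar>) + exp (\<bar>Re \<mu>\<bar> * \<bar>t\<bar>)) / 2"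
    using abs_ge_self[of "Re \<mu> * t"] abs_ge_minus_self[of "Re \<mu> * t"]
    by (intro divide_right_mono add_mono) (auto simp: abs_mult)
  finally show ?thesis by simp
qed

text \<open>
  With \<open>p = cosh t powr (-s)\<close> and \<open>q = cosh (\<mu> t)\<close> one has \<open>q'' = \<mu>^2 q\<close> and
  \<open>p'' = s^2 p - s (s + 1) p / (cosh t)^2\<close>.  The function \<open>p' q - p q'\<close> vanishes at 0 and at infinity,
  so its derivative \<open>p'' q - p q''\<close> has integral 0.
\<close>
lemma cosh_mellin_recurrence:
  assumes s: "Re s > \<bar>Re \<mu>\<bar>"
  shows "s * (s + 1) * cosh_mellin \<mu> (s + 2) = (s\<^sup>2 - \<mu>\<^sup>2) * cosh_mellin \<mu> s"
proof -
  define p where "p = (\<lambda>s t. exp (- s * of_real (ln (cosh t))) :: complex)"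
  define q where "q = (\<lambda>t. cosh (\<mu> * of_real t) :: complex)"
  define q1 where "q1 = (\<lambda>t. sinh (\<mu> * of_real t) :: complex)"
  define F where "F = (\<lambda>t. - s * of_real (tanh t) * p s t * q t - p s t * (\<mu> * q1 t))"
  define f where "f = (\<lambda>t. (s\<^sup>2 - \<mu>\<^sup>2) * (p s t * q t) - s * (s + 1) * (p (s + 2) t * q t))"
  have i1: "(\<lambda>t. p s t * q t) absolutely_integrable_on {0..}"
    unfolding p_def q_def by (rule cosh_mellin_absolutely_integrable[OF s])
  have i2: "(\<lambda>t. p (s + 2) t * q t) absolutely_integrable_on {0..}"
    unfolding p_def q_def by (rule cosh_mellin_absolutely_integrable) (use s in simp)
  have int: "f absolutely_integrable_on {0..}"
    unfolding f_def using i1 i2 by (intro set_integral_diff(1) set_integrable_mult_right) auto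
  have "integral {0..} f = 0 - F 0"
  proof (rule integral_Ici_eq_limit[OF int])
    fix t :: real
    have dp: "(p s has_vector_derivative (- s * of_real (tanh t) * p s t)) (at t)"
    proof -
      have "((\<lambda>t. ln (cosh t)) has_real_derivative tanh t) (at t)"
        by (auto intro!: derivative_eq_intros simp: tanh_def cosh_real_pos)
      then have "((\<lambda>t. complex_of_real (ln (cosh t))) has_vector_derivative of_real (tanh t)) (at t)"
        by (intro has_vector_derivative_of_real) (simp add: has_real_derivative_iff_has_vector_derivative)
      then have "((\<lambda>t. - s * complex_of_real (ln (cosh t))) has_vector_derivative - s * of_real (tanh t)) (at t)"
        by (rule has_vector_derivative_mult_right)
      from field_vector_diff_chain_at[OF this DERIV_exp] show ?thesis
        by (simp add: p_def o_def mult_ac)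
    qed
    have dq: "(q has_vector_derivative \<mu> * q1 t) (at t)" "(q1 has_vector_derivative \<mu> * q t) (at t)"
      unfolding q_def q1_def
      by (rule has_vector_derivative_real_field; auto intro!: derivative_eq_intros)+
    have dt: "((\<lambda>t. complex_of_real (tanh t)) has_vector_derivative of_real (1 - (tanh t)\<^sup>2)) (at t)"
    proof -
      have "(tanh has_real_derivative (1 - (tanh t)\<^sup>2)) (at t)"
        by (auto intro!: derivative_eq_intros)
      then show ?thesis
        by (intro has_vector_derivative_of_real) (simp add: has_real_derivative_iff_has_vector_derivative)
    qed
    have p2: "p (s + 2) t = (1 - (of_real (tanh t))\<^sup>2) * p s t"
    proof -
      have "p (s + 2) t = p s t * of_real (exp (- 2 * ln (cosh t)))"
        by (simp add: p_def exp_add[symmetric] exp_of_real[symmetric] algebra_simps)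
      also have "exp (- 2 * ln (cosh t)) = 1 / (cosh t)\<^sup>2"
        by (simp add: exp_minus exp_double divide_inverse)
      also have "1 / (cosh t)\<^sup>2 = 1 - (tanh t)\<^sup>2"
      proof -
        have "1 - (tanh t)\<^sup>2 = ((cosh t)\<^sup>2 - (sinh t)\<^sup>2) / (cosh t)\<^sup>2"
          by (simp add: tanh_def power_divide diff_divide_distrib)
        then show ?thesis by (simp only: hyperbolic_pythagoras)
      qed
      finally show ?thesis by simp
    qed
    have "(F has_vector_derivative
       ((- s * of_real (tanh t) * p s t * (\<mu> * q1 t) + (- s * of_real (tanh t) * (- s * of_real (tanh t) * p s t) + - s * of_real (1 - (tanh t)\<^sup>2) * p s t) * q t)
       - (p s t * (\<mu> * (\<mu> * q t)) + (- s * of_real (tanh t) * p s t) * (\<mu> * q1 t)))) (at t)"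
      unfolding F_def
      by (intro has_vector_derivative_diff has_vector_derivative_mult has_vector_derivative_mult_right dp dq dt)
    also have "((- s * of_real (tanh t) * p s t * (\<mu> * q1 t) + (- s * of_real (tanh t) * (- s * of_real (tanh t) * p s t) + - s * of_real (1 - (tanh t)\<^sup>2) * p s t) * q t)
       - (p s t * (\<mu> * (\<mu> * q t)) + (- s * of_real (tanh t) * p s t) * (\<mu> * q1 t))) = f t"
      unfolding f_def p2 by (simp add: algebra_simps power2_eq_square)
    finally show "(F has_vector_derivative f t) (at t)" .
  next
    show "(\<lambda>n. F (real n)) \<longlonglongrightarrow> 0"
    proof (rule Lim_null_comparison)
      have Rs: "Re s \<ge> 0" using s by linarith
      define B where "B = 2 powr Re s * (norm s + norm \<mu>)"
      show "eventually (\<lambda>n. norm (F (real n)) \<le> B * exp (- ((Re s - \<bar>Re \<mu>\<bar>) * real n))) sequentially"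
      proof (intro always_eventually allI)
        fix n :: nat
        let ?t = "real n"
        let ?E = "2 powr Re s * exp (- ((Re s - \<bar>Re \<mu>\<bar>) * ?t))"
        have "norm (p s ?t) * exp (\<bar>Re \<mu>\<bar> * ?t) \<le> ?E"
        proof -
          have "norm (p s ?t) \<le> 2 powr Re s * exp (- (Re s * ?t))"
            using cosh_mellin_integrand_bound[OF Rs, of ?t 0] by (simp add: p_def)
          then have "norm (p s ?t) * exp (\<bar>Re \<mu>\<bar> * ?t) \<le> 2 powr Re s * exp (- (Re s * ?t)) * exp (\<bar>Re \<mu>\<bar> * ?t)"
            by (intro mult_right_mono) auto
          also have "\<dots> = ?E" by (simp add: exp_add[symmetric] algebra_simps)
          finally show ?thesis .
        qed
        then have pq: "norm (p s ?t) * norm (q ?t) \<le> ?E" "norm (p s ?t) * norm (q1 ?t) \<le> ?E"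
          using norm_cosh_mult_le[of \<mu> ?t] norm_sinh_mult_le[of \<mu> ?t]
          by (auto simp: q_def q1_def elim!: order_trans[rotated] intro!: mult_left_mono)
        have th: "\<bar>tanh ?t\<bar> \<le> 1" using tanh_real_bounds[of ?t] by auto
        have "norm (F ?t) \<le> norm s * \<bar>tanh ?t\<bar> * (norm (p s ?t) * norm (q ?t)) + norm \<mu> * (norm (p s ?t) * norm (q1 ?t))"
          unfolding F_def by (rule order_trans[OF norm_triangle_ineq4]) (simp add: norm_mult mult_ac)
        also have "\<dots> \<le> norm s * 1 * ?E + norm \<mu> * ?E"
          by (intro add_mono mult_mono pq th) auto
        finally show "norm (F ?t) \<le> B * exp (- ((Re s - \<bar>Re \<mu>\<bar>) * ?t))" by (simp add: B_def algebra_simps)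
      qed
      have "((\<lambda>x. exp (- ((Re s - \<bar>Re \<mu>\<bar>) * x))) \<longlongrightarrow> 0) at_top"
        using s by (intro filterlim_compose[OF exp_at_bot] filterlim_compose[OF filterlim_uminus_at_bot_at_top]
         filterlim_tendsto_pos_mult_at_top[OF tendsto_const _ filterlim_ident]) auto
      from tendsto_mult[OF tendsto_const[of B] filterlim_compose[OF this filterlim_real_sequentially]]
      show "(\<lambda>n. B * exp (- ((Re s - \<bar>Re \<mu>\<bar>) * real n))) \<longlonglongrightarrow> 0" by simp
    qed
  qed
  also have "F 0 = 0" by (simp add: F_def q1_def)
  finally have "integral {0..} f = 0" by simp
  moreover have "integral {0..} f = (s\<^sup>2 - \<mu>\<^sup>2) * cosh_mellin \<mu> s - s * (s + 1) * cosh_mellin \<mu> (s + 2)"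
  proof -
    have c: "cosh_mellin \<mu> z = integral {0..} (\<lambda>t. p z t * q t)" for z
      by (simp add: cosh_mellin_def p_def q_def)
    show ?thesis
      unfolding f_def c
      using i1 i2 by (subst integral_diff) (auto intro!: integrable_on_mult_right set_lebesgue_integral_eq_integral(1))
  qed
  ultimately show ?thesis by simp
qed

text \<open>
  By the recurrence a zero at \<open>s\<close> forces zeros at \<open>s + 2 j\<close> for every \<open>j\<close>, but the
  integrand concentrates at \<open>t = 0\<close> as the real part of \<open>s\<close> grows.
\<close>
lemma cosh_mellin_nonzero:
  assumes s: "Re s > \<bar>Re \<mu>\<bar>"
  shows "cosh_mellin \<mu> s \<noteq> 0"
proof
  assume zero: "cosh_mellin \<mu> s = 0"
  have z: "cosh_mellin \<mu> (s + 2 * of_nat j) = 0" for j :: nat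
  proof (induction j)
    case 0 then show ?case using zero by simp
  next
    case (Suc j)
    have R: "Re (s + 2 * of_nat j) > \<bar>Re \<mu>\<bar>" using s by simp
    have pos: "Re (s + 2 * of_nat j) > 0" using s by simp
    from cosh_mellin_recurrence[OF R] Suc
    have "(s + 2 * of_nat j) * (s + 2 * of_nat j + 1) * cosh_mellin \<mu> (s + 2 * of_nat j + 2) = 0" by simp
    moreover have "s + 2 * of_nat j \<noteq> 0" "s + 2 * of_nat j + 1 \<noteq> 0"
      using pos by (metis less_irrefl zero_complex.sel(1))
        (metis pos add.commute add_pos_pos less_irrefl one_complex.sel(1) plus_complex.sel(1) zero_complex.sel(1) zero_less_one)
    ultimately have "cosh_mellin \<mu> (s + 2 * of_nat j + 2) = 0" by simp
    then show ?case by (simp add: algebra_simps)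
  qed
  \<comment> \<open>The imaginary part of \<open>s\<close> stays fixed along \<open>s + 2 j\<close> and is absorbed into the amplitude.\<close>
  let ?g = "\<lambda>t. exp (- (\<i> * of_real (Im s)) * of_real (ln (cosh t))) * cosh (\<mu> * of_real t) :: complex"
  have eq: "of_real (exp (- (S * ln (cosh t)))) * ?g t = exp (- (of_real S + \<i> * of_real (Im s)) * of_real (ln (cosh t))) * cosh (\<mu> * of_real t)" for S t
  proof -
    have "complex_of_real (exp (- (S * ln (cosh t)))) = exp (- (of_real S * of_real (ln (cosh t))))"
      by (metis exp_of_real of_real_minus of_real_mult)
    then show ?thesis
      unfolding mult.assoc[symmetric] by (simp only: exp_add[symmetric] minus_add_distrib ring_distribs mult_minus_left)
  qed
  have "\<exists>c>0. \<exists>S1\<ge>0. \<forall>S\<ge>S1. norm (integral {0..} (\<lambda>t. of_real (exp (- (S * ln (cosh t)))) * ?g t)) \<ge> c * exp (- (S * ln (cosh 1)))"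
  proof (rule laplace_lower_bound[where ?S0.0 = "Re s"])
    show "strict_mono_on {0..} (\<lambda>t::real. ln (cosh t))"
      by (rule strict_mono_onI) (auto simp: cosh_real_strict_mono)
    show "(\<lambda>t. of_real (exp (- (S * ln (cosh t)))) * ?g t) absolutely_integrable_on {0..}" if "S \<ge> Re s" for S
      unfolding eq by (rule cosh_mellin_absolutely_integrable) (use s that in simp)
  qed (auto intro!: continuous_intros simp: cosh_real_nonzero)
  then obtain c S1 where c: "c > 0" and lb: "\<And>S. S \<ge> S1 \<Longrightarrow> norm (cosh_mellin \<mu> (of_real S + \<i> * of_real (Im s))) \<ge> c * exp (- (S * ln (cosh 1)))"
    unfolding eq cosh_mellin_def[symmetric] by auto
  obtain j :: nat where j: "Re s + 2 * real j \<ge> S1"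
    using reals_Archimedean2[of "S1 - Re s"] by (smt (verit) of_nat_0_le_iff)
  have "of_real (Re s + 2 * real j) + \<i> * of_real (Im s) = s + 2 * of_nat j"
    by (simp add: complex_eq_iff)
  then have "c * exp (- ((Re s + 2 * real j) * ln (cosh 1))) \<le> 0"
    using lb[OF j] z[of j] by (simp only: norm_zero)
  then show False using c by (simp add: mult_le_0_iff)
qed

lemma lborel_integral_from_absolutely_integrable:
  fixes f :: "real \<Rightarrow> 'a::euclidean_space"
  assumes "f \<in> borel_measurable borel" "\<And>x. x \<notin> S \<Longrightarrow> f x = 0"
    and "f absolutely_integrable_on S" "(f has_integral J) S"
  shows "integrable lborel f" "(LINT x|lborel. f x) = J"
proof -
  have "(\<lambda>x. indicator S x *\<^sub>R f x) = f" using assms(2) by (auto simp: indicator_def fun_eq_iff)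
  then have "integrable lebesgue f" using assms(3) by (simp add: set_integrable_def)
  then show i: "integrable lborel f" using assms(1) by (simp add: integrable_completion)
  have "(\<lambda>x. if x \<in> S then f x else 0) = f" using assms(2) by auto
  then have "(f has_integral J) UNIV" using assms(4) has_integral_restrict_UNIV[of S f J] by simp
  then show "(LINT x|lborel. f x) = J" using has_integral_integral_lborel[OF i] has_integral_unique by blast
qed

lemma absolutely_integrable_from_lborel:
  fixes f :: "real \<Rightarrow> 'a::euclidean_space"
  assumes "integrable lborel f" "\<And>x. x \<notin> S \<Longrightarrow> f x = 0" "\<And>x. x \<in> S \<Longrightarrow> f x = g x"
  shows "g absolutely_integrable_on S" "(g has_integral (LINT x|lborel. f x)) S"
proof -
  have "(\<lambda>x. indicator S x *\<^sub>R g x) = f" using assms(2,3) by (auto simp: indicator_def fun_eq_iff)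
  then show "g absolutely_integrable_on S" using assms(1) by (simp add: set_integrable_def integrable_completion)
  have "(\<lambda>x. if x \<in> S then g x else 0) = f" using assms(2,3) by auto
  then show "(g has_integral (LINT x|lborel. f x)) S"
    using has_integral_integral_lborel[OF assms(1)] has_integral_restrict_UNIV[of S g] by simp
qed

text \<open>
  Interchange the integral over \<open>x\<close> with the one defining \<open>bessel_K\<close>: the inner
  integral over \<open>x\<close> is \<open>Gamma s * cosh t powr (-s)\<close>.
\<close>
lemma bessel_K_mellin:
  assumes s: "Re s > \<bar>Re \<mu>\<bar>"
  shows "(\<lambda>x. of_real x powr (s - 1) * bessel_K \<mu> x) absolutely_integrable_on {0<..}"
    and "((\<lambda>x. of_real x powr (s - 1) * bessel_K \<mu> x) has_integral Gamma s * cosh_mellin \<mu> s) {0<..}"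
proof -
  have Rs: "Re s > 0" using s by linarith
  define p where "p = (\<lambda>x::real. indicator {0<..} x *\<^sub>R (of_real x powr (s - 1) :: complex))"
  define q where "q = (\<lambda>t::real. indicator {0..} t *\<^sub>R (cosh (\<mu> * of_real t) :: complex))"
  define E where "E = (\<lambda>(t::real) (x::real). complex_of_real (exp (- (x * cosh t))))"
  define F where "F = (\<lambda>t x. q t * (p x * E t x))"
  have pm [measurable]: "p \<in> borel_measurable borel"
    unfolding p_def by (rule borel_measurable_continuous_on_indicator) (auto intro!: continuous_intros)
  have qm [measurable]: "q \<in> borel_measurable borel"
    unfolding q_def by (rule borel_measurable_continuous_on_indicator) (auto intro!: continuous_intros)
  have cm [measurable]: "(cosh :: real \<Rightarrow> real) \<in> borel_measurable borel"
    by (intro borel_measurable_continuous_onI continuous_intros)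
  have om [measurable]: "complex_of_real \<in> borel_measurable borel"
    by (intro borel_measurable_continuous_onI continuous_intros)
  have Em: "case_prod E \<in> borel_measurable (lborel \<Otimes>\<^sub>M lborel)"
    unfolding E_def by measurable
  have Em1 [measurable]: "E t \<in> borel_measurable borel" "(\<lambda>t. E t x) \<in> borel_measurable borel" for t x
    unfolding E_def by measurable
  have Fm: "case_prod F \<in> borel_measurable (lborel \<Otimes>\<^sub>M lborel)"
    unfolding F_def using Em by measurable
  have inner: "integrable lborel (\<lambda>x. p x * E t x)"
       "(LINT x|lborel. p x * E t x) = Gamma s * of_real (cosh t) powr (- s)"
       "(LINT x|lborel. norm (p x * E t x)) = Gamma (Re s) * cosh t powr (- Re s)" for t
  proof -
    have c: "cosh t > (0::real)" by (rule cosh_real_pos)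
    have eq: "of_real x powr (s - 1) * of_real (exp (- (cosh t * x))) = p x * E t x" if "x \<in> {0<..}" for x
      using that by (simp add: p_def E_def mult.commute)
    note G = Gamma_integral_scaled[OF Rs c]
    have a: "(\<lambda>x. p x * E t x) absolutely_integrable_on {0<..}"
      using G(1) by (subst (asm) set_integrable_cong[OF refl refl eq])
    have b: "((\<lambda>x. p x * E t x) has_integral Gamma s * of_real (cosh t) powr (- s)) {0<..}"
      by (rule has_integral_eq[OF eq G(2)])
    have m: "(\<lambda>x. p x * E t x) \<in> borel_measurable borel" by measurable
    show "integrable lborel (\<lambda>x. p x * E t x)"
       "(LINT x|lborel. p x * E t x) = Gamma s * of_real (cosh t) powr (- s)"
      by (rule lborel_integral_from_absolutely_integrable[OF m _ a b]; simp add: p_def)+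
    have b2: "((\<lambda>x. norm (p x * E t x)) has_integral Gamma (Re s) * cosh t powr (- Re s)) {0<..}"
      by (rule has_integral_eq[OF _ Gamma_integral_scaled_real[OF Rs c]])
         (simp add: p_def E_def norm_mult norm_powr_real_powr mult.commute)
    show "(LINT x|lborel. norm (p x * E t x)) = Gamma (Re s) * cosh t powr (- Re s)"
      by (rule lborel_integral_from_absolutely_integrable[OF _ _ set_integrable_norm[OF a] b2]) (simp_all add: p_def, measurable)
  qed
  have powr_eq: "complex_of_real (cosh t) powr (- s) = exp (- s * of_real (ln (cosh t)))" for t
    by (simp add: powr_def Ln_of_real cosh_real_nonzero)
  note I = cosh_mellin_absolutely_integrable[OF s]
  have outer: "integrable lborel (\<lambda>t. q t * (of_real (cosh t) powr (- s)))"
     "(LINT t|lborel. q t * (of_real (cosh t) powr (- s))) = cosh_mellin \<mu> s"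
  proof -
    have eq: "exp (- s * of_real (ln (cosh t))) * cosh (\<mu> * of_real t) = q t * (of_real (cosh t) powr (- s))" if "t \<in> {0..}" for t
      using that by (simp add: q_def powr_eq)
    have a: "(\<lambda>t. q t * (of_real (cosh t) powr (- s))) absolutely_integrable_on {0..}"
      using I by (subst (asm) set_integrable_cong[OF refl refl eq])
    have b: "((\<lambda>t. q t * (of_real (cosh t) powr (- s))) has_integral cosh_mellin \<mu> s) {0..}"
      unfolding cosh_mellin_def
      by (rule has_integral_eq[OF eq integrable_integral]) (use I set_lebesgue_integral_eq_integral(1) in blast)+
    have "(\<lambda>t. complex_of_real (cosh t) powr (- s)) \<in> borel_measurable borel"
      unfolding powr_eq by (intro borel_measurable_continuous_onI continuous_intros) (simp add: cosh_real_nonzero)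
    then have m: "(\<lambda>t. q t * (of_real (cosh t) powr (- s))) \<in> borel_measurable borel" by measurable
    show "integrable lborel (\<lambda>t. q t * (of_real (cosh t) powr (- s)))"
     "(LINT t|lborel. q t * (of_real (cosh t) powr (- s))) = cosh_mellin \<mu> s"
      by (rule lborel_integral_from_absolutely_integrable[OF m _ a b]; simp add: q_def)+
  qed
  have Fint: "integrable (lborel \<Otimes>\<^sub>M lborel) (case_prod F)"
  proof (rule lborel_pair.Fubini_integrable[OF Fm])
    have "(\<lambda>t. LINT x|lborel. norm (case_prod F (t, x))) = (\<lambda>t. Gamma (Re s) * norm (q t * (of_real (cosh t) powr (- s))))"
    proof
      fix t
      have "(LINT x|lborel. norm (case_prod F (t, x))) = norm (q t) * (LINT x|lborel. norm (p x * E t x))"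
        by (simp add: F_def norm_mult)
      also have "\<dots> = Gamma (Re s) * norm (q t * (of_real (cosh t) powr (- s)))"
        unfolding inner(3) by (simp add: norm_mult norm_powr_real_powr)
      finally show "(LINT x|lborel. norm (case_prod F (t, x))) = Gamma (Re s) * norm (q t * (of_real (cosh t) powr (- s)))" .
    qed
    then show "integrable lborel (\<lambda>t. LINT x|lborel. norm (case_prod F (t, x)))"
      using outer(1) by (simp only:) (intro integrable_mult_right integrable_norm)
    show "AE t in lborel. integrable lborel (\<lambda>x. case_prod F (t, x))"
      using inner(1) by (simp add: F_def)
  qed
  have K: "(LINT t|lborel. F t x) = of_real x powr (s - 1) * bessel_K \<mu> x" if x: "x > 0" for x
  proof -
    have eq: "of_real (exp (- x * cosh t)) * cosh (\<mu> * of_real t) = q t * E t x" if "t \<in> {0..}" for t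
      using that by (simp add: q_def E_def)
    have a: "(\<lambda>t. q t * E t x) absolutely_integrable_on {0..}"
      using bessel_K_absolutely_integrable[OF x, of \<mu>] by (subst (asm) set_integrable_cong[OF refl refl eq])
    have b: "((\<lambda>t. q t * E t x) has_integral bessel_K \<mu> x) {0..}"
      unfolding bessel_K_def
      by (rule has_integral_eq[OF eq integrable_integral]) 
         (use bessel_K_absolutely_integrable[OF x, of \<mu>] set_lebesgue_integral_eq_integral(1) in blast)+
    have m: "(\<lambda>t. q t * E t x) \<in> borel_measurable borel" by measurable
    have "(LINT t|lborel. q t * E t x) = bessel_K \<mu> x"
      by (rule lborel_integral_from_absolutely_integrable[OF m _ a b]) (simp add: q_def)
    moreover have "(\<lambda>t. F t x) = (\<lambda>t. p x * (q t * E t x))" by (simp add: F_def fun_eq_iff)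
    ultimately show ?thesis using x by (simp add: p_def)
  qed
  have K0: "(LINT t|lborel. F t x) = 0" if "x \<notin> {0<..}" for x
    using that by (simp add: F_def p_def)
  have L: "integrable lborel (\<lambda>x. LINT t|lborel. F t x)"
    using lborel_pair.integrable_snd[OF Fint] .
  have "(LINT x|lborel. LINT t|lborel. F t x) = (LINT t|lborel. LINT x|lborel. F t x)"
    by (rule lborel_pair.Fubini_integral[OF Fint])
  also have "\<dots> = (LINT t|lborel. Gamma s * (q t * (of_real (cosh t) powr (- s))))"
  proof (rule Bochner_Integration.integral_cong[OF refl])
    fix t
    have "(LINT x|lborel. F t x) = q t * (LINT x|lborel. p x * E t x)" by (simp add: F_def)
    also have "\<dots> = Gamma s * (q t * (of_real (cosh t) powr (- s)))" by (simp only: inner(2) mult_ac)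
    finally show "(LINT x|lborel. F t x) = Gamma s * (q t * (of_real (cosh t) powr (- s)))" .
  qed
  also have "\<dots> = Gamma s * cosh_mellin \<mu> s" using outer(2) by simp
  finally have J: "(LINT x|lborel. LINT t|lborel. F t x) = Gamma s * cosh_mellin \<mu> s" .
  show "(\<lambda>x. of_real x powr (s - 1) * bessel_K \<mu> x) absolutely_integrable_on {0<..}"
    by (rule absolutely_integrable_from_lborel(1)[OF L K0 K]) simp_all
  show "((\<lambda>x. of_real x powr (s - 1) * bessel_K \<mu> x) has_integral Gamma s * cosh_mellin \<mu> s) {0<..}"
    unfolding J[symmetric] by (rule absolutely_integrable_from_lborel(2)[OF L K0 K]) simp_all
qed

lemma bessel_K_mellin_nonzero:
  assumes s: "Re s > \<bar>Re \<mu>\<bar>"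
  shows "Gamma s * cosh_mellin \<mu> s \<noteq> 0"
proof -
  have "Re s > 0" using s by linarith
  then have "Gamma s \<noteq> 0" by (auto simp: Gamma_eq_zero_iff elim!: nonpos_Ints_cases)
  then show ?thesis using cosh_mellin_nonzero[OF s] by simp
qed

text \<open>
  Suppose \<open>Re \<mu> > 1/2\<close>.  Then the Mellin transform \<open>M\<close> of \<open>K\<close> stays bounded as its argument \<open>z\<close>
  approaches \<open>\<mu>\<close> from the right, and \<open>M (z + 2) = (z^2 - \<mu>^2) M z\<close> gives \<open>M (\<mu> + 2) = 0\<close>
  in the limit.  But \<open>M\<close> has no zeros to the right of \<open>|Re \<mu>|\<close>.
\<close>
lemma bessel_K_order_le_half_aux:
  assumes bd: "\<And>x. 0 < x \<Longrightarrow> x \<le> 1 \<Longrightarrow> norm (bessel_K \<mu> x) \<le> B * x powr (- 1 / 2)"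
  shows "Re \<mu> \<le> 1 / 2"
proof (rule ccontr)
  assume "\<not> Re \<mu> \<le> 1 / 2"
  then have \<sigma>: "Re \<mu> > 1 / 2" by simp
  define \<sigma> where "\<sigma> = Re \<mu>"
  define D where "D = exp ((\<bar>Re \<mu>\<bar> + 1)\<^sup>2 / 2)"
  \<comment> \<open>One integrable majorant serves both \<open>M z\<close> and \<open>M (z + 2)\<close> for \<open>z\<close> near \<open>\<mu>\<close>.\<close>
  define G where "G = (\<lambda>x. (if x \<le> 1 then \<bar>B\<bar> * x powr (\<sigma> - 3 / 2) else 0) + D * (x powr ((\<sigma> + 3) - 1) * exp (- (1 * x))))"
  have "((\<lambda>x. \<bar>B\<bar> * x powr (\<sigma> - 3 / 2)) has_integral \<bar>B\<bar> * (1 powr (\<sigma> - 3/2 + 1) / (\<sigma> - 3/2 + 1))) {0..1}"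
    using \<sigma> by (intro has_integral_mult_right has_integral_powr_from_0) (auto simp: \<sigma>_def)
  then have "((\<lambda>x. if x \<in> {0..1} then \<bar>B\<bar> * x powr (\<sigma> - 3 / 2) else 0) has_integral \<bar>B\<bar> * (1 powr (\<sigma> - 3/2 + 1) / (\<sigma> - 3/2 + 1))) {0..}"
    by (subst has_integral_restrict) auto
  then have "((\<lambda>x. if x \<le> 1 then \<bar>B\<bar> * x powr (\<sigma> - 3 / 2) else 0) has_integral \<bar>B\<bar> * (1 powr (\<sigma> - 3/2 + 1) / (\<sigma> - 3/2 + 1))) {0..}"
    by (rule has_integral_eq[rotated]) auto
  then have G1: "(\<lambda>x. if x \<le> 1 then \<bar>B\<bar> * x powr (\<sigma> - 3 / 2) else 0) integrable_on {0<..}"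
    using has_integral_Ioi_iff_Ici has_integral_integrable by blast
  have G: "G integrable_on {0<..}"
    unfolding G_def using \<sigma> Gamma_integral_scaled_real[of "\<sigma> + 3" 1]
    by (intro integrable_add G1 integrable_on_mult_right) (auto simp: \<sigma>_def intro: has_integral_integrable)
  have dom: "norm (of_real x powr (z - 1) * bessel_K \<mu> x) \<le> G x" if x: "x > 0" and z: "\<sigma> \<le> Re z" "Re z \<le> \<sigma> + 3" for x z
  proof -
    have n: "norm (of_real x powr (z - 1) * bessel_K \<mu> x) = x powr (Re z - 1) * norm (bessel_K \<mu> x)"
      using x by (simp add: norm_mult norm_powr_real_powr)
    show ?thesis
    proof (cases "x \<le> 1")
      case True
      have "x powr (Re z - 1) * norm (bessel_K \<mu> x) \<le> x powr (\<sigma> - 1) * (\<bar>B\<bar> * x powr (- 1 / 2))"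
      proof (intro mult_mono)
        show "x powr (Re z - 1) \<le> x powr (\<sigma> - 1)" using x True z by (intro powr_mono') auto
        show "norm (bessel_K \<mu> x) \<le> \<bar>B\<bar> * x powr (- 1 / 2)"
          by (rule order_trans[OF bd[OF x True]]) (auto intro: mult_right_mono)
      qed auto
      also have "\<dots> = \<bar>B\<bar> * x powr (\<sigma> - 3 / 2)" by (simp add: powr_add[symmetric])
      also have "\<dots> \<le> G x" using True by (simp add: G_def D_def)
      finally show ?thesis using n by simp
    next
      case False
      have "norm (bessel_K \<mu> x) \<le> exp (- x) * exp ((\<bar>Re \<mu>\<bar> + 1)\<^sup>2 / (2 * x))" by (rule bessel_K_upper[OF x])
      also have "\<dots> \<le> exp (- x) * D"
      proof -
        have "(\<bar>Re \<mu>\<bar> + 1)\<^sup>2 / (2 * x) \<le> (\<bar>Re \<mu>\<bar> + 1)\<^sup>2 / 2"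
          using False by (intro divide_left_mono) auto
        then have "exp ((\<bar>Re \<mu>\<bar> + 1)\<^sup>2 / (2 * x)) \<le> D" unfolding D_def exp_le_cancel_iff .
        then show ?thesis by (intro mult_left_mono) auto
      qed
      finally have k: "norm (bessel_K \<mu> x) \<le> exp (- x) * D" .
      have "x powr (Re z - 1) * norm (bessel_K \<mu> x) \<le> x powr (\<sigma> + 3 - 1) * (exp (- x) * D)"
        using False z k by (intro mult_mono powr_mono) auto
      also have "\<dots> = G x" using False by (simp add: G_def)
      finally show ?thesis using n by simp
    qed
  qed
  define M where "M = (\<lambda>z. Gamma z * cosh_mellin \<mu> z)"
  have MI: "M z = integral {0<..} (\<lambda>x. of_real x powr (z - 1) * bessel_K \<mu> x)" if "Re z > \<sigma>" for z
    using bessel_K_mellin(2)[of \<mu> z] that \<sigma> by (simp add: M_def \<sigma>_def integral_unique)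
  have Mint: "(\<lambda>x. of_real x powr (z - 1) * bessel_K \<mu> x) integrable_on {0<..}" if "Re z > \<sigma>" for z
    using bessel_K_mellin(2)[of \<mu> z] that \<sigma> by (auto simp: \<sigma>_def intro: has_integral_integrable)
  have Mbd: "norm (M z) \<le> integral {0<..} G" if "Re z > \<sigma>" "Re z \<le> \<sigma> + 3" for z
    unfolding MI[OF that(1)] by (intro integral_norm_bound_integral Mint G dom) (use that in auto)
  have rec: "M (z + 2) = (z\<^sup>2 - \<mu>\<^sup>2) * M z" if "Re z > \<sigma>" for z
  proof -
    have R: "Re z > \<bar>Re \<mu>\<bar>" using that \<sigma> by (simp add: \<sigma>_def)
    have ni: "z \<notin> \<int>\<^sub>\<le>\<^sub>0" "z + 1 \<notin> \<int>\<^sub>\<le>\<^sub>0" using R by (auto elim!: nonpos_Ints_cases simp: complex_eq_iff)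
    have "Gamma (z + 2) = (z + 1) * (z * Gamma z)"
      using Gamma_plus1[OF ni(2)] Gamma_plus1[OF ni(1)] by (simp add: add.assoc)
    then have "M (z + 2) = Gamma z * (z * (z + 1) * cosh_mellin \<mu> (z + 2))" by (simp add: M_def)
    also have "\<dots> = (z\<^sup>2 - \<mu>\<^sup>2) * M z" unfolding cosh_mellin_recurrence[OF R] by (simp add: M_def)
    finally show ?thesis .
  qed
  define h where "h = (\<lambda>n. inverse (real (Suc n)))"
  have h: "h n > 0" "h n \<le> 1" for n by (auto simp: h_def field_simps)
  have hlim: "h \<longlonglongrightarrow> 0" unfolding h_def by (rule LIMSEQ_inverse_real_of_nat)
  define z where "z = (\<lambda>n. \<mu> + of_real (h n))"
  have zR: "Re (z n) > \<sigma>" "Re (z n) \<le> \<sigma> + 1" for n using h[of n] by (auto simp: z_def \<sigma>_def)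
  have zlim: "z \<longlonglongrightarrow> \<mu>" unfolding z_def using tendsto_add[OF tendsto_const tendsto_of_real[OF hlim], of \<mu>] by simp
  have "(\<lambda>n. M (z n + 2)) \<longlonglongrightarrow> 0"
  proof (rule Lim_null_comparison)
    show "eventually (\<lambda>n. norm (M (z n + 2)) \<le> norm ((z n)\<^sup>2 - \<mu>\<^sup>2) * integral {0<..} G) sequentially"
      unfolding rec[OF zR(1)] norm_mult using zR
      by (intro always_eventually allI mult_left_mono Mbd) (auto intro: order_trans[OF zR(2)])
    have "(\<lambda>n. norm ((z n)\<^sup>2 - \<mu>\<^sup>2) * integral {0<..} G) \<longlonglongrightarrow> norm (\<mu>\<^sup>2 - \<mu>\<^sup>2) * integral {0<..} G"
      by (intro tendsto_intros zlim)
    then show "(\<lambda>n. norm ((z n)\<^sup>2 - \<mu>\<^sup>2) * integral {0<..} G) \<longlonglongrightarrow> 0" by simp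
  qed
  moreover have "(\<lambda>n. M (z n + 2)) \<longlonglongrightarrow> M (\<mu> + 2)"
  proof -
    have "(\<lambda>n. integral {0<..} (\<lambda>x. of_real x powr (z n + 2 - 1) * bessel_K \<mu> x)) \<longlonglongrightarrow>
            integral {0<..} (\<lambda>x. of_real x powr (\<mu> + 2 - 1) * bessel_K \<mu> x)"
    proof (rule dominated_convergence(2)[OF _ G])
      show "(\<lambda>x. of_real x powr (z n + 2 - 1) * bessel_K \<mu> x) integrable_on {0<..}" for n
        using zR(1)[of n] by (intro Mint) simp
      show "norm (of_real x powr (z n + 2 - 1) * bessel_K \<mu> x) \<le> G x" if "x \<in> {0<..}" for n x
        using zR[of n] that by (intro dom) auto
      show "(\<lambda>n. of_real x powr (z n + 2 - 1) * bessel_K \<mu> x) \<longlonglongrightarrow> of_real x powr (\<mu> + 2 - 1) * bessel_K \<mu> x"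
        if "x \<in> {0<..}" for x
        using that by (intro tendsto_intros zlim) auto
    qed
    moreover have "Re (z n + 2) > \<sigma>" "Re (\<mu> + 2) > \<sigma>" for n
      using zR(1)[of n] by (simp_all add: \<sigma>_def)
    ultimately show ?thesis by (simp only: MI)
  qed
  ultimately have "M (\<mu> + 2) = 0" using LIMSEQ_unique by blast
  moreover have "M (\<mu> + 2) \<noteq> 0" unfolding M_def by (rule bessel_K_mellin_nonzero) (use \<sigma> in simp)
  ultimately show False by simp
qed

lemma bessel_K_order_le_half:
  assumes bd: "\<And>x. 0 < x \<Longrightarrow> x \<le> 1 \<Longrightarrow> norm (bessel_K \<mu> x) \<le> B * x powr (- 1 / 2)"
  shows "\<bar>Re \<mu>\<bar> \<le> 1 / 2"
  using bessel_K_order_le_half_aux[of \<mu> B] bessel_K_order_le_half_aux[of "- \<mu>" B] bd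
  by (simp add: bessel_K_minus)

section \<open>Bounds for modular forms\<close>

lemma Im_moebius:
  fixes a b c d :: int
  assumes "a * d - b * c = 1" "Im z > 0"
  shows "Im ((of_int a * z + of_int b) / (of_int c * z + of_int d)) = Im z / (norm (of_int c * z + of_int d))\<^sup>2"
    and "of_int c * z + of_int d \<noteq> 0"
proof -
  show nz: "of_int c * z + of_int d \<noteq> 0"
  proof
    assume *: "of_int c * z + of_int d = 0"
    then have "Im (of_int c * z + of_int d) = 0" "Re (of_int c * z + of_int d) = 0" by (simp_all only: zero_complex.sel)
    then have "c = 0" "d = 0" using assms(2) by auto
    then show False using assms(1) by simp
  qed
  have D: "real_of_int a * real_of_int d - real_of_int b * real_of_int c = 1"
    using assms(1) by (metis of_int_1 of_int_diff of_int_mult)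
  have "Im ((of_int a * z + of_int b) / (of_int c * z + of_int d)) =
     (Im (of_int a * z + of_int b) * Re (of_int c * z + of_int d) - Re (of_int a * z + of_int b) * Im (of_int c * z + of_int d)) / (norm (of_int c * z + of_int d))\<^sup>2"
    by (simp only: Im_divide cmod_power2)
  also have "Im (of_int a * z + of_int b) * Re (of_int c * z + of_int d) - Re (of_int a * z + of_int b) * Im (of_int c * z + of_int d)
     = (real_of_int a * real_of_int d - real_of_int b * real_of_int c) * Im z"
    by (simp add: algebra_simps)
  finally show "Im ((of_int a * z + of_int b) / (of_int c * z + of_int d)) = Im z / (norm (of_int c * z + of_int d))\<^sup>2"
    by (simp add: D)
qed

text \<open>
  The bottom row \<open>(c, d)\<close> comes from Dirichlet's approximation theorem for \<open>Re z\<close> with denominators up to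
  \<open>N\<close>, about \<open>1 / sqrt y\<close> where \<open>y = Im z\<close>: then \<open>|c z + d|^2 \<le> y + 4 y\<close>.  The constant 1/5
  is all that the bounds need, so no fundamental domain enters.
\<close>
lemma ex_moebius_Im_ge:
  assumes "0 < Im z" "Im z \<le> 1"
  shows "\<exists>a b c d :: int. a * d - b * c = 1 \<and> Im ((of_int a * z + of_int b) / (of_int c * z + of_int d)) \<ge> 1 / 5"
proof -
  define x y where "x = Re z" and "y = Im z"
  have y: "0 < y" "y \<le> 1" using assms by (auto simp: y_def)
  define N where "N = nat \<lceil>1 / sqrt y\<rceil>"
  have s: "0 < sqrt y" "sqrt y \<le> 1" using y by auto
  have N1: "real N \<ge> 1 / sqrt y" unfolding N_def by (rule real_nat_ceiling_ge)
  have "real N \<le> 1 / sqrt y + 1"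
    using s by (simp add: N_def)
  also have "\<dots> \<le> 2 / sqrt y"
  proof -
    have "1 \<le> 1 / sqrt y" using s by (subst le_divide_eq_1_pos)
    moreover have "2 / sqrt y = 1 / sqrt y + 1 / sqrt y" by (simp only: add_divide_distrib[symmetric] one_add_one)
    ultimately show ?thesis by linarith
  qed
  finally have N2: "real N \<le> 2 / sqrt y" .
  have N0: "N > 0" using N1 s by (metis N_def divide_pos_pos zero_less_ceiling zero_less_nat_eq zero_less_one)
  obtain h k where hk: "coprime h k" "0 < k" "k \<le> int N" "\<bar>of_int k * x - of_int h\<bar> < 1 / N"
    using Dirichlet_approx_coprime[OF N0, of x] by blast
  obtain u v where uv: "u * h + v * k = 1"
    using bezout_int[of h k] hk(1) by auto
  have det: "(- u) * (- h) - (- v) * k = 1" using uv by simp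
  have n: "(norm (of_int k * z + of_int (- h)))\<^sup>2 \<le> 5 * y"
  proof -
    have "(norm (of_int k * z + of_int (- h)))\<^sup>2 = (of_int k * x - of_int h)\<^sup>2 + (of_int k * y)\<^sup>2"
      by (simp add: cmod_power2 x_def y_def)
    also have "(of_int k * x - of_int h)\<^sup>2 \<le> (1 / real N)\<^sup>2"
      using hk(4) by (metis abs_ge_zero less_imp_le power2_abs power_mono)
    also have "\<dots> \<le> (sqrt y)\<^sup>2"
      using N1 N0 s by (intro power_mono) (auto simp: field_simps)
    also have "(of_int k * y)\<^sup>2 \<le> (2 / sqrt y * y)\<^sup>2"
    proof (intro power_mono mult_right_mono)
      have "real_of_int k \<le> real N" using hk(3) by linarith
      then show "real_of_int k \<le> 2 / sqrt y" using N2 by linarith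
    qed (use hk y in auto)
    also have "2 / sqrt y * y = 2 * (y / sqrt y)" by simp
    also have "y / sqrt y = sqrt y" using y by (intro real_div_sqrt) simp
    finally show ?thesis using y by (simp add: power_mult_distrib)
  qed
  note I = Im_moebius[OF det assms(1)]
  have "norm (of_int k * z + of_int (- h)) > 0" using I(2) by simp
  then have "y / (norm (of_int k * z + of_int (- h)))\<^sup>2 \<ge> 1 / 5"
    using n by (simp add: field_simps)
  then show ?thesis using det I(1) unfolding y_def by (intro exI[of _ "-u"] exI[of _ "-v"] exI[of _ k] exI[of _ "-h"]) simp
qed

text \<open>
  \<open>|f z| (Im z) powr (k/2)\<close> is invariant under the modular group, and every orbit meets the
  region \<open>Im z \<ge> 1/5\<close>.
\<close>
lemma modular_weight_bound:
  assumes mod: "modular_weight k f"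
    and bd: "\<And>z. Im z \<ge> 1 / 5 \<Longrightarrow> norm (f z) * Im z powr (of_int k / 2) \<le> C"
    and z: "Im z > 0"
  shows "norm (f z) * Im z powr (of_int k / 2) \<le> C"
proof (cases "Im z \<le> 1")
  case True
  then obtain a b c d :: int where det: "a * d - b * c = 1"
    and ge: "Im ((of_int a * z + of_int b) / (of_int c * z + of_int d)) \<ge> 1 / 5"
    using ex_moebius_Im_ge[OF z] by blast
  define w where "w = of_int c * z + of_int d"
  have w: "norm w > 0" using Im_moebius(2)[OF det z] by (simp add: w_def)
  let ?g = "(of_int a * z + of_int b) / w"
  have Im: "Im ?g = Im z / (norm w)\<^sup>2" using Im_moebius(1)[OF det z] by (simp add: w_def)
  have "f ?g = w powi k * f z"
    using mod det z unfolding modular_weight_def upper_half_plane_def w_def by blast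
  then have "norm (f ?g) = norm w powr of_int k * norm (f z)"
    using w by (simp add: norm_mult norm_power_int powr_real_of_int')
  moreover have "Im ?g powr (of_int k / 2) = Im z powr (of_int k / 2) * norm w powr (- of_int k)"
  proof -
    have "((norm w)\<^sup>2) powr (of_int k / 2) = norm w powr of_int k"
    proof -
      have "(norm w)\<^sup>2 = norm w powr 2" using w by simp
      then show ?thesis by (simp only: powr_powr) simp
    qed
    then show ?thesis unfolding Im using z w by (simp add: powr_divide powr_minus_divide)
  qed
  moreover have "norm w powr of_int k * norm w powr (- of_int k) = 1"
    using w by (simp add: powr_add[symmetric])
  ultimately have "norm (f ?g) * Im ?g powr (of_int k / 2) = norm (f z) * Im z powr (of_int k / 2)"
    by (simp add: mult_ac)
  then show ?thesis using bd[of ?g] ge by (simp add: w_def)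
next
  case False
  then show ?thesis by (intro bd) simp
qed

text \<open>
  The maximum for \<open>a > 0\<close> is at \<open>y = a\<close>; the estimate is \<open>ln (y / a) \<le> y / a - 1\<close>.
\<close>
lemma powr_mult_exp_minus_bounded:
  fixes a :: real
  shows "\<exists>C>0. \<forall>y\<ge>1/5. y powr a * exp (- y) \<le> C"
proof (cases "a > 0")
  case True
  have "y powr a * exp (- y) \<le> exp (a * ln a)" if "y \<ge> 1/5" for y
  proof -
    have "ln (y / a) \<le> y / a - 1" using True that by (intro ln_le_minus_one) auto
    then have "a * (ln y - ln a) \<le> a * (y / a)" using True that by (intro mult_left_mono) (auto simp: ln_div)
    then show ?thesis using True that by (simp add: powr_def exp_add[symmetric] algebra_simps)
  qed
  then show ?thesis by (intro exI[of _ "exp (a * ln a)"]) auto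
next
  case False
  have "y powr a * exp (- y) \<le> (1/5) powr a * 1" if "y \<ge> 1/5" for y
    using False that by (intro mult_mono powr_mono2') auto
  then show ?thesis by (intro exI[of _ "(1/5) powr a"]) auto
qed

lemma modular_form_bound:
  assumes "modular_weight k f" and "\<And>z. Im z \<ge> 1 / 5 \<Longrightarrow> norm (f z) \<le> C * exp (- Im z)" and "C \<ge> 0"
  shows "\<exists>C'>0. \<forall>z. Im z > 0 \<longrightarrow> norm (f z) \<le> C' * Im z powr (- of_int k / 2)"
proof -
  obtain D where D: "D > 0" "\<And>y::real. y \<ge> 1/5 \<Longrightarrow> y powr (of_int k / 2) * exp (- y) \<le> D"
    using powr_mult_exp_minus_bounded[of "of_int k / 2"] by blast
  have bd: "norm (f z) * Im z powr (of_int k / 2) \<le> C * D" if "Im z \<ge> 1/5" for z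
  proof -
    have "norm (f z) * Im z powr (of_int k / 2) \<le> (C * exp (- Im z)) * Im z powr (of_int k / 2)"
      by (intro mult_right_mono assms that) auto
    also have "\<dots> = C * (Im z powr (of_int k / 2) * exp (- Im z))" by (simp add: mult_ac)
    also have "\<dots> \<le> C * D" by (intro mult_left_mono D assms that)
    finally show ?thesis .
  qed
  have "norm (f z) \<le> (C * D + 1) * Im z powr (- of_int k / 2)" if "Im z > 0" for z
  proof -
    have "norm (f z) * Im z powr (of_int k / 2) \<le> C * D + 1"
      using modular_weight_bound[OF assms(1) bd that] by simp
    then show ?thesis using that by (simp add: powr_minus field_simps)
  qed
  moreover have "C * D + 1 > 0" using D assms by (simp add: add_nonneg_pos)
  ultimately show ?thesis by blast
qed

lemma has_sum_norm_le:
  assumes "(u has_sum g) S" "v summable_on S" "\<And>n. n \<in> S \<Longrightarrow> norm (u n) \<le> E * v n"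
  shows "norm (g :: complex) \<le> E * infsum v S"
proof -
  show ?thesis
    by (rule norm_infsum_le[OF assms(1) has_sum_cmult_right[OF has_sum_infsum[OF assms(2)]] assms(3)])
qed

text \<open>
  Near \<open>y = 0\<close> the weight \<open>y powr (k/2 + \<delta> - 1)\<close> meets \<open>|f| \<le> D y powr (-k/2)\<close>, which leaves
  the integrable \<open>y powr (\<delta> - 1)\<close>; for large \<open>y\<close> the exponential decay suffices.
\<close>
lemma hankel_bounded_modular_form:
  assumes mod: "modular_weight k f" and k: "k \<ge> 0"
    and decay: "\<And>z. Im z \<ge> 1 / 5 \<Longrightarrow> norm (f z) \<le> C * exp (- Im z)" and C: "C \<ge> 0"
    and hs: "\<And>x y. y > 0 \<Longrightarrow> ((\<lambda>n. \<phi> y n * fchar n x) has_sum f (Complex x y)) S"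
    and S: "{1..} \<subseteq> S" and \<delta>: "\<delta> > 0"
    and mel: "\<And>n. n \<ge> 1 \<Longrightarrow> ((\<lambda>y. of_real (y powr (of_int k / 2 + \<delta> - 1)) * \<phi> y (int n)) has_integral \<gamma> * a n) {0<..}"
    and \<gamma>: "\<gamma> \<noteq> 0"
  shows "hankel_bounded a"
proof -
  obtain D where D: "D > 0" "\<And>z. Im z > 0 \<Longrightarrow> norm (f z) \<le> D * Im z powr (- of_int k / 2)"
    using modular_form_bound[OF mod decay C] by blast
  define B where "B = (\<lambda>y. (if y \<le> 1 then D * y powr (- of_int k / 2) else 0) + C * exp (- y))"
  define w where "w = of_int k / 2 + \<delta>"
  have w: "w > 0" using k \<delta> by (simp add: w_def)
  show ?thesis
  proof (rule hankel_bounded_mellin[OF hs S _ mel \<gamma>])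
    fix x y :: real assume y: "y > 0"
    show "norm (f (Complex x y)) \<le> B y"
      using D(2)[of "Complex x y"] decay[of "Complex x y"] y C
      by (auto simp: B_def add_increasing2)
  next
    have "((\<lambda>y. D * y powr (\<delta> - 1)) has_integral D * (1 powr (\<delta> - 1 + 1) / (\<delta> - 1 + 1))) {0..1}"
      using \<delta> by (intro has_integral_mult_right has_integral_powr_from_0) auto
    then have "((\<lambda>y. if y \<in> {0..1} then D * y powr (\<delta> - 1) else 0) has_integral D * (1 powr (\<delta> - 1 + 1) / (\<delta> - 1 + 1))) {0..}"
      by (subst has_integral_restrict) auto
    then have "((\<lambda>y. if y \<in> {0..1} then D * y powr (\<delta> - 1) else 0) has_integral D * (1 powr (\<delta> - 1 + 1) / (\<delta> - 1 + 1))) {0<..}"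
      by (simp only: has_integral_Ioi_iff_Ici)
    then have i1: "(\<lambda>y. if y \<in> {0..1} then D * y powr (\<delta> - 1) else 0) integrable_on {0<..}" by blast
    have i2: "(\<lambda>y. C * (y powr (w - 1) * exp (- (1 * y)))) integrable_on {0<..}"
      using Gamma_integral_scaled_real[OF w, of 1] by (intro integrable_on_mult_right) auto
    have "(\<lambda>y. (if y \<in> {0..1} then D * y powr (\<delta> - 1) else 0) + C * (y powr (w - 1) * exp (- (1 * y)))) integrable_on {0<..}"
      by (intro integrable_add i1 i2)
    then show "(\<lambda>y. y powr (of_int k / 2 + \<delta> - 1) * B y) integrable_on {0<..}"
    proof (rule integrable_eq)
      fix y :: real assume "y \<in> {0<..}"
      then show "(if y \<in> {0..1} then D * y powr (\<delta> - 1) else 0) + C * (y powr (w - 1) * exp (- (1 * y))) = y powr (of_int k / 2 + \<delta> - 1) * B y"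
        by (simp add: B_def w_def ring_distribs powr_add[symmetric])
    qed
  qed auto
qed


section \<open>Holomorphic and Maass cusp forms\<close>

text \<open>
  The decay follows by comparing the expansion at height \<open>Im z\<close> with the one at height 1/10, which
  converges absolutely.  The Mellin transform of \<open>exp (- 2 \<pi> n y)\<close> is a Gamma integral.
\<close>
lemma holomorphic_hankel_bounded:
  assumes cf: "hecke_holomorphic_cusp_form k f" and co: "holomorphic_coeffs k f A" and \<delta>: "\<delta> > 0"
  shows "hankel_bounded (\<lambda>n. A (int n) * of_real (real n powr (- (1 / 2 + \<delta>))))"
proof -
  define \<phi> where "\<phi> = (\<lambda>y n. A n * of_real (of_int n powr ((of_int k - 1) / 2)) * of_real (exp (- (2 * pi * of_int n * y))))"
  have A1: "A 1 = 1" using co by (simp add: holomorphic_coeffs_def)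
  have mod: "modular_weight k f" using cf by (simp add: hecke_holomorphic_cusp_form_def holomorphic_cusp_form_def)
  have hs: "((\<lambda>n. \<phi> y n * fchar n x) has_sum f (Complex x y)) {1..}" if "y > 0" for x y
  proof -
    have "e (of_int n * Complex x y) = of_real (exp (- (2 * pi * of_int n * y))) * fchar n x" for n
      by (simp add: e_def exp_of_real[symmetric] exp_add[symmetric] Complex_eq algebra_simps)
    then have "\<phi> y n * fchar n x = A n * of_real (of_int n powr ((of_int k - 1) / 2)) * e (of_int n * Complex x y)" for n
      by (simp add: \<phi>_def)
    then show ?thesis using co that by (simp add: holomorphic_coeffs_def upper_half_plane_def)
  qed
  define v where "v = (\<lambda>n. norm (\<phi> (1 / 10) n))"
  have "(\<lambda>n. norm (\<phi> (1 / 10) n * fchar n 0)) summable_on {1..}"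
    using has_sum_imp_summable[OF hs[of "1/10" 0]] by (simp add: summable_on_iff_abs_summable_on_complex)
  then have v: "v summable_on {1..}" by (simp only: v_def norm_mult norm_fchar mult_1_right)
  have v0: "infsum v {1..} \<ge> 0" by (rule infsum_nonneg) (simp add: v_def)
  have decay: "norm (f z) \<le> (exp 1 * infsum v {1..}) * exp (- Im z)" if z: "Im z \<ge> 1 / 5" for z
  proof -
    have "norm (f (Complex (Re z) (Im z))) \<le> (exp 1 * exp (- Im z)) * infsum v {1..}"
    proof (rule has_sum_norm_le[OF hs v])
      fix n :: int assume n: "n \<in> {1..}"
      have "- (2 * pi * n * Im z) = - (2 * pi * n * (1 / 10)) - (2 * pi * n) * (Im z - 1 / 10)"
        by (simp add: algebra_simps)
      moreover have "2 * pi * real_of_int n \<ge> 1"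
        using n pi_gt3 mult_mono[of 1 "2 * pi" 1 "real_of_int n"] by simp
      then have "(2 * pi * n) * (Im z - 1 / 10) \<ge> 1 * (Im z - 1 / 10)"
        using z by (intro mult_right_mono) auto
      ultimately have "exp (- (2 * pi * n * Im z)) \<le> exp (- (2 * pi * n * (1 / 10)) + (1 - Im z))"
        by simp
      also have "\<dots> = exp (- (2 * pi * n * (1 / 10))) * (exp 1 * exp (- Im z))"
        unfolding exp_add[symmetric] by simp
      finally have "exp (- (2 * pi * n * Im z)) \<le> exp (- (2 * pi * n * (1 / 10))) * (exp 1 * exp (- Im z))" .
      then have "norm (A n * of_real (of_int n powr ((of_int k - 1) / 2))) * exp (- (2 * pi * n * Im z))
         \<le> norm (A n * of_real (of_int n powr ((of_int k - 1) / 2))) * (exp (- (2 * pi * n * (1 / 10))) * (exp 1 * exp (- Im z)))"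
        by (rule mult_left_mono) auto
      then show "norm (\<phi> (Im z) n * fchar n (Re z)) \<le> (exp 1 * exp (- Im z)) * v n"
        by (simp add: \<phi>_def v_def norm_mult norm_fchar mult_ac)
    qed (use z in simp)
    then show ?thesis by (simp add: mult_ac)
  qed
  have C: "exp 1 * infsum v {1..} \<ge> 0" using v0 by simp
  \<comment> \<open>For negative weight the bound for \<open>f\<close> tends to 0 with \<open>y\<close>, while the first coefficient tends to 1.\<close>
  have k: "k \<ge> 0"
  proof (rule ccontr)
    assume k: "\<not> k \<ge> 0"
    obtain D where D: "D > 0" "\<And>z. Im z > 0 \<Longrightarrow> norm (f z) \<le> D * Im z powr (- of_int k / 2)"
      using modular_form_bound[OF mod decay C] by blast
    have le: "exp (- (2 * pi * y)) \<le> D * y powr (- of_int k / 2)" if "y > 0" for y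
      using fourier_coefficient_bound[OF hs[OF that], of 1 "D * y powr (- of_int k / 2)"] D(2)[of "Complex _ y"] that
      by (simp add: \<phi>_def A1)
    have "((\<lambda>y. D * y powr (- of_int k / 2)) \<longlongrightarrow> D * 0 powr (- of_int k / 2)) (at_right 0)"
      using k by (intro tendsto_intros tendsto_powr' ) (auto simp: eventually_at_right_less intro!: eventually_at_rightI[of 0 1])
    moreover have "((\<lambda>y. exp (- (2 * pi * y))) \<longlongrightarrow> exp (- (2 * pi * 0))) (at_right 0)"
      by (intro tendsto_intros)
    moreover have "eventually (\<lambda>y. exp (- (2 * pi * y)) \<le> D * y powr (- of_int k / 2)) (at_right 0)"
      using eventually_at_right_less by eventually_elim (rule le)
    ultimately have "exp (- (2 * pi * 0)) \<le> D * 0 powr (- of_int k / 2)"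
      by (rule tendsto_le[OF trivial_limit_at_right_real])
    then show False by simp
  qed
  define w where "w = of_int k / 2 + \<delta>"
  have w: "w > 0" using k \<delta> by (simp add: w_def)
  show ?thesis
  proof (rule hankel_bounded_modular_form[OF mod k decay C hs _ \<delta>])
    show "complex_of_real (Gamma w * (2 * pi) powr (- w)) \<noteq> 0"
      using Gamma_real_pos[OF w] by simp
    fix n :: nat assume n: "n \<ge> 1"
    have "((\<lambda>y. complex_of_real (y powr (w - 1) * exp (- (2 * pi * real n * y)))) has_integral complex_of_real (Gamma w * (2 * pi * real n) powr (- w))) {0<..}"
      using n by (intro has_integral_of_real Gamma_integral_scaled_real w) auto
    then have I: "((\<lambda>y. A (int n) * of_real (real n powr ((of_int k - 1) / 2)) * complex_of_real (y powr (w - 1) * exp (- (2 * pi * real n * y)))) has_integral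
        A (int n) * of_real (real n powr ((of_int k - 1) / 2)) * complex_of_real (Gamma w * (2 * pi * real n) powr (- w))) {0<..}"
      by (rule has_integral_mult_right)
    have *: "real n powr ((of_int k - 1) / 2) * (Gamma w * (2 * pi * real n) powr (- w)) =
        Gamma w * (2 * pi) powr (- w) * real n powr (- (1 / 2 + \<delta>))"
    proof -
      have "real n powr ((of_int k - 1) / 2) * real n powr (- w) = real n powr (- (1 / 2 + \<delta>))"
      proof -
        have "(of_int k - 1) / 2 + (- w) = - (1 / 2 + \<delta>)" by (simp add: w_def field_simps)
        then show ?thesis by (simp only: powr_add[symmetric])
      qed
      then show ?thesis using n by (simp add: powr_mult)
    qed
    have E: "A (int n) * of_real (real n powr ((of_int k - 1) / 2)) * complex_of_real (Gamma w * (2 * pi * real n) powr (- w))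
       = complex_of_real (Gamma w * (2 * pi) powr (- w)) * (A (int n) * of_real (real n powr (- (1 / 2 + \<delta>))))"
    proof -
      have "A (int n) * of_real (real n powr ((of_int k - 1) / 2)) * complex_of_real (Gamma w * (2 * pi * real n) powr (- w))
        = A (int n) * of_real (real n powr ((of_int k - 1) / 2) * (Gamma w * (2 * pi * real n) powr (- w)))"
        by (simp only: of_real_mult mult.assoc)
      also have "\<dots> = complex_of_real (Gamma w * (2 * pi) powr (- w)) * (A (int n) * of_real (real n powr (- (1 / 2 + \<delta>))))"
        unfolding * by (simp only: of_real_mult mult_ac)
      finally show ?thesis .
    qed
    from I[unfolded E] show "((\<lambda>y. of_real (y powr (of_int k / 2 + \<delta> - 1)) * \<phi> y (int n)) has_integral
      complex_of_real (Gamma w * (2 * pi) powr (- w)) * (A (int n) * of_real (real n powr (- (1 / 2 + \<delta>))))) {0<..}"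
      by (simp add: \<phi>_def w_def mult_ac)
  qed auto
qed

text \<open>
  The weight is 0, so \<open>f\<close> itself is bounded.  The scaling \<open>y \<mapsto> y / (2 \<pi> n)\<close> in the Mellin integral of
  \<open>sqrt y K(2 \<pi> n y)\<close> produces the power \<open>n powr (- (1/2 + \<delta>))\<close>.
\<close>
lemma maass_hankel_bounded:
  assumes cf: "hecke_maass_cusp_form \<nu> f" and co: "maass_coeffs \<nu> f A" and \<delta>: "\<delta> > 0"
  shows "hankel_bounded (\<lambda>n. A (int n) * of_real (real n powr (- (1 / 2 + \<delta>))))"
proof -
  define \<mu> where "\<mu> = \<i> * \<nu>"
  define S where "S = {n::int. n \<noteq> 0}"
  define \<phi> where "\<phi> = (\<lambda>y n. 2 * of_real (sqrt y) * A n * bessel_K \<mu> (2 * pi * \<bar>of_int n\<bar> * y))"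
  have A1: "A 1 = 1" using co by (simp add: maass_coeffs_def)
  have mod: "modular_weight 0 f" using cf by (simp add: hecke_maass_cusp_form_def maass_cusp_form_def)
  have hs: "((\<lambda>n. \<phi> y n * fchar n x) has_sum f (Complex x y)) S" if "y > 0" for x y
    using co that by (simp add: maass_coeffs_def \<phi>_def \<mu>_def S_def)
  have S1: "1 \<in> S" "{1..} \<subseteq> S" by (auto simp: S_def)
  obtain c x0 where c: "c > 0" "x0 \<ge> 0" and Klow: "\<And>x. x \<ge> x0 \<Longrightarrow> norm (bessel_K \<mu> x) \<ge> c * exp (- 2 * x)"
    using bessel_K_lower[of \<mu>] by blast
  \<comment> \<open>Absolute convergence at height 1/100 and \<open>|K x| \<ge> c exp (- 2 x)\<close> show that \<open>v\<close> is summable: \<open>pi / 25 = 2 * (2 * pi / 100)\<close>.\<close>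
  define v where "v = (\<lambda>n. norm (A n) * exp (- (pi * \<bar>of_int n\<bar> / 25)))"
  have v: "v summable_on S"
  proof -
    have "(\<lambda>n. norm (\<phi> (1 / 100) n * fchar n 0)) summable_on S"
      using has_sum_imp_summable[OF hs[of "1/100" 0]] by (simp add: summable_on_iff_abs_summable_on_complex)
    then have s1: "(\<lambda>n. norm (\<phi> (1 / 100) n)) summable_on S" by (simp only: norm_mult norm_fchar mult_1_right)
    \<comment> \<open>Outside the finite set \<open>T\<close> the argument \<open>2 * pi * |n| / 100\<close> is in the range of the lower bound for \<open>K\<close>.\<close>
    define T where "T = {n::int. \<bar>of_int n\<bar> \<le> 50 * x0}"
    have finT: "finite T"
      by (rule finite_subset[of _ "{- \<lceil>50 * x0\<rceil>..\<lceil>50 * x0\<rceil>}"]) (auto simp: T_def, linarith+)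
    have "v summable_on (S - T)"
    proof (rule summable_on_comparison_test)
      show "(\<lambda>n. norm (\<phi> (1 / 100) n) * (5 / c)) summable_on (S - T)"
        by (intro summable_on_cmult_left summable_on_subset_banach[OF s1]) auto
      fix n assume n: "n \<in> S - T"
      have "real_of_int \<bar>n\<bar> > 50 * x0" using n by (auto simp: T_def)
      moreover have "2 * pi * \<bar>real_of_int n\<bar> * (1 / 100) \<ge> real_of_int \<bar>n\<bar> / 50"
        using pi_gt3 mult_right_mono[of 1 pi "\<bar>real_of_int n\<bar>"] by simp
      ultimately have "2 * pi * \<bar>real_of_int n\<bar> * (1 / 100) \<ge> x0" by simp
      from Klow[OF this] have "c * exp (- (pi * \<bar>of_int n\<bar> / 25)) \<le> norm (bessel_K \<mu> (2 * pi * \<bar>of_int n\<bar> * (1 / 100)))"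
        by simp
      then have "norm (A n) * (c * exp (- (pi * \<bar>of_int n\<bar> / 25))) \<le> norm (A n) * norm (bessel_K \<mu> (2 * pi * \<bar>of_int n\<bar> * (1 / 100)))"
        by (rule mult_left_mono) auto
      also have "\<dots> = norm (\<phi> (1 / 100) n) * 5"
        by (simp add: \<phi>_def norm_mult real_sqrt_divide)
      finally show "v n \<le> norm (\<phi> (1 / 100) n) * (5 / c)" using c by (simp add: v_def field_simps)
    qed (simp add: v_def)
    then have "v summable_on ((S - T) \<union> T)"
      by (rule summable_on_Un_disjoint) (use finT in \<open>auto intro: summable_on_finite\<close>)
    then show ?thesis by (rule summable_on_subset_banach) auto
  qed
  have v0: "infsum v S \<ge> 0" by (rule infsum_nonneg) (simp add: v_def)
  define D where "D = exp ((\<bar>Re \<mu>\<bar> + 1)\<^sup>2 / 2)"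
  have decay: "norm (f z) \<le> (2 * D * exp 1 * infsum v S) * exp (- Im z)" if z: "Im z \<ge> 1 / 5" for z
  proof -
    define y where "y = Im z"
    have y: "y \<ge> 1/5" using z by (simp add: y_def)
    have "norm (f (Complex (Re z) y)) \<le> (2 * D * exp 1 * exp (- y)) * infsum v S"
    proof (rule has_sum_norm_le[OF hs v])
      fix n assume n: "n \<in> S"
      define x where "x = 2 * pi * \<bar>real_of_int n\<bar> * y"
      have n1: "\<bar>real_of_int n\<bar> \<ge> 1" using n by (auto simp: S_def)
      have pn: "pi * \<bar>real_of_int n\<bar> \<ge> 3" using pi_gt3 n1 mult_mono[of 3 pi 1 "\<bar>real_of_int n\<bar>"] by simp
      have x: "x \<ge> pi * \<bar>real_of_int n\<bar> / 25 + (2 * y - 1)"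
      proof -
        have "x - pi * \<bar>real_of_int n\<bar> / 25 = (pi * \<bar>real_of_int n\<bar>) * (2 * y - 1 / 25)"
          by (simp add: x_def algebra_simps)
        also have "\<dots> \<ge> 3 * (2 * y - 1 / 25)" using pn y by (intro mult_right_mono) auto
        finally show ?thesis using y by simp
      qed
      have x1: "x \<ge> 1"
      proof -
        have "x = (pi * \<bar>real_of_int n\<bar>) * (2 * y)" by (simp add: x_def)
        also have "\<dots> \<ge> 3 * (2 * y)" using pn y by (intro mult_right_mono) auto
        finally show ?thesis using y by simp
      qed
      have "norm (bessel_K \<mu> x) \<le> exp (- x) * exp ((\<bar>Re \<mu>\<bar> + 1)\<^sup>2 / (2 * x))"
        by (rule bessel_K_upper) (use x1 in simp)
      also have "\<dots> \<le> exp (- (pi * \<bar>real_of_int n\<bar> / 25) - (2 * y - 1)) * D"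
      proof (intro mult_mono)
        show "exp (- x) \<le> exp (- (pi * \<bar>real_of_int n\<bar> / 25) - (2 * y - 1))" using x by simp
        have "(\<bar>Re \<mu>\<bar> + 1)\<^sup>2 / (2 * x) \<le> (\<bar>Re \<mu>\<bar> + 1)\<^sup>2 / 2"
          using x1 by (intro divide_left_mono) auto
        then show "exp ((\<bar>Re \<mu>\<bar> + 1)\<^sup>2 / (2 * x)) \<le> D" unfolding D_def exp_le_cancel_iff .
      qed auto
      finally have K: "norm (bessel_K \<mu> x) \<le> exp (- (pi * \<bar>real_of_int n\<bar> / 25) - (2 * y - 1)) * D" .
      have sq: "sqrt y \<le> exp y"
      proof (rule real_le_lsqrt)
        have "y \<le> exp (2 * y)"
          using exp_ge_add_one_self[of "2 * y"] y by linarith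
        then show "y \<le> (exp y)\<^sup>2" by (simp only: exp_double)
      qed auto
      have "norm (\<phi> y n * fchar n (Re z)) = 2 * sqrt y * norm (A n) * norm (bessel_K \<mu> x)"
        using y by (simp add: \<phi>_def x_def norm_mult norm_fchar)
      also have "\<dots> \<le> 2 * exp y * norm (A n) * (exp (- (pi * \<bar>real_of_int n\<bar> / 25) - (2 * y - 1)) * D)"
        using sq K y by (intro mult_mono mult_nonneg_nonneg) auto
      also have "\<dots> = 2 * D * norm (A n) * (exp y * exp (- (pi * \<bar>real_of_int n\<bar> / 25) - (2 * y - 1)))"
        by (simp only: mult_ac)
      also have "exp y * exp (- (pi * \<bar>real_of_int n\<bar> / 25) - (2 * y - 1)) = exp 1 * exp (- y) * exp (- (pi * \<bar>real_of_int n\<bar> / 25))"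
        unfolding exp_add[symmetric] by simp
      finally show "norm (\<phi> y n * fchar n (Re z)) \<le> (2 * D * exp 1 * exp (- y)) * v n"
        by (simp only: v_def mult_ac)
    qed (use y in simp)
    then show ?thesis by (simp add: y_def mult_ac)
  qed
  have C: "2 * D * exp 1 * infsum v S \<ge> 0" using v0 by (simp add: D_def)
  obtain B where B: "B > 0" "\<And>z. Im z > 0 \<Longrightarrow> norm (f z) \<le> B * Im z powr (- of_int 0 / 2)"
    using modular_form_bound[OF mod decay C] by blast
  \<comment> \<open>The first Fourier coefficient of a bounded function is bounded, and \<open>A 1 = 1\<close>.\<close>
  have "\<bar>Re \<mu>\<bar> \<le> 1 / 2"
  proof (rule bessel_K_order_le_half)
    fix x :: real assume x: "0 < x" "x \<le> 1"
    define y where "y = x / (2 * pi)"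
    have y: "y > 0" using x by (simp add: y_def)
    have "norm (\<phi> y 1) \<le> B"
      by (rule fourier_coefficient_bound[OF hs[OF y] S1(1)]) (use B(2)[of "Complex _ y"] y in simp)
    then have "2 * sqrt y * norm (bessel_K \<mu> x) \<le> B"
      using y A1 by (simp add: \<phi>_def norm_mult y_def)
    also have "2 * sqrt y = 2 / sqrt (2 * pi) * x powr (1 / 2)"
      using x by (simp add: y_def real_sqrt_divide powr_half_sqrt)
    finally show "norm (bessel_K \<mu> x) \<le> (B * sqrt (2 * pi) / 2) * x powr (- 1 / 2)"
      using x by (simp add: powr_minus_divide field_simps)
  qed
  then have s: "Re (of_real (1 / 2 + \<delta>)) > \<bar>Re \<mu>\<bar>" using \<delta> by simp
  define s where "s = 1 / 2 + \<delta>"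
  define M where "M = Gamma (of_real s) * cosh_mellin \<mu> (of_real s)"
  have M0: "M \<noteq> 0" unfolding M_def s_def by (rule bessel_K_mellin_nonzero[OF s])
  show ?thesis
  proof (rule hankel_bounded_modular_form[OF mod _ decay C hs S1(2) \<delta>])
    show "2 * of_real ((2 * pi) powr (- s)) * M \<noteq> 0" using M0 by simp
    fix n :: nat assume n: "n \<ge> 1"
    define c where "c = 2 * pi * real n"
    have c: "c > 0" using n by (simp add: c_def)
    have "((\<lambda>y. of_real (c * y) powr (of_real s - 1) * bessel_K \<mu> (c * y)) has_integral M /\<^sub>R c) {0<..}"
      using has_integral_scale_pos(2)[OF bessel_K_mellin[OF s] c] by (simp add: M_def s_def)
    then have "((\<lambda>y. 2 * A (int n) * of_real (c powr (1 - s)) * (of_real (c * y) powr (of_real s - 1) * bessel_K \<mu> (c * y))) has_integral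
       2 * A (int n) * of_real (c powr (1 - s)) * (M /\<^sub>R c)) {0<..}"
      by (rule has_integral_mult_right)
    then show "((\<lambda>y. of_real (y powr (of_int 0 / 2 + \<delta> - 1)) * \<phi> y (int n)) has_integral
       2 * of_real ((2 * pi) powr (- s)) * M * (A (int n) * of_real (real n powr (- (1 / 2 + \<delta>))))) {0<..}"
    proof (rule has_integral_eq_rhs[OF has_integral_eq, rotated])
      fix y :: real assume "y \<in> {0<..}"
      then have y: "y > 0" by simp
      have 1: "complex_of_real (c * y) powr (of_real s - 1) = of_real ((c * y) powr (s - 1))"
        using c y by (simp add: powr_of_real[symmetric])
      have 2: "c powr (1 - s) * (c * y) powr (s - 1) = y powr (\<delta> - 1) * sqrt y"
      proof -
        have "c powr (1 - s) * c powr (s - 1) = 1" using c by (simp add: powr_add[symmetric])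
        moreover have "y powr (s - 1) = y powr (\<delta> - 1) * sqrt y"
          using y by (simp add: powr_half_sqrt[symmetric] powr_add[symmetric] s_def)
        ultimately show ?thesis using c y by (simp add: powr_mult)
      qed
      have "2 * A (int n) * of_real (c powr (1 - s)) * (of_real (c * y) powr (of_real s - 1) * bessel_K \<mu> (c * y))
        = 2 * A (int n) * of_real (c powr (1 - s) * (c * y) powr (s - 1)) * bessel_K \<mu> (c * y)"
        unfolding 1 by (simp only: of_real_mult mult_ac)
      also have "\<dots> = of_real (y powr (of_int 0 / 2 + \<delta> - 1)) * \<phi> y (int n)"
        unfolding 2 by (simp add: \<phi>_def c_def)
      finally show "2 * A (int n) * of_real (c powr (1 - s)) * (of_real (c * y) powr (of_real s - 1) * bessel_K \<mu> (c * y)) = of_real (y powr (of_int 0 / 2 + \<delta> - 1)) * \<phi> y (int n)" .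
    next
      have 3: "c powr (1 - s) / c = (2 * pi) powr (- s) * real n powr (- (1 / 2 + \<delta>))"
      proof -
        have "c powr (1 - s) = c * c powr (- s)" using powr_add[of c 1 "- s"] c by simp
        then have "c powr (1 - s) / c = (2 * pi * real n) powr (- s)" using c by (simp add: c_def)
        also have "\<dots> = (2 * pi) powr (- s) * real n powr (- s)" by (simp add: powr_mult)
        finally show ?thesis by (simp only: s_def)
      qed
      have "2 * A (int n) * of_real (c powr (1 - s)) * (M /\<^sub>R c) = 2 * A (int n) * M * of_real (c powr (1 - s) / c)"
        by (simp add: scaleR_conv_of_real field_simps)
      also have "\<dots> = 2 * of_real ((2 * pi) powr (- s)) * M * (A (int n) * of_real (real n powr (- (1 / 2 + \<delta>))))"
        unfolding 3 by (simp only: of_real_mult mult_ac)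
      finally show "2 * of_real ((2 * pi) powr (- s)) * M * (A (int n) * of_real (real n powr (- (1 / 2 + \<delta>)))) =
          2 * A (int n) * of_real (c powr (1 - s)) * (M /\<^sub>R c)" by (rule sym)
    qed
  qed auto
qed

section \<open>The shifted convolution sum\<close>

text \<open>
  The untwisting costs \<open>X powr (9/16)\<close>, and each mean square saves the exponent 15/32.  After cancellation
  the claim is \<open>X powr (3/32) * Y powr (9/32) \<le> X powr (3/8)\<close>, where \<open>Y \<le> X\<close> and 3/32 + 9/32 = 3/8.
\<close>
lemma saving_exponents:
  fixes X Y p q :: real
  assumes "1 \<le> Y" "Y \<le> X"
  shows "X powr (9/16) * (X powr (p - 15/32) * Y powr (q - 15/32)) \<le> X powr (3/8) / Y powr (3/4) * (X powr p * Y powr q)"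
proof -
  have "X powr (9/16) * (X powr (p - 15/32) * Y powr (q - 15/32)) =
      X powr (9/16 + (p - 15/32)) * Y powr (9/32 + (q - 3/4))"
    by (simp add: powr_add[symmetric] flip: mult.assoc)
  also have "\<dots> = Y powr (9/32) * (X powr (3/32 + p) * Y powr (q - 3/4))"
    by (simp only: powr_add[of Y]) (simp add: mult_ac)
  also have "\<dots> \<le> X powr (9/32) * (X powr (3/32 + p) * Y powr (q - 3/4))"
    using assms by (intro mult_right_mono powr_mono2) auto
  also have "\<dots> = X powr (9/32 + (3/32 + p)) * Y powr (q - 3/4)"
    by (simp only: powr_add mult.assoc)
  also have "9/32 + (3/32 + p) = 3/8 + p" by simp
  also have "X powr (3/8 + p) * Y powr (q - 3/4) = X powr (3/8) / Y powr (3/4) * (X powr p * Y powr q)"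
    by (simp add: powr_add powr_diff)
  finally show ?thesis .
qed

text \<open>
  The losses are fixed at \<open>\<delta> = 1/16\<close> in \<open>9/16 = 1/2 + \<delta>\<close> and 1/16 in the mean squares, so that they use up exactly
  the gap between the bound that the method gives and the stated one.
\<close>
theorem shifted_sum_bound:
  fixes A :: "int \<Rightarrow> complex"
  assumes hb: "hankel_bounded (\<lambda>n. A (int n) * of_real (real n powr (- (9/16))))"
    and l: "l1 \<ge> 2" "l2 \<ge> 2"
  shows "\<exists>C>0. \<forall>X Y :: real. 1 \<le> Y \<longrightarrow> Y \<le> X \<longrightarrow>
     norm (\<Sum>n | 1 \<le> n \<and> real n \<le> X. \<Sum>m | 1 \<le> m \<and> real m \<le> Y. of_nat (r l1 n) * of_nat (r l2 m) * A (int (n + m)))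
       \<le> C * (X powr (3/8) / Y powr (3/4)) * (X powr (real l1 / 2) * Y powr (real l2 / 2))"
proof -
  obtain C0 where C0: "C0 \<ge> 0" and S: "\<And>X N M c d. X \<ge> 1 \<Longrightarrow> N \<subseteq> {n. 1 \<le> n \<and> real n \<le> X} \<Longrightarrow> M \<subseteq> {m. 1 \<le> m \<and> real m \<le> X} \<Longrightarrow>
     norm (\<Sum>n\<in>N. \<Sum>m\<in>M. c n * d m * A (int (n + m))) \<le>
       C0 * X powr (9/16) * (sqrt (\<Sum>n\<in>N. (norm (c n))\<^sup>2) * sqrt (\<Sum>m\<in>M. (norm (d m))\<^sup>2))"
    using hankel_bounded_untwist[OF hb] by auto
  obtain C1 where C1: "C1 > 0" "\<And>X. X \<ge> 1 \<Longrightarrow> (\<Sum>n | 1 \<le> n \<and> real n \<le> X. real (r l1 n) ^ 2) \<le> C1 * X powr (real l1 - 15/16)"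
    using sum_r_sq_bound[OF l(1)] by blast
  obtain C2 where C2: "C2 > 0" "\<And>X. X \<ge> 1 \<Longrightarrow> (\<Sum>n | 1 \<le> n \<and> real n \<le> X. real (r l2 n) ^ 2) \<le> C2 * X powr (real l2 - 15/16)"
    using sum_r_sq_bound[OF l(2)] by blast
  define C where "C = C0 * (sqrt C1 * sqrt C2)"
  have C: "C \<ge> 0" using C0 C1 C2 by (simp add: C_def)
  show ?thesis
  proof (intro exI[of _ "C + 1"] conjI allI impI)
    show "C + 1 > 0" using C by simp
    fix X Y :: real assume Y: "1 \<le> Y" and YX: "Y \<le> X"
    have X: "1 \<le> X" using Y YX by simp
    let ?N = "{n. 1 \<le> n \<and> real n \<le> X}" and ?M = "{m. 1 \<le> m \<and> real m \<le> Y}"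
    have sqrt_powr: "sqrt (D * Z powr (a - 15/16)) = sqrt D * Z powr (a / 2 - 15/32)" if "Z \<ge> 1" for D Z a :: real
    proof -
      have "sqrt (Z powr (a - 15/16)) = Z powr ((a - 15/16) * (1/2))"
        using that by (simp add: powr_half_sqrt[symmetric] powr_powr)
      then show ?thesis by (simp add: real_sqrt_mult field_simps)
    qed
    have "norm (\<Sum>n\<in>?N. \<Sum>m\<in>?M. of_nat (r l1 n) * of_nat (r l2 m) * A (int (n + m)))
       \<le> C0 * X powr (9/16) * (sqrt (\<Sum>n\<in>?N. (norm (of_nat (r l1 n) :: complex))\<^sup>2) * sqrt (\<Sum>m\<in>?M. (norm (of_nat (r l2 m) :: complex))\<^sup>2))"
      by (rule S[OF X]) (use YX in auto)
    also have "\<dots> \<le> C0 * X powr (9/16) * (sqrt (C1 * X powr (real l1 - 15/16)) * sqrt (C2 * Y powr (real l2 - 15/16)))"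
      using C1(2)[OF X] C2(2)[OF Y] C0 C1(1)
      by (intro mult_left_mono mult_mono real_sqrt_le_mono) (auto simp: sum_nonneg)
    also have "\<dots> = C * (X powr (9/16) * (X powr (real l1 / 2 - 15/32) * Y powr (real l2 / 2 - 15/32)))"
      unfolding sqrt_powr[OF X] sqrt_powr[OF Y] C_def by (simp only: mult_ac)
    also have "\<dots> \<le> (C + 1) * (X powr (3/8) / Y powr (3/4) * (X powr (real l1 / 2) * Y powr (real l2 / 2)))"
      using C by (intro mult_mono saving_exponents Y YX) auto
    finally show "norm (\<Sum>n\<in>?N. \<Sum>m\<in>?M. of_nat (r l1 n) * of_nat (r l2 m) * A (int (n + m)))
       \<le> (C + 1) * (X powr (3/8) / Y powr (3/4)) * (X powr (real l1 / 2) * Y powr (real l2 / 2))"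
      by (simp only: mult.assoc)
  qed
qed

theorem corollary1p3:
  fixes f :: "complex \<Rightarrow> complex" and A :: "int \<Rightarrow> complex" and l1 l2 :: nat
  assumes "(\<exists>k. hecke_holomorphic_cusp_form k f \<and> holomorphic_coeffs k f A) \<or>
           (\<exists>\<nu>. hecke_maass_cusp_form \<nu> f \<and> maass_coeffs \<nu> f A)"
    and "l1 > 4" and "l2 > 4"
  shows "\<forall>\<epsilon>::real. \<epsilon> > 0 \<longrightarrow>
     (\<exists>C>0. \<forall>X Y :: real. X \<ge> 1 \<longrightarrow> Y \<ge> 1 \<longrightarrow> Y < X powr (1 - \<epsilon>) \<longrightarrow>
        norm (\<Sum>n | 1 \<le> n \<and> real n \<le> X. \<Sum>m | 1 \<le> m \<and> real m \<le> Y.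
                of_nat (r l1 n) * of_nat (r l2 m) * A (int (n + m)))
          \<le> C * (X powr (3 / 8) / Y powr (3 / 4)) *
              (X powr (real l1 / 2) * Y powr (real l2 / 2)) powr (1 + \<epsilon>)) \<and>
     (\<forall>X Y :: real. X \<ge> 1 \<longrightarrow> Y \<ge> 1 \<longrightarrow> X powr (1 / 2) < Y \<longrightarrow> Y < X powr (1 - \<epsilon>) \<longrightarrow>
        X powr (3 / 8) / Y powr (3 / 4) < 1)"
proof (intro allI impI conjI)
  fix \<epsilon> :: real assume \<epsilon>: "\<epsilon> > 0"
  have "hankel_bounded (\<lambda>n. A (int n) * of_real (real n powr (- (9/16))))"
    using assms(1) holomorphic_hankel_bounded[of _ f A "1/16"] maass_hankel_bounded[of _ f A "1/16"] by auto
  then obtain C where C: "C > 0" and bound: "\<And>X Y. 1 \<le> Y \<Longrightarrow> Y \<le> X \<Longrightarrow>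
     norm (\<Sum>n | 1 \<le> n \<and> real n \<le> X. \<Sum>m | 1 \<le> m \<and> real m \<le> Y. of_nat (r l1 n) * of_nat (r l2 m) * A (int (n + m)))
       \<le> C * (X powr (3/8) / Y powr (3/4)) * (X powr (real l1 / 2) * Y powr (real l2 / 2))"
    using shifted_sum_bound[of A l1 l2] assms(2,3) by auto
  show "\<exists>C>0. \<forall>X Y :: real. X \<ge> 1 \<longrightarrow> Y \<ge> 1 \<longrightarrow> Y < X powr (1 - \<epsilon>) \<longrightarrow>
        norm (\<Sum>n | 1 \<le> n \<and> real n \<le> X. \<Sum>m | 1 \<le> m \<and> real m \<le> Y.
                of_nat (r l1 n) * of_nat (r l2 m) * A (int (n + m)))
          \<le> C * (X powr (3 / 8) / Y powr (3 / 4)) *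
              (X powr (real l1 / 2) * Y powr (real l2 / 2)) powr (1 + \<epsilon>)"
  proof (intro exI[of _ C] conjI allI impI C)
    fix X Y :: real assume X: "X \<ge> 1" and Y: "Y \<ge> 1" and YX: "Y < X powr (1 - \<epsilon>)"
    have "X powr (1 - \<epsilon>) \<le> X powr 1" using X \<epsilon> by (intro powr_mono) auto
    then have YX': "Y \<le> X" using YX X by simp
    let ?Q = "X powr (real l1 / 2) * Y powr (real l2 / 2)"
    have "1 * 1 \<le> ?Q" using X Y by (intro mult_mono ge_one_powr_ge_zero) auto
    then have "?Q powr 1 \<le> ?Q powr (1 + \<epsilon>)" using \<epsilon> by (intro powr_mono) auto
    then have Q: "?Q \<le> ?Q powr (1 + \<epsilon>)" using X Y by simp
    show "norm (\<Sum>n | 1 \<le> n \<and> real n \<le> X. \<Sum>m | 1 \<le> m \<and> real m \<le> Y.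
                of_nat (r l1 n) * of_nat (r l2 m) * A (int (n + m)))
          \<le> C * (X powr (3 / 8) / Y powr (3 / 4)) * ?Q powr (1 + \<epsilon>)"
      by (rule order_trans[OF bound[OF Y YX'] mult_left_mono[OF Q]]) (use C in simp)
  qed
next
  fix \<epsilon> X Y :: real assume X: "X \<ge> 1" and Y: "Y \<ge> 1" and XY: "X powr (1 / 2) < Y"
  have "X powr (3/8) = (X powr (1/2)) powr (3/4)" by (simp add: powr_powr)
  also have "\<dots> < Y powr (3/4)" using XY by (intro powr_less_mono2) auto
  finally show "X powr (3 / 8) / Y powr (3 / 4) < 1" using Y by simp
qed

end
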